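(* Let $T$ be a homogeneous $\mathcal{C}$-colored tangle with Reshetikhin-Turaev invariant $\mathcal{F}_{\mathcal{C}}(T)$. Then there is a morphism $j_\zeta(T)$ of $\mathrm{Inv}(\mathcal{C}_e)$ (from the tensor product of the invertible objects $\mu_1,\dots,\mu_n$ attached to the top boundary of $T$ to the tensor product of the invertible objects $\mu'_1,\dots,\mu'_m$ attached to the bottom boundary of $T$) such that the Reshetikhin-Turaev invariant of $T$ in the zested category is the warp product $$\mathcal{F}_{\mathcal{C}^\zeta}(T)=\mathcal{F}_{\mathcal{C}}(T)\;\rtimes\!\!\!\bigcirc\; j_\zeta(T).$$
   Context: **Categories.** $\Bbbk$ is an algebraically closed field of characteristic $0$ and $\mathcal{C}$ is a strict ribbon fusion category over $\Bbbk$ with unit $\mathbf 1$, braiding $\beta_{X,Y}:X\otimes Y\to Y\otimes X$, twists $\theta$, quantum dimension $\dim$, and (co)evaluations $\mathrm{ev}_X:X^*\otimes X\to\mathbf 1$, $\mathrm{coev}_X:\mathbf 1\to X\otimes X^*$, $\mathrm{ev}'_X:X\otimes X^*\to\mathbf 1$, $\mathrm{coev}'_X:\mathbf 1\to X^*\otimes X$. For an endomorphism $f$ of a simple object, $f=\langle f\rangle\,\mathrm{id}$. $A$ (finite abelian, identity $e$) is the universal grading group, $\mathcal{C}=\bigoplus_{a\in A}\mathcal{C}_a$; an object is homogeneous if it lies in some $\mathcal{C}_a$, and then $|X|=a$. $\mathrm{Inv}(\mathcal{C}_e)$ denotes (the full subcategory of) invertible objects in $\mathcal{C}_e$. For $\eta$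 invertible, $\chi_\eta:A\to\Bbbk^\times$ is the character with $\beta_{\eta,X}\circ\beta_{X,\eta}=\chi_\eta(a)\,\mathrm{id}_{X\otimes\eta}$ for simple $X\in\mathcal{C}_a$. **Ribbon zesting data** $\zeta=(\lambda,\nu,t,\epsilon)$: (a) $\lambda:A\times A\to\mathrm{Inv}(\mathcal{C}_e)$ with $\lambda(e,a)=\lambda(a,e)=\mathbf 1$; put $\omega(a,b;c)=\chi_{\lambda(a,b)}(c)$. (b) isomorphisms $\nu(a,b,c):\lambda(a,b)\otimes\lambda(ab,c)\to\lambda(b,c)\otimes\lambda(a,bc)$, equal to identities when one of $a,b,c$ is $e$, with $(\nu(b,c,d)\otimes\mathrm{id})(\mathrm{id}\otimes\nu(a,bc,d))(\nu(a,b,c)\otimes\mathrm{id})=(\mathrm{id}_{\lambda(c,d)}\otimes\nu(a,b,cd))(\beta_{\lambda(a,b),\lambda(c,d)}\otimes\mathrm{id})(\mathrm{id}_{\lambda(a,b)}\otimes\nu(ab,c,d))$. (c) isomorphisms $t(a,b):\lambda(a,b)\to\lambda(b,a)$, identities when $a$ or $b$ is $e$, with $\nu(b,c,a)(\mathrm{id}\otimes t(a,bc))\nu(a,b,c)=(t(a,c)\otimes\mathrm{id})\nu(b,a,c)(t(a,b)\otimes\mathrm{id})$ and $\omega(a,b;c)\,\nu(c,a,b)^{-1}(\mathrm{id}\otimes t(ab,c))\nu(a,b,c)^{-1}=(t(a,c)\otimes\mathrm{id})\nu(a,c,b)^{-1}(t(b,c)\otimes\mathrm{id})$. (d) $\epsilon:A\to\Bbbk^\times$,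 $\epsilon(e)=1$, $\epsilon(ab)/(\epsilon(a)\epsilon(b))=\dim\lambda(a,b)$, $\epsilon(a)^2=1$. All conditions are for all $a,b,c,d\in A$. Write $t(a)=\langle t(a,a)\rangle$, $\lambda(a)=\lambda(a,a^{-1})$, $\nu(a)=\nu(a,a^{-1},a):\lambda(a)\to\lambda(a^{-1})$. **Zested category** $\mathcal{C}^\zeta$: the ribbon fusion category with the same objects, morphisms, unit and grading as $\mathcal{C}$, and for $X\in\mathcal{C}_a,Y\in\mathcal{C}_b,Z\in\mathcal{C}_c$: tensor product $X\overset{\zeta}{\otimes}Y=X\otimes Y\otimes\lambda(a,b)$; associator $(\mathrm{id}_{X\otimes Y\otimes Z}\otimes\nu(a,b,c))\circ(\mathrm{id}_{X\otimes Y}\otimes\beta^{-1}_{Z,\lambda(a,b)}\otimes\mathrm{id}_{\lambda(ab,c)})$; braiding $\beta_{X,Y}\otimes t(a,b)$; twist $t(a)\epsilon(a)\theta_X$; dual $\overline{X}=X^*\otimes\lambda(a)^*$ with $\mathrm{coev}^\zeta_X=\dim(\lambda(a))^{-1}\,\mathrm{coev}_X\otimes\mathrm{coev}'_{\lambda(a)}$, $\mathrm{ev}^\zeta_X=\big(\mathrm{ev}_X\otimes(\mathrm{ev}_{\lambda(a)}(\mathrm{id}\otimes\nu(a)^{-1}))\big)(\mathrm{id}_{X^*}\otimes\beta^{-1}_{X,\lambda(a)^*}\otimes\mathrm{id}_{\lambda(a^{-1})})$, and right (co)evaluations induced by the ribbon structure. **Tangles.** A $\mathcal{C}$-colored tangle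 is an oriented framed tangle with components labelled by objects of $\mathcal{C}$; it is homogeneous if all labels are. Diagrams are read from top (source) to bottom (target). $\mathcal{F}_{\mathcal{C}}$ is the Reshetikhin-Turaev ribbon functor (a downward boundary point labelled $X$ goes to $X$, an upward one to its dual; the crossing whose over-strand goes from top left to bottom right goes to $\beta$). Since $\mathcal{C}^\zeta$ has the same objects, a $\mathcal{C}$-colored tangle is also $\mathcal{C}^\zeta$-colored; in $\mathcal{C}^\zeta$ all tensor products of boundary objects are left-associated. Thus for boundary points labelled $X_1,\dots,X_n$ with $|X_k|=a_k$ and orientations $\epsilon_k=\pm1$ ($+1$ downward), the boundary object of $\mathcal{F}_{\mathcal{C}^\zeta}(T)$ is $X_1^{\epsilon_1}\otimes\mu_1\otimes X_2^{\epsilon_2}\otimes\mu_2\otimes\cdots\otimes X_n^{\epsilon_n}\otimes\mu_n$, where $X^{+1}=X$, $X^{-1}=X^*$, and with $c_k=a_1^{\epsilon_1}\cdots a_{k-1}^{\epsilon_{k-1}}$ we set $\mu_k=\lambda(c_k,a_k)$ if $\epsilon_k=1$ and $\mu_k=\lambda(a_k)^*\otimes\lambda(c_k,a_k^{-1})$ if $\epsilon_k=-1$. **Warp product.** For $f:X_1\otimes\cdots\otimes X_n\to Y_1\otimes\cdots\otimes Y_m$ and $j:\lambda_1\otimes\cdots\otimes\lambda_n\to\mu_1\otimes\cdots\otimes\mu_m$ in $\mathcal{C}$, the warp product $f\rtimes\!\!\!\bigcirc j:X_1\otimes\lambda_1\otimes\cdots\otimes X_n\otimes\lambda_n\to Y_1\otimes\mu_1\otimes\cdots\otimes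 Y_m\otimes\mu_m$ is $\Sigma_{Y,\mu}^{-1}\circ(f\otimes j)\circ\Sigma_{X,\lambda}$, where $\Sigma_{X,\lambda}:X_1\otimes\lambda_1\otimes\cdots\otimes X_n\otimes\lambda_n\to X_1\otimes\cdots\otimes X_n\otimes\lambda_1\otimes\cdots\otimes\lambda_n$ moves every $\lambda_k$ to the right underneath the strands $X_l$, $l>k$ (i.e. using $\beta^{-1}_{X_l,\lambda_k}:\lambda_k\otimes X_l\to X_l\otimes\lambda_k$), and $\Sigma_{Y,\mu}$ is defined likewise. *)

theory Defs
  imports "HOL-Algebra.Group" "HOL-Computational_Algebra.Polynomial"
begin

section \<open>Linear categories with ribbon structure\<close>

text \<open>
  The data of a linear ribbon category whose unit constraints are identities. Every element of the
  types \<open>'o\<close> and \<open>'m\<close> is an object, respectively a morphism. The associator \<open>Assoc X Y Z\<close> goes from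
  \<open>(X \<odot> Y) \<odot> Z\<close> to \<open>X \<odot> (Y \<odot> Z)\<close>; it is kept as data because zesting turns a strict category into a
  non-strict one. \<open>Ev X : X* \<odot> X \<rightarrow> 1\<close> and \<open>Coev X : 1 \<rightarrow> X \<odot> X*\<close>.
\<close>

record ('o, 'm, 'k) ribbon_data =
  Dom :: "'m \<Rightarrow> 'o"
  Cod :: "'m \<Rightarrow> 'o"
  Ident :: "'o \<Rightarrow> 'm" ("\<i>\<d>\<index>")
  Cmp :: "'m \<Rightarrow> 'm \<Rightarrow> 'm" (infixr "\<cdot>\<index>" 55)
  Zero :: "'o \<Rightarrow> 'o \<Rightarrow> 'm"
  Add :: "'m \<Rightarrow> 'm \<Rightarrow> 'm"
  Smult :: "'k \<Rightarrow> 'm \<Rightarrow> 'm"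
  Unit :: "'o" ("\<I>\<index>")
  TenO :: "'o \<Rightarrow> 'o \<Rightarrow> 'o" (infixr "\<odot>\<index>" 70)
  TenM :: "'m \<Rightarrow> 'm \<Rightarrow> 'm" (infixr "\<star>\<index>" 70)
  Assoc :: "'o \<Rightarrow> 'o \<Rightarrow> 'o \<Rightarrow> 'm"
  Braid :: "'o \<Rightarrow> 'o \<Rightarrow> 'm" ("\<beta>\<index>")
  Twist :: "'o \<Rightarrow> 'm" ("\<theta>\<index>")
  Dual :: "'o \<Rightarrow> 'o"
  Ev :: "'o \<Rightarrow> 'm"
  Coev :: "'o \<Rightarrow> 'm"

definition hom_set :: "('o, 'm, 'k) ribbon_data \<Rightarrow> 'o \<Rightarrow> 'o \<Rightarrow> 'm set" where
  "hom_set C X Y = {f. Dom C f = X \<and> Cod C f = Y}"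

definition inverse_mors :: "('o, 'm, 'k) ribbon_data \<Rightarrow> 'm \<Rightarrow> 'm \<Rightarrow> bool" where
  "inverse_mors C f g \<longleftrightarrow> g \<in> hom_set C (Cod C f) (Dom C f) \<and>
     g \<cdot>\<^bsub>C\<^esub> f = \<i>\<d>\<^bsub>C\<^esub> (Dom C f) \<and> f \<cdot>\<^bsub>C\<^esub> g = \<i>\<d>\<^bsub>C\<^esub> (Cod C f)"

definition is_iso :: "('o, 'm, 'k) ribbon_data \<Rightarrow> 'm \<Rightarrow> bool" where
  "is_iso C f \<longleftrightarrow> (\<exists>g. inverse_mors C f g)"

definition minv :: "('o, 'm, 'k) ribbon_data \<Rightarrow> 'm \<Rightarrow> 'm" where
  "minv C f = (THE g. inverse_mors C f g)"

definition isomorphic :: "('o, 'm, 'k) ribbon_data \<Rightarrow> 'o \<Rightarrow> 'o \<Rightarrow> bool" where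
  "isomorphic C X Y \<longleftrightarrow> (\<exists>f \<in> hom_set C X Y. is_iso C f)"

definition mono_mor :: "('o, 'm, 'k) ribbon_data \<Rightarrow> 'm \<Rightarrow> bool" where
  "mono_mor C f \<longleftrightarrow> (\<forall>W. \<forall>g \<in> hom_set C W (Dom C f). \<forall>h \<in> hom_set C W (Dom C f).
     f \<cdot>\<^bsub>C\<^esub> g = f \<cdot>\<^bsub>C\<^esub> h \<longrightarrow> g = h)"

definition epi_mor :: "('o, 'm, 'k) ribbon_data \<Rightarrow> 'm \<Rightarrow> bool" where
  "epi_mor C f \<longleftrightarrow> (\<forall>W. \<forall>g \<in> hom_set C (Cod C f) W. \<forall>h \<in> hom_set C (Cod C f) W.
     g \<cdot>\<^bsub>C\<^esub> f = h \<cdot>\<^bsub>C\<^esub> f \<longrightarrow> g = h)"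

definition zero_object :: "('o, 'm, 'k) ribbon_data \<Rightarrow> 'o \<Rightarrow> bool" where
  "zero_object C Z \<longleftrightarrow> (\<forall>X. hom_set C Z X = {Zero C Z X} \<and> hom_set C X Z = {Zero C X Z})"

definition simple_object :: "('o, 'm, 'k) ribbon_data \<Rightarrow> 'o \<Rightarrow> bool" where
  "simple_object C X \<longleftrightarrow> \<not> zero_object C X \<and>
     (\<forall>f. Cod C f = X \<and> mono_mor C f \<longrightarrow> zero_object C (Dom C f) \<or> is_iso C f)"

definition kernel_of :: "('o, 'm, 'k) ribbon_data \<Rightarrow> 'm \<Rightarrow> 'm \<Rightarrow> bool" where
  "kernel_of C f k \<longleftrightarrow> Cod C k = Dom C f \<and> f \<cdot>\<^bsub>C\<^esub> k = Zero C (Dom C k) (Cod C f) \<and>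
     (\<forall>W. \<forall>g \<in> hom_set C W (Dom C f). f \<cdot>\<^bsub>C\<^esub> g = Zero C W (Cod C f) \<longrightarrow>
        (\<exists>!u. u \<in> hom_set C W (Dom C k) \<and> k \<cdot>\<^bsub>C\<^esub> u = g))"

definition cokernel_of :: "('o, 'm, 'k) ribbon_data \<Rightarrow> 'm \<Rightarrow> 'm \<Rightarrow> bool" where
  "cokernel_of C f q \<longleftrightarrow> Dom C q = Cod C f \<and> q \<cdot>\<^bsub>C\<^esub> f = Zero C (Dom C f) (Cod C q) \<and>
     (\<forall>W. \<forall>g \<in> hom_set C (Cod C f) W. g \<cdot>\<^bsub>C\<^esub> f = Zero C (Dom C f) W \<longrightarrow>
        (\<exists>!u. u \<in> hom_set C (Cod C q) W \<and> u \<cdot>\<^bsub>C\<^esub> q = g))"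

definition sum_mor :: "('o, 'm, 'k) ribbon_data \<Rightarrow> 'o \<Rightarrow> 'o \<Rightarrow> 'm list \<Rightarrow> 'm" where
  "sum_mor C X Y fs = foldr (Add C) fs (Zero C X Y)"

definition direct_sum :: "('o, 'm, 'k) ribbon_data \<Rightarrow> 'o \<Rightarrow> 'o list \<Rightarrow> bool" where
  "direct_sum C X Zs \<longleftrightarrow> (\<exists>\<iota> \<pi>.
     (\<forall>i < length Zs. \<iota> i \<in> hom_set C (Zs ! i) X \<and> \<pi> i \<in> hom_set C X (Zs ! i)) \<and>
     (\<forall>i < length Zs. \<forall>j < length Zs.
        \<pi> i \<cdot>\<^bsub>C\<^esub> \<iota> j = (if i = j then \<i>\<d>\<^bsub>C\<^esub> (Zs ! i) else Zero C (Zs ! j) (Zs ! i))) \<and>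
     sum_mor C X X (map (\<lambda>i. \<iota> i \<cdot>\<^bsub>C\<^esub> \<pi> i) [0..<length Zs]) = \<i>\<d>\<^bsub>C\<^esub> X)"

text \<open>The scalar \<open>\<langle>f\<rangle>\<close> of an endomorphism \<open>f\<close> of a simple object.\<close>

definition scalar_of :: "('o, 'm, 'k) ribbon_data \<Rightarrow> 'm \<Rightarrow> 'k" where
  "scalar_of C f = (THE s. f = Smult C s (\<i>\<d>\<^bsub>C\<^esub> (Dom C f)))"

text \<open>
  The right (co)evaluations \<open>X \<odot> X* \<rightarrow> 1\<close> and \<open>1 \<rightarrow> X* \<odot> X\<close> induced by the ribbon structure.
  No associators are needed, so the formulas also make sense in the non-strict case.
\<close>

definition Ev' :: "('o, 'm, 'k) ribbon_data \<Rightarrow> 'o \<Rightarrow> 'm" where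
  "Ev' C X = Ev C X \<cdot>\<^bsub>C\<^esub> \<beta>\<^bsub>C\<^esub> X (Dual C X) \<cdot>\<^bsub>C\<^esub> (\<theta>\<^bsub>C\<^esub> X \<star>\<^bsub>C\<^esub> \<i>\<d>\<^bsub>C\<^esub> (Dual C X))"

definition Coev' :: "('o, 'm, 'k) ribbon_data \<Rightarrow> 'o \<Rightarrow> 'm" where
  "Coev' C X = (\<i>\<d>\<^bsub>C\<^esub> (Dual C X) \<star>\<^bsub>C\<^esub> \<theta>\<^bsub>C\<^esub> X) \<cdot>\<^bsub>C\<^esub> \<beta>\<^bsub>C\<^esub> X (Dual C X) \<cdot>\<^bsub>C\<^esub> Coev C X"

definition qdim :: "('o, 'm, 'k) ribbon_data \<Rightarrow> 'o \<Rightarrow> 'k" where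
  "qdim C X = scalar_of C (Ev' C X \<cdot>\<^bsub>C\<^esub> Coev C X)"

section \<open>Strict ribbon fusion categories\<close>

locale linear_category =
  fixes C :: "('o, 'm, 'k::{alg_closed_field,field_char_0}) ribbon_data" (structure)
  assumes Id_in_hom: "\<i>\<d> X \<in> hom_set C X X"
    and Cmp_in_hom: "f \<in> hom_set C X Y \<Longrightarrow> g \<in> hom_set C Y Z \<Longrightarrow> g \<cdot> f \<in> hom_set C X Z"
    and Cmp_Id: "f \<in> hom_set C X Y \<Longrightarrow> f \<cdot> \<i>\<d> X = f"
    and Id_Cmp: "f \<in> hom_set C X Y \<Longrightarrow> \<i>\<d> Y \<cdot> f = f"
    and Cmp_assoc: "f \<in> hom_set C W X \<Longrightarrow> g \<in> hom_set C X Y \<Longrightarrow> h \<in> hom_set C Y Z \<Longrightarrow>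
        (h \<cdot> g) \<cdot> f = h \<cdot> (g \<cdot> f)"
    and Zero_in_hom: "Zero C X Y \<in> hom_set C X Y"
    and Add_in_hom: "f \<in> hom_set C X Y \<Longrightarrow> g \<in> hom_set C X Y \<Longrightarrow> Add C f g \<in> hom_set C X Y"
    and Smult_in_hom: "f \<in> hom_set C X Y \<Longrightarrow> Smult C s f \<in> hom_set C X Y"
    and Add_assoc: "f \<in> hom_set C X Y \<Longrightarrow> g \<in> hom_set C X Y \<Longrightarrow> h \<in> hom_set C X Y \<Longrightarrow>
        Add C (Add C f g) h = Add C f (Add C g h)"
    and Add_commute: "f \<in> hom_set C X Y \<Longrightarrow> g \<in> hom_set C X Y \<Longrightarrow> Add C f g = Add C g f"
    and Add_Zero: "f \<in> hom_set C X Y \<Longrightarrow> Add C f (Zero C X Y) = f"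
    and Add_uminus: "f \<in> hom_set C X Y \<Longrightarrow> Add C f (Smult C (- 1) f) = Zero C X Y"
    and Smult_one: "Smult C 1 f = f"
    and Smult_Smult: "Smult C r (Smult C s f) = Smult C (r * s) f"
    and Smult_add: "Smult C (r + s) f = Add C (Smult C r f) (Smult C s f)"
    and Smult_Add: "f \<in> hom_set C X Y \<Longrightarrow> g \<in> hom_set C X Y \<Longrightarrow>
        Smult C s (Add C f g) = Add C (Smult C s f) (Smult C s g)"
    and Cmp_Add_left: "f \<in> hom_set C X Y \<Longrightarrow> g \<in> hom_set C Y Z \<Longrightarrow> h \<in> hom_set C Y Z \<Longrightarrow>
        Add C g h \<cdot> f = Add C (g \<cdot> f) (h \<cdot> f)"
    and Cmp_Add_right: "f \<in> hom_set C X Y \<Longrightarrow> g \<in> hom_set C X Y \<Longrightarrow> h \<in> hom_set C Y Z \<Longrightarrow>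
        h \<cdot> Add C f g = Add C (h \<cdot> f) (h \<cdot> g)"
    and Cmp_Smult_left: "f \<in> hom_set C X Y \<Longrightarrow> g \<in> hom_set C Y Z \<Longrightarrow>
        Smult C s g \<cdot> f = Smult C s (g \<cdot> f)"
    and Cmp_Smult_right: "f \<in> hom_set C X Y \<Longrightarrow> g \<in> hom_set C Y Z \<Longrightarrow>
        g \<cdot> Smult C s f = Smult C s (g \<cdot> f)"

locale finite_semisimple_category = linear_category C
  for C :: "('o, 'm, 'k::{alg_closed_field,field_char_0}) ribbon_data" (structure) +
  assumes ex_zero_object: "\<exists>Z. zero_object C Z"
    and ex_direct_sum: "\<exists>S. direct_sum C S [X, Y]"
    and ex_kernel: "\<exists>k. kernel_of C f k"
    and ex_cokernel: "\<exists>q. cokernel_of C f q"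
    and mono_is_kernel: "mono_mor C k \<Longrightarrow> \<exists>f. kernel_of C f k"
    and epi_is_cokernel: "epi_mor C q \<Longrightarrow> \<exists>f. cokernel_of C f q"
    and semisimple: "\<exists>Zs. (\<forall>Z \<in> set Zs. simple_object C Z) \<and> direct_sum C X Zs"
    and finitely_many_simples:
      "\<exists>I. finite I \<and> (\<forall>X. simple_object C X \<longrightarrow> (\<exists>Y \<in> I. isomorphic C X Y))"
    and finite_dimensional_hom: "\<exists>B. set B \<subseteq> hom_set C X Y \<and>
      (\<forall>f \<in> hom_set C X Y. \<exists>cs. length cs = length B \<and> f = sum_mor C X Y (map2 (Smult C) cs B))"

locale strict_ribbon_fusion_category = finite_semisimple_category C
  for C :: "('o, 'm, 'k::{alg_closed_field,field_char_0}) ribbon_data" (structure) +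
  assumes TenO_assoc: "(X \<odot> Y) \<odot> Z = X \<odot> (Y \<odot> Z)"
    and TenO_Unit: "X \<odot> \<I> = X"
    and Unit_TenO: "\<I> \<odot> X = X"
    and TenM_in_hom: "f \<in> hom_set C X X' \<Longrightarrow> g \<in> hom_set C Y Y' \<Longrightarrow>
        f \<star> g \<in> hom_set C (X \<odot> Y) (X' \<odot> Y')"
    and TenM_Id: "\<i>\<d> X \<star> \<i>\<d> Y = \<i>\<d> (X \<odot> Y)"
    and TenM_Cmp: "f \<in> hom_set C X X' \<Longrightarrow> f' \<in> hom_set C X' X'' \<Longrightarrow>
        g \<in> hom_set C Y Y' \<Longrightarrow> g' \<in> hom_set C Y' Y'' \<Longrightarrow>
        (f' \<cdot> f) \<star> (g' \<cdot> g) = (f' \<star> g') \<cdot> (f \<star> g)"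
    and TenM_assoc: "(f \<star> g) \<star> h = f \<star> (g \<star> h)"
    and TenM_Unit: "f \<star> \<i>\<d> \<I> = f"
    and Unit_TenM: "\<i>\<d> \<I> \<star> f = f"
    and TenM_Add_left: "f \<in> hom_set C X X' \<Longrightarrow> g \<in> hom_set C X X' \<Longrightarrow>
        Add C f g \<star> h = Add C (f \<star> h) (g \<star> h)"
    and TenM_Add_right: "f \<in> hom_set C X X' \<Longrightarrow> g \<in> hom_set C X X' \<Longrightarrow>
        h \<star> Add C f g = Add C (h \<star> f) (h \<star> g)"
    and TenM_Smult_left: "Smult C s f \<star> g = Smult C s (f \<star> g)"
    and TenM_Smult_right: "f \<star> Smult C s g = Smult C s (f \<star> g)"
    and Assoc_strict: "Assoc C X Y Z = \<i>\<d> (X \<odot> Y \<odot> Z)"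
    and simple_Unit: "simple_object C \<I>"
    and Ev_in_hom: "Ev C X \<in> hom_set C (Dual C X \<odot> X) \<I>"
    and Coev_in_hom: "Coev C X \<in> hom_set C \<I> (X \<odot> Dual C X)"
    and zigzag: "(\<i>\<d> X \<star> Ev C X) \<cdot> (Coev C X \<star> \<i>\<d> X) = \<i>\<d> X"
    and zigzag_Dual: "(Ev C X \<star> \<i>\<d> (Dual C X)) \<cdot> (\<i>\<d> (Dual C X) \<star> Coev C X) = \<i>\<d> (Dual C X)"
    and Braid_in_hom: "\<beta> X Y \<in> hom_set C (X \<odot> Y) (Y \<odot> X)"
    and Braid_iso: "is_iso C (\<beta> X Y)"
    and Braid_natural: "f \<in> hom_set C X X' \<Longrightarrow> g \<in> hom_set C Y Y' \<Longrightarrow>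
        \<beta> X' Y' \<cdot> (f \<star> g) = (g \<star> f) \<cdot> \<beta> X Y"
    and hexagon_left: "\<beta> (X \<odot> Y) Z = (\<beta> X Z \<star> \<i>\<d> Y) \<cdot> (\<i>\<d> X \<star> \<beta> Y Z)"
    and hexagon_right: "\<beta> X (Y \<odot> Z) = (\<i>\<d> Y \<star> \<beta> X Z) \<cdot> (\<beta> X Y \<star> \<i>\<d> Z)"
    and Twist_in_hom: "\<theta> X \<in> hom_set C X X"
    and Twist_iso: "is_iso C (\<theta> X)"
    and Twist_natural: "f \<in> hom_set C X Y \<Longrightarrow> \<theta> Y \<cdot> f = f \<cdot> \<theta> X"
    and Twist_balanced: "\<theta> (X \<odot> Y) = \<beta> Y X \<cdot> \<beta> X Y \<cdot> (\<theta> X \<star> \<theta> Y)"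
    \<comment> \<open>the twist of the dual is the dual morphism of the twist\<close>
    and Twist_Dual: "\<theta> (Dual C X) = (Ev C X \<star> \<i>\<d> (Dual C X)) \<cdot>
        (\<i>\<d> (Dual C X) \<star> \<theta> X \<star> \<i>\<d> (Dual C X)) \<cdot> (\<i>\<d> (Dual C X) \<star> Coev C X)"

section \<open>Gradings\<close>

text \<open>
  A grading is given by the replete full subcategories \<open>D g\<close> with \<open>g \<in> carrier G\<close>, each described
  by its set of objects.
\<close>

locale category_grading =
  fixes C :: "('o, 'm, 'k) ribbon_data" and G :: "'g monoid" and D :: "'g \<Rightarrow> 'o set"
  assumes group_G: "group G"
    and replete: "g \<in> carrier G \<Longrightarrow> X \<in> D g \<Longrightarrow> isomorphic C X Y \<Longrightarrow> Y \<in> D g"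
    and orthogonal: "g \<in> carrier G \<Longrightarrow> h \<in> carrier G \<Longrightarrow> g \<noteq> h \<Longrightarrow> X \<in> D g \<Longrightarrow> Y \<in> D h \<Longrightarrow>
        hom_set C X Y = {Zero C X Y}"
    and decomposition: "\<exists>gs Z. distinct gs \<and> set gs \<subseteq> carrier G \<and> (\<forall>g \<in> set gs. Z g \<in> D g) \<and>
        direct_sum C X (map Z gs)"
    and TenO_graded: "g \<in> carrier G \<Longrightarrow> h \<in> carrier G \<Longrightarrow> X \<in> D g \<Longrightarrow> Y \<in> D h \<Longrightarrow>
        X \<odot>\<^bsub>C\<^esub> Y \<in> D (g \<otimes>\<^bsub>G\<^esub> h)"

text \<open>
  The homogeneous components that are nonzero for some grading of a fusion category form a finite
  subgroup, so in the universal property it suffices to consider groups carried by sets of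
  natural numbers.
\<close>

locale universal_grading = category_grading C A Cg
  for C :: "('o, 'm, 'k) ribbon_data" and A :: "'a monoid" and Cg :: "'a \<Rightarrow> 'o set" +
  assumes faithful: "a \<in> carrier A \<Longrightarrow> \<exists>X \<in> Cg a. \<not> zero_object C X"
    and universal: "category_grading C (H :: nat monoid) E \<Longrightarrow>
        \<exists>\<phi> \<in> hom A H. \<forall>a \<in> carrier A. Cg a \<subseteq> E (\<phi> a)"

text \<open>The zero object lies in every component; it has no degree and does not count as homogeneous.\<close>

definition homogeneous ::
  "('o, 'm, 'k) ribbon_data \<Rightarrow> 'a monoid \<Rightarrow> ('a \<Rightarrow> 'o set) \<Rightarrow> 'o \<Rightarrow> bool" where
  "homogeneous C A Cg X \<longleftrightarrow> \<not> zero_object C X \<and> (\<exists>a \<in> carrier A. X \<in> Cg a)"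

definition deg :: "'a monoid \<Rightarrow> ('a \<Rightarrow> 'o set) \<Rightarrow> 'o \<Rightarrow> 'a" where
  "deg A Cg X = (THE a. a \<in> carrier A \<and> X \<in> Cg a)"

definition invertible_objects :: "('o, 'm, 'k) ribbon_data \<Rightarrow> 'o set" where
  "invertible_objects C = {X. \<exists>Y. isomorphic C (X \<odot>\<^bsub>C\<^esub> Y) \<I>\<^bsub>C\<^esub> \<and> isomorphic C (Y \<odot>\<^bsub>C\<^esub> X) \<I>\<^bsub>C\<^esub>}"

text \<open>Objects and hom-sets of the full subcategory of invertible objects of degree \<open>\<one>\<^bsub>A\<^esub>\<close>.\<close>

definition Inv_e :: "('o, 'm, 'k) ribbon_data \<Rightarrow> 'a monoid \<Rightarrow> ('a \<Rightarrow> 'o set) \<Rightarrow> 'o set" where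
  "Inv_e C A Cg = invertible_objects C \<inter> Cg \<one>\<^bsub>A\<^esub>"

definition Inv_e_hom ::
  "('o, 'm, 'k) ribbon_data \<Rightarrow> 'a monoid \<Rightarrow> ('a \<Rightarrow> 'o set) \<Rightarrow> 'o \<Rightarrow> 'o \<Rightarrow> 'm set" where
  "Inv_e_hom C A Cg L M =
     {j. L \<in> Inv_e C A Cg \<and> M \<in> Inv_e C A Cg \<and> j \<in> hom_set C L M}"

definition chi :: "('o, 'm, 'k) ribbon_data \<Rightarrow> ('a \<Rightarrow> 'o set) \<Rightarrow> 'o \<Rightarrow> 'a \<Rightarrow> 'k" where
  "chi C Cg \<eta> a = (THE s. \<forall>X \<in> Cg a. simple_object C X \<longrightarrow>
     \<beta>\<^bsub>C\<^esub> \<eta> X \<cdot>\<^bsub>C\<^esub> \<beta>\<^bsub>C\<^esub> X \<eta> = Smult C s (\<i>\<d>\<^bsub>C\<^esub> (X \<odot>\<^bsub>C\<^esub> \<eta>)))"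

section \<open>Ribbon zesting\<close>


text \<open>
  The parameters \<open>lam\<close>, \<open>nu\<close>, \<open>t\<close>, \<open>eps\<close> are the components of the zesting data
  \<open>\<zeta> = (\<lambda>, \<nu>, t, \<epsilon>)\<close>; only their values on \<open>carrier A\<close> matter.
\<close>

locale ribbon_zesting =
  fixes C :: "('o, 'm, 'k::field) ribbon_data" (structure)
    and A :: "'a monoid"
    and Cg :: "'a \<Rightarrow> 'o set"
    and lam :: "'a \<Rightarrow> 'a \<Rightarrow> 'o"
    and nu :: "'a \<Rightarrow> 'a \<Rightarrow> 'a \<Rightarrow> 'm"
    and t :: "'a \<Rightarrow> 'a \<Rightarrow> 'm"
    and eps :: "'a \<Rightarrow> 'k"
  assumes lam_Inv: "a \<in> carrier A \<Longrightarrow> b \<in> carrier A \<Longrightarrow> lam a b \<in> Inv_e C A Cg"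
    and lam_one: "a \<in> carrier A \<Longrightarrow> lam \<one>\<^bsub>A\<^esub> a = \<I> \<and> lam a \<one>\<^bsub>A\<^esub> = \<I>"
    and nu_in_hom: "a \<in> carrier A \<Longrightarrow> b \<in> carrier A \<Longrightarrow> c \<in> carrier A \<Longrightarrow>
        nu a b c \<in> hom_set C (lam a b \<odot> lam (a \<otimes>\<^bsub>A\<^esub> b) c) (lam b c \<odot> lam a (b \<otimes>\<^bsub>A\<^esub> c))"
    and nu_iso: "a \<in> carrier A \<Longrightarrow> b \<in> carrier A \<Longrightarrow> c \<in> carrier A \<Longrightarrow> is_iso C (nu a b c)"
    and nu_one: "a \<in> carrier A \<Longrightarrow> b \<in> carrier A \<Longrightarrow> c \<in> carrier A \<Longrightarrow> \<one>\<^bsub>A\<^esub> \<in> {a, b, c} \<Longrightarrow>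
        nu a b c = \<i>\<d> (lam a b \<odot> lam (a \<otimes>\<^bsub>A\<^esub> b) c)"
    and associative_zesting:
      "a \<in> carrier A \<Longrightarrow> b \<in> carrier A \<Longrightarrow> c \<in> carrier A \<Longrightarrow> d \<in> carrier A \<Longrightarrow>
        (nu b c d \<star> \<i>\<d> (lam a (b \<otimes>\<^bsub>A\<^esub> c \<otimes>\<^bsub>A\<^esub> d))) \<cdot>
        (\<i>\<d> (lam b c) \<star> nu a (b \<otimes>\<^bsub>A\<^esub> c) d) \<cdot>
        (nu a b c \<star> \<i>\<d> (lam (a \<otimes>\<^bsub>A\<^esub> b \<otimes>\<^bsub>A\<^esub> c) d))
      = (\<i>\<d> (lam c d) \<star> nu a b (c \<otimes>\<^bsub>A\<^esub> d)) \<cdot>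
        (\<beta> (lam a b) (lam c d) \<star> \<i>\<d> (lam (a \<otimes>\<^bsub>A\<^esub> b) (c \<otimes>\<^bsub>A\<^esub> d))) \<cdot>
        (\<i>\<d> (lam a b) \<star> nu (a \<otimes>\<^bsub>A\<^esub> b) c d)"
    and t_in_hom: "a \<in> carrier A \<Longrightarrow> b \<in> carrier A \<Longrightarrow> t a b \<in> hom_set C (lam a b) (lam b a)"
    and t_iso: "a \<in> carrier A \<Longrightarrow> b \<in> carrier A \<Longrightarrow> is_iso C (t a b)"
    and t_one: "a \<in> carrier A \<Longrightarrow> b \<in> carrier A \<Longrightarrow> \<one>\<^bsub>A\<^esub> \<in> {a, b} \<Longrightarrow> t a b = \<i>\<d> (lam a b)"
    and braided_zesting_1: "a \<in> carrier A \<Longrightarrow> b \<in> carrier A \<Longrightarrow> c \<in> carrier A \<Longrightarrow>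
        nu b c a \<cdot> (\<i>\<d> (lam b c) \<star> t a (b \<otimes>\<^bsub>A\<^esub> c)) \<cdot> nu a b c
      = (t a c \<star> \<i>\<d> (lam b (a \<otimes>\<^bsub>A\<^esub> c))) \<cdot> nu b a c \<cdot> (t a b \<star> \<i>\<d> (lam (a \<otimes>\<^bsub>A\<^esub> b) c))"
    and braided_zesting_2: "a \<in> carrier A \<Longrightarrow> b \<in> carrier A \<Longrightarrow> c \<in> carrier A \<Longrightarrow>
        Smult C (chi C Cg (lam a b) c)
          (minv C (nu c a b) \<cdot> (\<i>\<d> (lam a b) \<star> t (a \<otimes>\<^bsub>A\<^esub> b) c) \<cdot> minv C (nu a b c))
      = (t a c \<star> \<i>\<d> (lam (a \<otimes>\<^bsub>A\<^esub> c) b)) \<cdot> minv C (nu a c b) \<cdot> (t b c \<star> \<i>\<d> (lam a (b \<otimes>\<^bsub>A\<^esub> c)))"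
    and eps_nonzero: "a \<in> carrier A \<Longrightarrow> eps a \<noteq> 0"
    and eps_one: "eps \<one>\<^bsub>A\<^esub> = 1"
    and eps_mult: "a \<in> carrier A \<Longrightarrow> b \<in> carrier A \<Longrightarrow>
        eps (a \<otimes>\<^bsub>A\<^esub> b) / (eps a * eps b) = qdim C (lam a b)"
    and eps_square: "a \<in> carrier A \<Longrightarrow> (eps a)\<^sup>2 = 1"

text \<open>
  The zested category has the same objects, morphisms, composition, linear structure and unit.
  The formulas below define its structure on homogeneous objects (and on morphisms between them),
  from which the structure on arbitrary objects is obtained by additivity. The values outside
  homogeneous objects are irrelevant here, because homogeneous objects are closed under the tensor
  product and duals.
\<close>

definition zested ::
  "('o, 'm, 'k::field) ribbon_data \<Rightarrow> 'a monoid \<Rightarrow> ('a \<Rightarrow> 'o set) \<Rightarrow>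
   ('a \<Rightarrow> 'a \<Rightarrow> 'o) \<Rightarrow> ('a \<Rightarrow> 'a \<Rightarrow> 'a \<Rightarrow> 'm) \<Rightarrow> ('a \<Rightarrow> 'a \<Rightarrow> 'm) \<Rightarrow> ('a \<Rightarrow> 'k) \<Rightarrow>
   ('o, 'm, 'k) ribbon_data" where
  "zested C A Cg lam nu t eps = C\<lparr>
     TenO := (\<lambda>X Y. X \<odot>\<^bsub>C\<^esub> Y \<odot>\<^bsub>C\<^esub> lam (deg A Cg X) (deg A Cg Y)),
     TenM := (\<lambda>f g. f \<star>\<^bsub>C\<^esub> g \<star>\<^bsub>C\<^esub>
        \<i>\<d>\<^bsub>C\<^esub> (lam (deg A Cg (Dom C f)) (deg A Cg (Dom C g)))),
     Assoc := (\<lambda>X Y Z. let a = deg A Cg X; b = deg A Cg Y; c = deg A Cg Z in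
        (\<i>\<d>\<^bsub>C\<^esub> (X \<odot>\<^bsub>C\<^esub> Y \<odot>\<^bsub>C\<^esub> Z) \<star>\<^bsub>C\<^esub> nu a b c) \<cdot>\<^bsub>C\<^esub>
        (\<i>\<d>\<^bsub>C\<^esub> (X \<odot>\<^bsub>C\<^esub> Y) \<star>\<^bsub>C\<^esub> minv C (\<beta>\<^bsub>C\<^esub> Z (lam a b)) \<star>\<^bsub>C\<^esub> \<i>\<d>\<^bsub>C\<^esub> (lam (a \<otimes>\<^bsub>A\<^esub> b) c))),
     Braid := (\<lambda>X Y. \<beta>\<^bsub>C\<^esub> X Y \<star>\<^bsub>C\<^esub> t (deg A Cg X) (deg A Cg Y)),
     Twist := (\<lambda>X. let a = deg A Cg X in
        Smult C (scalar_of C (t a a) * eps a) (\<theta>\<^bsub>C\<^esub> X)),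
     Dual := (\<lambda>X. let a = deg A Cg X in Dual C X \<odot>\<^bsub>C\<^esub> Dual C (lam a (inv\<^bsub>A\<^esub> a))),
     Ev := (\<lambda>X. let a = deg A Cg X; a' = inv\<^bsub>A\<^esub> a; L = lam a a'; L' = lam a' a in
        (Ev C X \<star>\<^bsub>C\<^esub> (Ev C L \<cdot>\<^bsub>C\<^esub> (\<i>\<d>\<^bsub>C\<^esub> (Dual C L) \<star>\<^bsub>C\<^esub> minv C (nu a a' a)))) \<cdot>\<^bsub>C\<^esub>
        (\<i>\<d>\<^bsub>C\<^esub> (Dual C X) \<star>\<^bsub>C\<^esub> minv C (\<beta>\<^bsub>C\<^esub> X (Dual C L)) \<star>\<^bsub>C\<^esub> \<i>\<d>\<^bsub>C\<^esub> L')),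
     Coev := (\<lambda>X. let a = deg A Cg X; L = lam a (inv\<^bsub>A\<^esub> a) in
        Smult C (inverse (qdim C L)) (Coev C X \<star>\<^bsub>C\<^esub> Coev' C L)) \<rparr>"

section \<open>Colored framed tangles\<close>

text \<open>
  Framed oriented tangles are represented by blackboard-framed diagrams in generic position, cut
  into horizontal slices that contain one crossing, cap or cup each, modulo framed isotopy. A
  boundary point \<open>(X, True)\<close> belongs to a downward strand labelled \<open>X\<close>, \<open>(X, False)\<close> to an upward
  one. Diagrams are read from top to bottom.

  \<^item> \<open>OverX p q\<close>: from \<open>p, q\<close> to \<open>q, p\<close>, the over-strand goes from top left to bottom right;
  \<^item> \<open>UnderX p q\<close>: from \<open>p, q\<close> to \<open>q, p\<close>, the over-strand goes from top right to bottom left;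
  \<^item> \<open>Cap p\<close>: from \<open>p, flip p\<close> to the empty word (the strand turns back up);
  \<^item> \<open>Cup p\<close>: from the empty word to \<open>p, flip p\<close>.
\<close>

type_synonym 'o point = "'o \<times> bool"

definition flip :: "'o point \<Rightarrow> 'o point" where
  "flip p = (fst p, \<not> snd p)"

datatype 'o elementary =
    OverX "'o point" "'o point"
  | UnderX "'o point" "'o point"
  | Cap "'o point"
  | Cup "'o point"

fun top_of :: "'o elementary \<Rightarrow> 'o point list" where
  "top_of (OverX p q) = [p, q]"
| "top_of (UnderX p q) = [p, q]"
| "top_of (Cap p) = [p, flip p]"
| "top_of (Cup p) = []"

fun bot_of :: "'o elementary \<Rightarrow> 'o point list" where
  "bot_of (OverX p q) = [q, p]"
| "bot_of (UnderX p q) = [q, p]"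
| "bot_of (Cap p) = []"
| "bot_of (Cup p) = [p, flip p]"

text \<open>The slice \<open>(P, g, Q)\<close> is \<open>g\<close> with vertical strands \<open>P\<close> to its left and \<open>Q\<close> to its right.\<close>

type_synonym 'o slice = "'o point list \<times> 'o elementary \<times> 'o point list"

fun slice_top :: "'o slice \<Rightarrow> 'o point list" where
  "slice_top (P, g, Q) = P @ top_of g @ Q"

fun slice_bot :: "'o slice \<Rightarrow> 'o point list" where
  "slice_bot (P, g, Q) = P @ bot_of g @ Q"

type_synonym 'o diagram = "'o point list \<times> 'o slice list"

fun stacked :: "'o point list \<Rightarrow> 'o slice list \<Rightarrow> bool" where
  "stacked w [] = True"
| "stacked w (s # ss) = (slice_top s = w \<and> stacked (slice_bot s) ss)"

definition diagrams :: "'o diagram set" where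
  "diagrams = {(w, ss). stacked w ss}"

definition diagram_top :: "'o diagram \<Rightarrow> 'o point list" where
  "diagram_top d = fst d"

definition diagram_bot :: "'o diagram \<Rightarrow> 'o point list" where
  "diagram_bot d = (if snd d = [] then fst d else slice_bot (last (snd d)))"

definition whisker :: "'o point list \<Rightarrow> 'o point list \<Rightarrow> 'o slice list \<Rightarrow> 'o slice list" where
  "whisker P Q = map (\<lambda>(P', g, Q'). (P @ P', g, Q' @ Q))"

text \<open>
  The local moves generating isotopy of framed tangle diagrams. As all elementary pieces exist for
  all orientations of their strands, one version of each move covers all orientations.
\<close>

inductive local_move :: "'o slice list \<Rightarrow> 'o slice list \<Rightarrow> bool" where
  interchange:
    "local_move [([], g, P @ top_of h), (bot_of g @ P, h, [])]
                [(top_of g @ P, h, []), ([], g, P @ bot_of h)]"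
| straighten_left: "local_move [([], Cup p, [p]), ([p], Cap (flip p), [])] []"
| straighten_right: "local_move [([p], Cup (flip p), []), ([], Cap p, [p])] []"
| framed_R1:
    "local_move [([p], Cup p, []), ([], OverX p p, [flip p]), ([p], Cap p, [])]
                [([], Cup (flip p), [p]), ([flip p], OverX p p, []), ([], Cap (flip p), [p])]"
| R2: "local_move [([], OverX p q, []), ([], UnderX q p, [])] []"
| R2': "local_move [([], UnderX p q, []), ([], OverX q p, [])] []"
| R3:
    "local_move [([], OverX p q, [r]), ([q], OverX p r, []), ([], OverX q r, [p])]
                [([p], OverX q r, []), ([], OverX p r, [q]), ([r], OverX p q, [])]"
| over_cap:
    "local_move [([], OverX r p, [flip p]), ([p], OverX r (flip p), []), ([], Cap p, [r])]
                [([r], Cap p, [])]"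
| under_cap:
    "local_move [([], UnderX r p, [flip p]), ([p], UnderX r (flip p), []), ([], Cap p, [r])]
                [([r], Cap p, [])]"
| over_cup:
    "local_move [([r], Cup p, []), ([], OverX r p, [flip p]), ([p], OverX r (flip p), [])]
                [([], Cup p, [r])]"
| under_cup:
    "local_move [([r], Cup p, []), ([], UnderX r p, [flip p]), ([p], UnderX r (flip p), [])]
                [([], Cup p, [r])]"

inductive isotopy_step :: "'o diagram \<Rightarrow> 'o diagram \<Rightarrow> bool" where
  "local_move L R \<Longrightarrow>
   (w, ss @ whisker P Q L @ ss') \<in> diagrams \<Longrightarrow> (w, ss @ whisker P Q R @ ss') \<in> diagrams \<Longrightarrow>
   isotopy_step (w, ss @ whisker P Q L @ ss') (w, ss @ whisker P Q R @ ss')"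

definition isotopy :: "'o diagram rel" where
  "isotopy = {(d, d'). d \<in> diagrams \<and> d' \<in> diagrams \<and> equivclp isotopy_step d d'}"

type_synonym 'o tangle = "'o diagram set"

definition tangles :: "'o tangle set" where
  "tangles = diagrams // isotopy"

definition representative :: "'o tangle \<Rightarrow> 'o diagram" where
  "representative T = (SOME d. d \<in> T)"

definition tangle_top :: "'o tangle \<Rightarrow> 'o point list" where
  "tangle_top T = diagram_top (representative T)"

definition tangle_bot :: "'o tangle \<Rightarrow> 'o point list" where
  "tangle_bot T = diagram_bot (representative T)"

definition labels :: "'o diagram \<Rightarrow> 'o set" where
  "labels d = fst ` (set (fst d) \<union> (\<Union>s \<in> set (snd d). set (slice_top s) \<union> set (slice_bot s)))"

definition homogeneous_tangle ::
  "('o, 'm, 'k) ribbon_data \<Rightarrow> 'a monoid \<Rightarrow> ('a \<Rightarrow> 'o set) \<Rightarrow> 'o tangle \<Rightarrow> bool" where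
  "homogeneous_tangle C A Cg T \<longleftrightarrow> (\<forall>d \<in> T. \<forall>X \<in> labels d. homogeneous C A Cg X)"

section \<open>The Reshetikhin-Turaev functor\<close>

text \<open>
  The functor is defined for arbitrary data with strict unit, so that it applies to the strict
  category and to its zestings. Tensor products of boundary objects are left-associated.
\<close>

definition point_obj :: "('o, 'm, 'k) ribbon_data \<Rightarrow> 'o point \<Rightarrow> 'o" where
  "point_obj R p = (if snd p then fst p else Dual R (fst p))"

definition word_obj :: "('o, 'm, 'k) ribbon_data \<Rightarrow> 'o point list \<Rightarrow> 'o" where
  "word_obj R w = foldl (TenO R) \<I>\<^bsub>R\<^esub> (map (point_obj R) w)"

fun elementary_mor :: "('o, 'm, 'k) ribbon_data \<Rightarrow> 'o elementary \<Rightarrow> 'm" where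
  "elementary_mor R (OverX p q) = \<beta>\<^bsub>R\<^esub> (point_obj R p) (point_obj R q)"
| "elementary_mor R (UnderX p q) = minv R (\<beta>\<^bsub>R\<^esub> (point_obj R q) (point_obj R p))"
| "elementary_mor R (Cap p) = (if snd p then Ev' R (fst p) else Ev R (fst p))"
| "elementary_mor R (Cup p) = (if snd p then Coev R (fst p) else Coev' R (fst p))"

text \<open>
  The canonical isomorphism from \<open>word_obj R (P @ w)\<close> to \<open>word_obj R P \<odot> word_obj R w\<close> for the
  words \<open>w\<close> of length 0 and 2 that bound elementary pieces.
\<close>

fun split_word :: "('o, 'm, 'k) ribbon_data \<Rightarrow> 'o point list \<Rightarrow> 'o point list \<Rightarrow> 'm" where
  "split_word R P [p, q] = Assoc R (word_obj R P) (point_obj R p) (point_obj R q)"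
| "split_word R P w = \<i>\<d>\<^bsub>R\<^esub> (word_obj R (P @ w))"

fun slice_mor :: "('o, 'm, 'k) ribbon_data \<Rightarrow> 'o slice \<Rightarrow> 'm" where
  "slice_mor R (P, g, Q) = foldl (\<lambda>f q. f \<star>\<^bsub>R\<^esub> \<i>\<d>\<^bsub>R\<^esub> (point_obj R q))
     (minv R (split_word R P (bot_of g)) \<cdot>\<^bsub>R\<^esub>
      (\<i>\<d>\<^bsub>R\<^esub> (word_obj R P) \<star>\<^bsub>R\<^esub> elementary_mor R g) \<cdot>\<^bsub>R\<^esub>
      split_word R P (top_of g)) Q"

fun slices_mor :: "('o, 'm, 'k) ribbon_data \<Rightarrow> 'o point list \<Rightarrow> 'o slice list \<Rightarrow> 'm" where
  "slices_mor R w [] = \<i>\<d>\<^bsub>R\<^esub> (word_obj R w)"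
| "slices_mor R w (s # ss) = slices_mor R (slice_bot s) ss \<cdot>\<^bsub>R\<^esub> slice_mor R s"

text \<open>
  For a ribbon category the value on diagrams is invariant under isotopy (Reshetikhin-Turaev), so
  the invariant of a tangle may be computed from any of its diagrams.
\<close>

definition RT :: "('o, 'm, 'k) ribbon_data \<Rightarrow> 'o tangle \<Rightarrow> 'm" where
  "RT R T = (case representative T of (w, ss) \<Rightarrow> slices_mor R w ss)"

section \<open>Warp products\<close>

definition tensor_list :: "('o, 'm, 'k) ribbon_data \<Rightarrow> 'o list \<Rightarrow> 'o" where
  "tensor_list C Xs = foldr (TenO C) Xs \<I>\<^bsub>C\<^esub>"

text \<open>\<open>pass_under C L Xs\<close> moves \<open>L\<close> to the right underneath the strands \<open>Xs\<close>.\<close>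

fun pass_under :: "('o, 'm, 'k) ribbon_data \<Rightarrow> 'o \<Rightarrow> 'o list \<Rightarrow> 'm" where
  "pass_under C L [] = \<i>\<d>\<^bsub>C\<^esub> L"
| "pass_under C L (X # Xs) = (\<i>\<d>\<^bsub>C\<^esub> X \<star>\<^bsub>C\<^esub> pass_under C L Xs) \<cdot>\<^bsub>C\<^esub>
     (minv C (\<beta>\<^bsub>C\<^esub> X L) \<star>\<^bsub>C\<^esub> \<i>\<d>\<^bsub>C\<^esub> (tensor_list C Xs))"

text \<open>The isomorphism \<open>\<Sigma>\<close> for the objects \<open>X\<^sub>1, \<dots>, X\<^sub>n\<close> and \<open>L\<^sub>1, \<dots>, L\<^sub>n\<close>, given as a list of pairs.\<close>

fun unshuffle :: "('o, 'm, 'k) ribbon_data \<Rightarrow> ('o \<times> 'o) list \<Rightarrow> 'm" where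
  "unshuffle C [] = \<i>\<d>\<^bsub>C\<^esub> \<I>\<^bsub>C\<^esub>"
| "unshuffle C ((X, L) # XLs) =
     (\<i>\<d>\<^bsub>C\<^esub> X \<star>\<^bsub>C\<^esub> pass_under C L (map fst XLs) \<star>\<^bsub>C\<^esub> \<i>\<d>\<^bsub>C\<^esub> (tensor_list C (map snd XLs))) \<cdot>\<^bsub>C\<^esub>
     (\<i>\<d>\<^bsub>C\<^esub> X \<star>\<^bsub>C\<^esub> \<i>\<d>\<^bsub>C\<^esub> L \<star>\<^bsub>C\<^esub> unshuffle C XLs)"

definition warp ::
  "('o, 'm, 'k) ribbon_data \<Rightarrow> ('o \<times> 'o) list \<Rightarrow> ('o \<times> 'o) list \<Rightarrow> 'm \<Rightarrow> 'm \<Rightarrow> 'm" where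
  "warp C XLs YMs f j = minv C (unshuffle C YMs) \<cdot>\<^bsub>C\<^esub> (f \<star>\<^bsub>C\<^esub> j) \<cdot>\<^bsub>C\<^esub> unshuffle C XLs"

text \<open>
  The invertible objects \<open>\<mu>\<^sub>k\<close> attached to the boundary points of a word; the argument \<open>c\<close>
  accumulates the degree of the points to the left.
\<close>

fun mu_from ::
  "('o, 'm, 'k) ribbon_data \<Rightarrow> 'a monoid \<Rightarrow> ('a \<Rightarrow> 'o set) \<Rightarrow> ('a \<Rightarrow> 'a \<Rightarrow> 'o) \<Rightarrow> 'a \<Rightarrow>
   'o point list \<Rightarrow> 'o list" where
  "mu_from C A Cg lam c [] = []"
| "mu_from C A Cg lam c ((X, downward) # w) = (let a = deg A Cg X; a' = inv\<^bsub>A\<^esub> a in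
     if downward then lam c a # mu_from C A Cg lam (c \<otimes>\<^bsub>A\<^esub> a) w
     else (Dual C (lam a a') \<odot>\<^bsub>C\<^esub> lam c a') # mu_from C A Cg lam (c \<otimes>\<^bsub>A\<^esub> a') w)"

definition mu ::
  "('o, 'm, 'k) ribbon_data \<Rightarrow> 'a monoid \<Rightarrow> ('a \<Rightarrow> 'o set) \<Rightarrow> ('a \<Rightarrow> 'a \<Rightarrow> 'o) \<Rightarrow>
   'o point list \<Rightarrow> 'o list" where
  "mu C A Cg lam w = mu_from C A Cg lam \<one>\<^bsub>A\<^esub> w"

definition mu_pairs ::
  "('o, 'm, 'k) ribbon_data \<Rightarrow> 'a monoid \<Rightarrow> ('a \<Rightarrow> 'o set) \<Rightarrow> ('a \<Rightarrow> 'a \<Rightarrow> 'o) \<Rightarrow>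
   'o point list \<Rightarrow> ('o \<times> 'o) list" where
  "mu_pairs C A Cg lam w = zip (map (point_obj C) w) (mu C A Cg lam w)"

end

theory Submission
  imports Defs "HOL-Library.Countable_Set"
begin

text \<open>
  Call a morphism of the zested category a warp of \<open>f\<close> if it is a warp product of \<open>f\<close> with some
  morphism of invertible objects. Warps are closed under composition, tensor products and inverses,
  so it suffices to show that the associators, braidings, twists, evaluations and coevaluations of the
  zested category are warps of those of the original one. This holds because each of them is composed
  of the original structure, of morphisms between invertible objects and of crossings of an invertible
  object \<open>L\<close> of trivial degree with a homogeneous object \<open>X\<close>. It does not matter whether \<open>L\<close> passes over
  or under \<open>X\<close>: the objects on which the double braiding with \<open>L\<close> is a given scalar are the components
  of a grading, and by universality \<open>X\<close> lies in one of them.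
\<close>

section \<open>Linear categories\<close>

text \<open>Schur's lemma alone does not provide the scalar: a homogeneous object need not be
  simple, and the simple summands of objects of one component might a priori give different scalars.
  Universality excludes this, but it speaks of groups carried by natural numbers, hence the detour
  through the countable group generated by the scalars of simple objects. An invertible factor
  passes over a strand of the tangle at one place only, in the zested braiding with a dual, because
  the dual of an object of degree \<open>a\<close> carries the dual of \<open>lam a (inv a)\<close>.
  That the scalar is nonzero keeps \<open>j\<close> invertible there, so that inverse crossings are
  warps as well. The other obstacle is bracketing: boundary objects are left-associated products in
  a non-strict category, while a warp product refers to a list of pairs. Warps are therefore taken
  between triples of two objects and an isomorphism, whose product is strictly associative:
  regrouping becomes an equation between triples.\<close>

context linear_category
begin

text \<open>Hom-sets are traded for equations on \<open>Dom\<close> and \<open>Cod\<close>, so that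
  the simplifier can discharge typing conditions. The rules that follow bring composites into
  right-nested form.\<close>

lemma hom_iff: "f \<in> hom_set C X Y \<longleftrightarrow> Dom C f = X \<and> Cod C f = Y"
  by (simp add: hom_set_def)

lemma Dom_Id [simp]: "Dom C (\<i>\<d> X) = X" and Cod_Id [simp]: "Cod C (\<i>\<d> X) = X"
  using Id_in_hom[of X] by (auto simp: hom_iff)

lemma Dom_Cmp [simp]: "Dom C g = Cod C f \<Longrightarrow> Dom C (g \<cdot> f) = Dom C f"
  and Cod_Cmp [simp]: "Dom C g = Cod C f \<Longrightarrow> Cod C (g \<cdot> f) = Cod C g"
  using Cmp_in_hom[of f "Dom C f" "Cod C f" g "Cod C g"] by (auto simp: hom_iff)

lemma Cmp_Id_right [simp]: "Dom C f = X \<Longrightarrow> f \<cdot> \<i>\<d> X = f"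
  using Cmp_Id by (auto simp: hom_iff)

lemma Cmp_Id_left [simp]: "Cod C f = X \<Longrightarrow> \<i>\<d> X \<cdot> f = f"
  using Id_Cmp by (auto simp: hom_iff)

lemma Cmp_assoc_right [simp]:
  "Dom C g = Cod C f \<Longrightarrow> Dom C h = Cod C g \<Longrightarrow> (h \<cdot> g) \<cdot> f = h \<cdot> g \<cdot> f"
  using Cmp_assoc by (auto simp: hom_iff)

lemma Dom_Zero [simp]: "Dom C (Zero C X Y) = X" and Cod_Zero [simp]: "Cod C (Zero C X Y) = Y"
  using Zero_in_hom[of X Y] by (auto simp: hom_iff)

lemma Dom_Smult [simp]: "Dom C (Smult C s f) = Dom C f"
  and Cod_Smult [simp]: "Cod C (Smult C s f) = Cod C f"
  using Smult_in_hom[of f "Dom C f" "Cod C f" s] by (auto simp: hom_iff)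

lemma Dom_Add [simp]: "Dom C f = Dom C g \<Longrightarrow> Cod C f = Cod C g \<Longrightarrow> Dom C (Add C f g) = Dom C g"
  and Cod_Add [simp]: "Dom C f = Dom C g \<Longrightarrow> Cod C f = Cod C g \<Longrightarrow> Cod C (Add C f g) = Cod C g"
  using Add_in_hom[of f "Dom C g" "Cod C g" g] by (auto simp: hom_iff)

lemma Smult_Cmp [simp]: "Dom C g = Cod C f \<Longrightarrow> Smult C s g \<cdot> f = Smult C s (g \<cdot> f)"
  using Cmp_Smult_left by (auto simp: hom_iff)

lemma Cmp_Smult [simp]: "Dom C g = Cod C f \<Longrightarrow> g \<cdot> Smult C s f = Smult C s (g \<cdot> f)"
  using Cmp_Smult_right by (auto simp: hom_iff)

declare Smult_Smult [simp] Smult_one [simp]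

lemma Smult_0: "Smult C 0 f = Zero C (Dom C f) (Cod C f)"
proof -
  have "Smult C (1 + - 1) f = Add C (Smult C 1 f) (Smult C (- 1) f)"
    by (rule Smult_add)
  then show ?thesis
    using Add_uminus[of f "Dom C f" "Cod C f"] by (simp add: hom_iff)
qed

lemma Smult_Zero [simp]: "Smult C s (Zero C X Y) = Zero C X Y"
  by (metis Dom_Zero Cod_Zero Smult_0 Smult_Smult mult_zero_right)

lemma Cmp_Zero [simp]: "Dom C g = Y \<Longrightarrow> g \<cdot> Zero C X Y = Zero C X (Cod C g)"
  by (metis Cmp_Smult Cod_Cmp Cod_Zero Dom_Cmp Dom_Zero Smult_0)

lemma Zero_Cmp [simp]: "Cod C f = Y \<Longrightarrow> Zero C Y Z \<cdot> f = Zero C (Dom C f) Z"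
  by (metis Smult_Cmp Cod_Cmp Cod_Zero Dom_Cmp Dom_Zero Smult_0)

lemma Add_Zero_right [simp]: "Dom C f = X \<Longrightarrow> Cod C f = Y \<Longrightarrow> Add C f (Zero C X Y) = f"
  using Add_Zero by (auto simp: hom_iff)

lemma Add_comm: "Dom C f = Dom C g \<Longrightarrow> Cod C f = Cod C g \<Longrightarrow> Add C f g = Add C g f"
  using Add_commute[of f "Dom C g" "Cod C g" g] by (auto simp: hom_iff)

lemma Add_Zero_left [simp]: "Dom C f = X \<Longrightarrow> Cod C f = Y \<Longrightarrow> Add C (Zero C X Y) f = f"
  using Add_comm[of "Zero C X Y" f] by simp

lemma Add_assoc_right:
  "Dom C f = Dom C h \<Longrightarrow> Cod C f = Cod C h \<Longrightarrow> Dom C g = Dom C h \<Longrightarrow> Cod C g = Cod C h \<Longrightarrow>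
    Add C (Add C f g) h = Add C f (Add C g h)"
  using Add_assoc[of f "Dom C h" "Cod C h" g h] by (auto simp: hom_iff)

lemma Smult_distrib:
  "Dom C f = Dom C g \<Longrightarrow> Cod C f = Cod C g \<Longrightarrow>
    Smult C s (Add C f g) = Add C (Smult C s f) (Smult C s g)"
  using Smult_Add[of f "Dom C g" "Cod C g" g] by (auto simp: hom_iff)

lemma Add_Cmp:
  "Dom C g = Cod C f \<Longrightarrow> Dom C h = Dom C g \<Longrightarrow> Cod C h = Cod C g \<Longrightarrow>
    Add C g h \<cdot> f = Add C (g \<cdot> f) (h \<cdot> f)"
  using Cmp_Add_left[of f "Dom C f" "Cod C f" g "Cod C g" h] by (auto simp: hom_iff)

lemma Cmp_Add:
  "Dom C h = Cod C f \<Longrightarrow> Dom C g = Dom C f \<Longrightarrow> Cod C g = Cod C f \<Longrightarrow>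
    h \<cdot> Add C f g = Add C (h \<cdot> f) (h \<cdot> g)"
  using Cmp_Add_right[of f "Dom C f" "Cod C f" g h "Cod C h"] by (auto simp: hom_iff)

lemma Add_uminus_self:
  "Dom C f = X \<Longrightarrow> Cod C f = Y \<Longrightarrow> Add C f (Smult C (- 1) f) = Zero C X Y"
  using Add_uminus by (auto simp: hom_iff)

lemma eq_if_diff_Zero:
  assumes "Dom C f = Dom C g" "Cod C f = Cod C g"
    and "Add C f (Smult C (- 1) g) = Zero C (Dom C g) (Cod C g)"
  shows "f = g"
proof -
  have "Add C (Smult C (- 1) g) g = Zero C (Dom C g) (Cod C g)"
    using Add_comm[of "Smult C (- 1) g" g] by (simp add: Add_uminus_self)
  then have "f = Add C f (Add C (Smult C (- 1) g) g)"
    using assms(1,2) by simp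
  also have "\<dots> = Add C (Add C f (Smult C (- 1) g)) g"
    using assms(1,2) by (simp add: Add_assoc_right)
  also have "\<dots> = g"
    using assms(3) by simp
  finally show ?thesis .
qed

lemma Smult_eq_Zero:
  assumes "Smult C s f = Zero C X Y" "s \<noteq> 0"
  shows "f = Zero C X Y"
proof -
  have "f = Smult C (inverse s) (Smult C s f)"
    using assms(2) by simp
  then show ?thesis
    using assms(1) by simp
qed

lemma Smult_right_cancel:
  assumes "Smult C r f = Smult C s f" "f \<noteq> Zero C (Dom C f) (Cod C f)"
  shows "r = s"
proof (rule ccontr)
  assume "r \<noteq> s"
  have "Smult C (r - s) f = Add C (Smult C r f) (Smult C (- s) f)"
    by (metis Smult_add diff_conv_add_uminus)
  also have "\<dots> = Add C (Smult C s f) (Smult C (- 1) (Smult C s f))"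
    using assms(1) by simp
  also have "\<dots> = Zero C (Dom C f) (Cod C f)"
    by (rule Add_uminus_self) simp_all
  finally show False
    using Smult_eq_Zero assms(2) \<open>r \<noteq> s\<close> by (metis right_minus_eq)
qed

subsection \<open>Isomorphisms\<close>

lemma inverse_mors_iff:
  "inverse_mors C f g \<longleftrightarrow> Dom C g = Cod C f \<and> Cod C g = Dom C f \<and>
     g \<cdot> f = \<i>\<d> (Dom C f) \<and> f \<cdot> g = \<i>\<d> (Cod C f)"
  by (auto simp: inverse_mors_def hom_iff)

lemma inverse_mors_unique: "inverse_mors C f g \<Longrightarrow> inverse_mors C f h \<Longrightarrow> g = h"
  unfolding inverse_mors_iff by (metis Cmp_Id_left Cmp_Id_right Cmp_assoc_right)

lemma inverse_mors_minv: "is_iso C f \<Longrightarrow> inverse_mors C f (minv C f)"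
  unfolding is_iso_def minv_def by (auto intro: theI inverse_mors_unique)

lemma minv_eqI: "inverse_mors C f g \<Longrightarrow> minv C f = g"
  by (metis inverse_mors_minv inverse_mors_unique is_iso_def)

lemma Dom_minv [simp]: "is_iso C f \<Longrightarrow> Dom C (minv C f) = Cod C f"
  and Cod_minv [simp]: "is_iso C f \<Longrightarrow> Cod C (minv C f) = Dom C f"
  and minv_Cmp_self [simp]: "is_iso C f \<Longrightarrow> minv C f \<cdot> f = \<i>\<d> (Dom C f)"
  and Cmp_minv_self [simp]: "is_iso C f \<Longrightarrow> f \<cdot> minv C f = \<i>\<d> (Cod C f)"
  using inverse_mors_minv[of f] by (simp_all add: inverse_mors_iff)

lemma minv_Cmp_cancel [simp]: "is_iso C f \<Longrightarrow> Cod C h = Dom C f \<Longrightarrow> minv C f \<cdot> f \<cdot> h = h"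
  using Cmp_assoc_right[of f h "minv C f"] by simp

lemma Cmp_minv_cancel [simp]: "is_iso C f \<Longrightarrow> Cod C h = Cod C f \<Longrightarrow> f \<cdot> minv C f \<cdot> h = h"
  using Cmp_assoc_right[of "minv C f" h f] by simp

lemma inverse_mors_sym: "inverse_mors C f g \<Longrightarrow> inverse_mors C g f"
  unfolding inverse_mors_iff by simp

lemma is_iso_minv [simp]: "is_iso C f \<Longrightarrow> is_iso C (minv C f)"
  and minv_minv [simp]: "is_iso C f \<Longrightarrow> minv C (minv C f) = f"
  by (metis inverse_mors_sym inverse_mors_minv minv_eqI is_iso_def)+

lemma inverse_mors_Id: "inverse_mors C (\<i>\<d> X) (\<i>\<d> X)"
  by (simp add: inverse_mors_iff)

lemma is_iso_Id [simp]: "is_iso C (\<i>\<d> X)" and minv_Id [simp]: "minv C (\<i>\<d> X) = \<i>\<d> X"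
  by (metis inverse_mors_Id minv_eqI is_iso_def)+

lemma inverse_mors_Cmp:
  assumes "is_iso C f" "is_iso C g" "Dom C g = Cod C f"
  shows "inverse_mors C (g \<cdot> f) (minv C f \<cdot> minv C g)"
  using assms by (simp add: inverse_mors_iff)

lemma is_iso_Cmp [simp]: "is_iso C f \<Longrightarrow> is_iso C g \<Longrightarrow> Dom C g = Cod C f \<Longrightarrow> is_iso C (g \<cdot> f)"
  and minv_Cmp: "is_iso C f \<Longrightarrow> is_iso C g \<Longrightarrow> Dom C g = Cod C f \<Longrightarrow>
    minv C (g \<cdot> f) = minv C f \<cdot> minv C g"
  by (metis inverse_mors_Cmp minv_eqI is_iso_def)+

lemma is_iso_Smult: "is_iso C f \<Longrightarrow> s \<noteq> 0 \<Longrightarrow> is_iso C (Smult C s f)"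
proof -
  assume "is_iso C f" "s \<noteq> 0"
  then have "inverse_mors C (Smult C s f) (Smult C (inverse s) (minv C f))"
    by (simp add: inverse_mors_iff)
  then show ?thesis
    by (auto simp: is_iso_def)
qed

lemma iso_left_cancel:
  "is_iso C f \<Longrightarrow> Cod C g = Dom C f \<Longrightarrow> Cod C h = Dom C f \<Longrightarrow> f \<cdot> g = f \<cdot> h \<longleftrightarrow> g = h"
  by (metis minv_Cmp_cancel)

lemma iso_right_cancel:
  assumes "is_iso C f" "Dom C g = Cod C f" "Dom C h = Cod C f" "g \<cdot> f = h \<cdot> f"
  shows "g = h"
  by (metis Cmp_Id_right Cmp_assoc_right Cmp_minv_self Dom_minv Cod_minv assms)

lemma isomorphicI: "is_iso C f \<Longrightarrow> Dom C f = X \<Longrightarrow> Cod C f = Y \<Longrightarrow> isomorphic C X Y"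
  by (auto simp: isomorphic_def hom_iff)

lemma isomorphicE:
  assumes "isomorphic C X Y"
  obtains f where "is_iso C f" "Dom C f = X" "Cod C f = Y"
  using assms by (auto simp: isomorphic_def hom_iff)

lemma isomorphic_sym: "isomorphic C X Y \<Longrightarrow> isomorphic C Y X"
  by (metis Cod_minv Dom_minv is_iso_minv isomorphicE isomorphicI)

lemma isomorphic_trans: "isomorphic C X Y \<Longrightarrow> isomorphic C Y Z \<Longrightarrow> isomorphic C X Z"
  by (metis Cod_Cmp Dom_Cmp is_iso_Cmp isomorphicE isomorphicI)

subsection \<open>Zero objects and sums of morphisms\<close>

text \<open>Every morphism factors through the identity of its domain and of its codomain, so the
  identity alone decides. In this form being zero can be computed in tensor products.\<close>

lemma zero_object_iff: "zero_object C X \<longleftrightarrow> \<i>\<d> X = Zero C X X"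
proof
  assume "zero_object C X"
  then show "\<i>\<d> X = Zero C X X"
    unfolding zero_object_def using Id_in_hom by blast
next
  assume *: "\<i>\<d> X = Zero C X X"
  have "f = Zero C X (Cod C f)" if "Dom C f = X" for f
    using that * Cmp_Zero Cmp_Id_right by metis
  moreover have "f = Zero C (Dom C f) X" if "Cod C f = X" for f
    using that * Zero_Cmp Cmp_Id_left by metis
  ultimately show "zero_object C X"
    unfolding zero_object_def by (auto simp: hom_iff)
qed

lemma zero_object_Dom: "zero_object C X \<Longrightarrow> Dom C f = X \<Longrightarrow> f = Zero C X (Cod C f)"
  and zero_object_Cod: "zero_object C X \<Longrightarrow> Cod C f = X \<Longrightarrow> f = Zero C (Dom C f) X"
  unfolding zero_object_def by (auto simp: hom_set_def)

lemma zero_object_isomorphic: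
  assumes "isomorphic C X Y" "zero_object C X"
  shows "zero_object C Y"
proof -
  obtain f where f: "is_iso C f" "Dom C f = X" "Cod C f = Y"
    using assms(1) by (rule isomorphicE)
  have "\<i>\<d> Y = f \<cdot> \<i>\<d> X \<cdot> minv C f"
    using f by simp
  also have "\<i>\<d> X = Zero C X X"
    using assms(2) by (simp add: zero_object_iff)
  finally show ?thesis
    using f by (simp add: zero_object_iff)
qed

lemma sum_mor_simps [simp]:
  "sum_mor C X Y [] = Zero C X Y"
  "sum_mor C X Y (f # fs) = Add C f (sum_mor C X Y fs)"
  by (simp_all add: sum_mor_def)

lemma Dom_Cod_sum_mor:
  "\<forall>f \<in> set fs. Dom C f = X \<and> Cod C f = Y \<Longrightarrow>
    Dom C (sum_mor C X Y fs) = X \<and> Cod C (sum_mor C X Y fs) = Y"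
  by (induction fs) auto

lemma Cmp_sum_mor:
  assumes "\<forall>f \<in> set fs. Dom C f = X \<and> Cod C f = Y" "Dom C g = Y"
  shows "g \<cdot> sum_mor C X Y fs = sum_mor C X (Cod C g) (map ((\<cdot>) g) fs)"
  using assms by (induction fs) (auto simp: Cmp_Add Dom_Cod_sum_mor)

lemma sum_mor_Cmp:
  assumes "\<forall>f \<in> set fs. Dom C f = X \<and> Cod C f = Y" "Cod C g = X"
  shows "sum_mor C X Y fs \<cdot> g = sum_mor C (Dom C g) Y (map (\<lambda>f. f \<cdot> g) fs)"
  using assms by (induction fs) (auto simp: Add_Cmp Dom_Cod_sum_mor)

lemma sum_mor_single:
  assumes "distinct xs" "a \<in> set xs" "Dom C f = X" "Cod C f = Y"
  shows "sum_mor C X Y (map (\<lambda>x. if x = a then f else Zero C X Y) xs) = f"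
proof -
  have "sum_mor C X Y (map (\<lambda>x. if x = a then f else Zero C X Y) xs) =
      (if a \<in> set xs then f else Zero C X Y)" if "distinct xs" for xs
    using that assms(3,4) by (induction xs) auto
  then show ?thesis
    using assms by simp
qed

text \<open>The half of a direct sum decomposition that makes the injections jointly epimorphic. It
  is kept apart from the orthogonality relations because it is all that equality tests need, and it
  is stable under tensoring.\<close>

definition resolves :: "'o \<Rightarrow> nat \<Rightarrow> (nat \<Rightarrow> 'm) \<Rightarrow> (nat \<Rightarrow> 'm) \<Rightarrow> bool" where
  "resolves X n \<iota> \<pi> \<longleftrightarrow>
     (\<forall>i<n. Cod C (\<iota> i) = X \<and> Dom C (\<pi> i) = X \<and> Cod C (\<pi> i) = Dom C (\<iota> i)) \<and>
     sum_mor C X X (map (\<lambda>i. \<iota> i \<cdot> \<pi> i) [0..<n]) = \<i>\<d> X"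

text \<open>Composing \<open>h\<close> with the resolved identity expresses it as the sum of the
  \<open>(h \<cdot> \<iota> i) \<cdot> \<pi> i\<close>, so \<open>h\<close> is determined by its
  restrictions to the summands.\<close>

lemma resolves_ext:
  assumes "resolves X n \<iota> \<pi>" "Dom C f = X" "Dom C g = X" "Cod C f = Cod C g"
    and "\<And>i. i < n \<Longrightarrow> f \<cdot> \<iota> i = g \<cdot> \<iota> i"
  shows "f = g"
proof -
  have typing: "\<forall>h \<in> set (map (\<lambda>i. \<iota> i \<cdot> \<pi> i) [0..<n]). Dom C h = X \<and> Cod C h = X"
    using assms(1) by (auto simp: resolves_def)
  have *: "h = sum_mor C X (Cod C h) (map (\<lambda>i. (h \<cdot> \<iota> i) \<cdot> \<pi> i) [0..<n])" if "Dom C h = X" for h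
  proof -
    have "h = h \<cdot> sum_mor C X X (map (\<lambda>i. \<iota> i \<cdot> \<pi> i) [0..<n])"
      using assms(1) that by (simp add: resolves_def)
    also have "\<dots> = sum_mor C X (Cod C h) (map ((\<cdot>) h) (map (\<lambda>i. \<iota> i \<cdot> \<pi> i) [0..<n]))"
      using typing that by (rule Cmp_sum_mor)
    also have "map ((\<cdot>) h) (map (\<lambda>i. \<iota> i \<cdot> \<pi> i) [0..<n]) = map (\<lambda>i. (h \<cdot> \<iota> i) \<cdot> \<pi> i) [0..<n]"
      using assms(1) that by (auto simp: resolves_def)
    finally show ?thesis .
  qed
  have "map (\<lambda>i. (f \<cdot> \<iota> i) \<cdot> \<pi> i) [0..<n] = map (\<lambda>i. (g \<cdot> \<iota> i) \<cdot> \<pi> i) [0..<n]"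
    using assms(5) by simp
  then show ?thesis
    using *[of f] *[of g] assms by metis
qed

lemma direct_sumE:
  assumes "direct_sum C X Zs"
  obtains \<iota> \<pi> where "resolves X (length Zs) \<iota> \<pi>"
    and "\<And>i. i < length Zs \<Longrightarrow> Dom C (\<iota> i) = Zs ! i \<and> Cod C (\<iota> i) = X"
    and "\<And>i. i < length Zs \<Longrightarrow> Dom C (\<pi> i) = X \<and> Cod C (\<pi> i) = Zs ! i"
    and "\<And>i j. i < length Zs \<Longrightarrow> j < length Zs \<Longrightarrow>
      \<pi> i \<cdot> \<iota> j = (if i = j then \<i>\<d> (Zs ! i) else Zero C (Zs ! j) (Zs ! i))"
  using assms unfolding direct_sum_def resolves_def by (auto simp: hom_iff)

subsection \<open>Evaluation of polynomials at an endomorphism\<close>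

text \<open>Horner's scheme, with the constant term at the head of the list.\<close>

fun poly_eval_list :: "'m \<Rightarrow> 'k list \<Rightarrow> 'm" where
  "poly_eval_list f [] = Zero C (Dom C f) (Dom C f)"
| "poly_eval_list f (a # as) = Add C (Smult C a (\<i>\<d> (Dom C f))) (poly_eval_list f as \<cdot> f)"

definition poly_eval :: "'m \<Rightarrow> 'k poly \<Rightarrow> 'm" where
  "poly_eval f p = poly_eval_list f (coeffs p)"

lemma poly_eval_0 [simp]: "poly_eval f 0 = Zero C (Dom C f) (Dom C f)"
  by (simp add: poly_eval_def)

lemma Dom_poly_eval [simp]: "Dom C f = Cod C f \<Longrightarrow> Dom C (poly_eval f p) = Cod C f"
  and Cod_poly_eval [simp]: "Dom C f = Cod C f \<Longrightarrow> Cod C (poly_eval f p) = Cod C f"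
proof -
  have "Dom C (poly_eval_list f as) = Cod C f \<and> Cod C (poly_eval_list f as) = Cod C f"
    if "Dom C f = Cod C f" for as
    using that by (induction as) auto
  then show "Dom C f = Cod C f \<Longrightarrow> Dom C (poly_eval f p) = Cod C f"
    "Dom C f = Cod C f \<Longrightarrow> Cod C (poly_eval f p) = Cod C f"
    by (auto simp: poly_eval_def)
qed

lemma poly_eval_pCons:
  assumes "Dom C f = Cod C f"
  shows "poly_eval f (pCons a p) = Add C (Smult C a (\<i>\<d> (Dom C f))) (poly_eval f p \<cdot> f)"
  \<comment> \<open>The zero polynomial is the one case in which \<open>coeffs\<close> drops the new
    coefficient.\<close>
  using assms by (cases "a = 0 \<and> p = 0") (auto simp: poly_eval_def Smult_0 cCons_def)

lemma poly_eval_smult: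
  assumes "Dom C f = Cod C f"
  shows "poly_eval f (smult c p) = Smult C c (poly_eval f p)"
  using assms by (induction p) (auto simp: poly_eval_pCons Smult_distrib)

lemma Add_swap_middle:
  assumes "Dom C a = X" "Dom C b = X" "Dom C c = X" "Dom C d = X"
    and "Cod C a = Y" "Cod C b = Y" "Cod C c = Y" "Cod C d = Y"
  shows "Add C (Add C a b) (Add C c d) = Add C (Add C a c) (Add C b d)"
proof -
  have "Add C (Add C a b) (Add C c d) = Add C a (Add C (Add C b c) d)"
    using assms by (simp add: Add_assoc_right)
  also have "Add C b c = Add C c b"
    using assms by (simp add: Add_comm)
  finally show ?thesis
    using assms by (simp add: Add_assoc_right)
qed

lemma poly_eval_add:
  assumes "Dom C f = Cod C f"
  shows "poly_eval f (p + q) = Add C (poly_eval f p) (poly_eval f q)"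
proof (induction p arbitrary: q)
  case 0
  then show ?case
    using assms by simp
next
  case (pCons a p)
  obtain b r where q: "q = pCons b r"
    by (cases q)
  have "poly_eval f (pCons a p + q) =
      Add C (Add C (Smult C a (\<i>\<d> (Dom C f))) (Smult C b (\<i>\<d> (Dom C f))))
        (Add C (poly_eval f p \<cdot> f) (poly_eval f r \<cdot> f))"
    using assms by (simp add: q poly_eval_pCons pCons.IH Smult_add Add_Cmp)
  also have "\<dots> = Add C (poly_eval f (pCons a p)) (poly_eval f q)"
    using assms by (subst Add_swap_middle[where X = "Cod C f" and Y = "Cod C f"])
      (simp_all add: q poly_eval_pCons)
  finally show ?case .
qed

text \<open>Since \<open>(x - r) q = x q - r q\<close>, the factor belonging to a root can be split
  off on the right, where a right inverse of it cancels it.\<close>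

lemma poly_eval_linear_factor:
  assumes "Dom C f = Cod C f"
  shows "poly_eval f ([:- r, 1:] * q) = poly_eval f q \<cdot> Add C f (Smult C (- r) (\<i>\<d> (Dom C f)))"
proof -
  have "[:- r, 1:] * q = pCons 0 q + smult (- r) q"
    by simp
  then have "poly_eval f ([:- r, 1:] * q) = Add C (poly_eval f (pCons 0 q)) (poly_eval f (smult (- r) q))"
    using poly_eval_add[OF assms, of "pCons 0 q" "smult (- r) q"] by (simp only:)
  then show ?thesis
    using assms by (simp add: poly_eval_pCons poly_eval_smult Smult_0 Cmp_Add del: smult_minus_left)
qed

text \<open>Recursion on the spanning list lets an elimination step discard its first vector; the
  list may be linearly dependent.\<close>

fun in_span :: "'o \<Rightarrow> 'o \<Rightarrow> 'm list \<Rightarrow> 'm \<Rightarrow> bool" where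
  "in_span X Y [] g = (g = Zero C X Y)"
| "in_span X Y (b # B) g = (\<exists>c h. in_span X Y B h \<and> g = Add C (Smult C c b) h)"

lemma Dom_Cod_in_span:
  "\<forall>b \<in> set B. Dom C b = X \<and> Cod C b = Y \<Longrightarrow> in_span X Y B g \<Longrightarrow> Dom C g = X \<and> Cod C g = Y"
proof (induction B arbitrary: g)
  case (Cons b B)
  then obtain c h where "in_span X Y B h" "g = Add C (Smult C c b) h"
    by auto
  then show ?case
    using Cons by simp
qed simp

lemma in_span_combination:
  assumes "\<forall>b \<in> set B. Dom C b = X \<and> Cod C b = Y" "in_span X Y B g" "in_span X Y B h"
  shows "in_span X Y B (Add C g (Smult C s h))"
  using assms
proof (induction B arbitrary: g h)
  case Nil
  then show ?case
    by simp
next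
  case (Cons b B)
  obtain c g' where g: "in_span X Y B g'" "g = Add C (Smult C c b) g'"
    using Cons.prems(2) unfolding in_span.simps by blast
  obtain d h' where h: "in_span X Y B h'" "h = Add C (Smult C d b) h'"
    using Cons.prems(3) unfolding in_span.simps by blast
  have typing: "Dom C b = X" "Cod C b = Y" "Dom C g' = X" "Cod C g' = Y" "Dom C h' = X" "Cod C h' = Y"
    using Cons.prems(1) Dom_Cod_in_span[OF _ g(1)] Dom_Cod_in_span[OF _ h(1)] by simp_all
  have "Add C g (Smult C s h) = Add C (Add C (Smult C c b) g')
      (Add C (Smult C (s * d) b) (Smult C s h'))"
    using typing by (simp add: g h Smult_distrib)
  also have "\<dots> = Add C (Smult C (c + s * d) b) (Add C g' (Smult C s h'))"
    using typing by (subst Add_swap_middle[where X = X and Y = Y]) (simp_all add: Smult_add)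
  finally show ?case
    using Cons.IH[OF _ g(1) h(1)] Cons.prems(1) unfolding in_span.simps by fastforce
qed

text \<open>Polynomials of pairwise different degrees are linearly independent; the degrees stay different
  when a multiple of the first of them is subtracted from the others, which eliminates one vector
  of the spanning list.\<close>

lemma ex_annihilating_poly:
  assumes "Dom C f = Cod C f" "Cod C f = X"
    and "\<forall>b \<in> set B. Dom C b = X \<and> Cod C b = X"
    and "\<And>i::nat. in_span X X B (poly_eval f (p i))"
    and "strict_mono (\<lambda>i. degree (p i))"
  shows "\<exists>q. q \<noteq> 0 \<and> poly_eval f q = Zero C X X"
  using assms(3-5)
proof (induction B arbitrary: p)
  case Nil
  have "degree (p 0) < degree (p 1)"
    using Nil.prems(3) by (simp add: strict_mono_def)
  then have "p 1 \<noteq> 0"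
    by auto
  moreover have "poly_eval f (p 1) = Zero C X X"
    using Nil.prems(2)[of 1] by simp
  ultimately show ?case
    by blast
next
  case (Cons b B)
  have "\<forall>i. \<exists>c h. in_span X X B h \<and> poly_eval f (p i) = Add C (Smult C c b) h"
    using Cons.prems(2) by simp
  then obtain c h where ch: "\<And>i. in_span X X B (h i)" "\<And>i. poly_eval f (p i) = Add C (Smult C (c i) b) (h i)"
    by metis
  have b: "Dom C b = X" "Cod C b = X" and h: "Dom C (h i) = X" "Cod C (h i) = X" for i
    using Cons.prems(1) Dom_Cod_in_span[OF _ ch(1)] by auto
  show ?case
  proof (cases "\<forall>i. c i = 0")
    case True
    then have "poly_eval f (p i) = h i" for i
      using ch(2)[of i] b h by (simp add: Smult_0)
    then show ?thesis
      using Cons.IH[of p] Cons.prems ch(1) by simp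
  next
    case False
    then obtain k where k: "c k \<noteq> 0"
      by blast
    \<comment> \<open>This multiple of \<open>p k\<close> cancels the coefficient of
      \<open>b\<close>. Only indices beyond \<open>k\<close> are kept, so \<open>p k\<close> has
      smaller degree and the leading terms survive.\<close>
    define d where "d i = - (c (Suc k + i) / c k)" for i
    define q where "q i = p (Suc k + i) + smult (d i) (p k)" for i
    have "degree (smult (d i) (p k)) < degree (p (Suc k + i))" for i
      using Cons.prems(3) degree_smult_le[of "d i" "p k"] strict_monoD[of "\<lambda>i. degree (p i)" k "Suc k + i"]
      by simp
    then have deg: "degree (q i) = degree (p (Suc k + i))" for i
      by (simp add: q_def degree_add_eq_left)
    have "poly_eval f (q i) = Add C (h (Suc k + i)) (Smult C (d i) (h k))" for i
    proof -
      have "poly_eval f (q i) = Add C (Add C (Smult C (c (Suc k + i)) b) (h (Suc k + i)))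
          (Add C (Smult C (d i * c k) b) (Smult C (d i) (h k)))"
        using assms(1) b h by (simp add: q_def poly_eval_add poly_eval_smult ch(2) Smult_distrib)
      also have "\<dots> = Add C (Smult C (c (Suc k + i) + d i * c k) b)
          (Add C (h (Suc k + i)) (Smult C (d i) (h k)))"
        using b h by (subst Add_swap_middle[where X = X and Y = X]) (simp_all add: Smult_add)
      finally show ?thesis
        using k b h by (simp add: d_def Smult_0)
    qed
    then have "in_span X X B (poly_eval f (q i))" for i
      using in_span_combination[OF _ ch(1) ch(1)] Cons.prems(1) by simp
    moreover have "strict_mono (\<lambda>i. degree (q i))"
      using Cons.prems(3) by (simp add: deg strict_mono_def)
    ultimately show ?thesis
      using Cons.IH[of q] Cons.prems(1) by simp
  qed
qed

text \<open>A substitute for simplicity that can be transported to duals and to products with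
  invertible objects by direct computation. Zero objects have the property too.\<close>

definition scalar_end :: "'o \<Rightarrow> bool" where
  "scalar_end X \<longleftrightarrow> (\<forall>f. Dom C f = X \<and> Cod C f = X \<longrightarrow> (\<exists>s. f = Smult C s (\<i>\<d> X)))"

end

section \<open>Schur's lemma over an algebraically closed field\<close>

context finite_semisimple_category
begin

text \<open>If \<open>f\<close> is nonzero, so is its restriction \<open>h\<close> to some simple
  summand of its domain. A nonzero morphism between simple objects is an isomorphism, and
  \<open>\<iota> i \<cdot> minv C h\<close> is then a section of \<open>f\<close>.\<close>

lemma simple_split_epi:
  assumes S: "simple_object C S" and f: "Cod C f = S" "f \<noteq> Zero C (Dom C f) S"
  shows "\<exists>g. Dom C g = S \<and> Cod C g = Dom C f \<and> f \<cdot> g = \<i>\<d> S"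
proof -
  obtain Zs where Zs: "\<forall>Z \<in> set Zs. simple_object C Z" "direct_sum C (Dom C f) Zs"
    using semisimple by blast
  obtain \<iota> \<pi> where res: "resolves (Dom C f) (length Zs) \<iota> \<pi>"
    and \<iota>: "\<And>i. i < length Zs \<Longrightarrow> Dom C (\<iota> i) = Zs ! i \<and> Cod C (\<iota> i) = Dom C f"
    using Zs(2) by (rule direct_sumE) blast
  have "\<exists>i < length Zs. f \<cdot> \<iota> i \<noteq> Zero C (Dom C f) S \<cdot> \<iota> i"
    using resolves_ext[OF res, of f "Zero C (Dom C f) S"] f by auto
  then obtain i where i: "i < length Zs" "f \<cdot> \<iota> i \<noteq> Zero C (Zs ! i) S"
    using \<iota> by auto
  define h where "h = f \<cdot> \<iota> i"
  have h: "Dom C h = Zs ! i" "Cod C h = S" "h \<noteq> Zero C (Zs ! i) S"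
    using \<iota>[OF i(1)] i f by (auto simp: h_def)
  have Zi: "simple_object C (Zs ! i)"
    using Zs(1) i(1) by simp
  obtain k where k: "kernel_of C h k"
    using ex_kernel by blast
  then have k': "Cod C k = Zs ! i" "h \<cdot> k = Zero C (Dom C k) S"
    and ku: "\<And>g. Cod C g = Zs ! i \<Longrightarrow> h \<cdot> g = Zero C (Dom C g) S \<Longrightarrow>
      \<exists>!u. Dom C u = Dom C g \<and> Cod C u = Dom C k \<and> k \<cdot> u = g"
    using h unfolding kernel_of_def by (auto simp: hom_iff)
  \<comment> \<open>As a monomorphism into the simple object \<open>Zs ! i\<close>, the kernel of
    \<open>h\<close> is zero or an isomorphism; the latter would force \<open>h\<close> to
    vanish.\<close>
  have "mono_mor C k"
    unfolding mono_mor_def hom_iff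
  proof (intro allI ballI impI, unfold hom_iff)
    fix W g g'
    assume g: "Dom C g = W \<and> Cod C g = Dom C k" "Dom C g' = W \<and> Cod C g' = Dom C k"
      and eq: "k \<cdot> g = k \<cdot> g'"
    have "h \<cdot> k \<cdot> g = Zero C (Dom C (k \<cdot> g)) S"
      using Cmp_assoc_right[of k g h] g k' h by simp
    then show "g = g'"
      using ku[of "k \<cdot> g"] g k' eq by auto
  qed
  then have "zero_object C (Dom C k) \<or> is_iso C k"
    using Zi k'(1) unfolding simple_object_def by blast
  moreover have "\<not> is_iso C k"
  proof
    assume "is_iso C k"
    then have "h = (h \<cdot> k) \<cdot> minv C k"
      using h k'(1) by simp
    then show False
      using h k' \<open>is_iso C k\<close> by simp
  qed
  ultimately have zk: "zero_object C (Dom C k)"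
    by blast
  \<comment> \<open>Two morphisms equalized by \<open>h\<close> have a difference that factors
    through the zero kernel.\<close>
  have "mono_mor C h"
    unfolding mono_mor_def
  proof (intro allI ballI impI, unfold hom_iff)
    fix W g g'
    assume g: "Dom C g = W \<and> Cod C g = Dom C h" "Dom C g' = W \<and> Cod C g' = Dom C h"
      and eq: "h \<cdot> g = h \<cdot> g'"
    let ?d = "Add C g (Smult C (- 1) g')"
    have "h \<cdot> ?d = Zero C (Dom C ?d) S"
      using g eq h by (simp add: Cmp_Add Add_uminus_self)
    then obtain u where u: "Dom C u = Dom C ?d" "Cod C u = Dom C k" "k \<cdot> u = ?d"
      using ku[of ?d] g h by auto
    have "u = Zero C W (Dom C k)"
      using zero_object_Cod[OF zk u(2)] u(1) g by simp
    then have "?d = Zero C W (Zs ! i)"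
      using u(3) k'(1) by simp
    then show "g = g'"
      using g h(1) eq_if_diff_Zero[of g g'] by presburger
  qed
  then have "is_iso C h"
    using S h Zi unfolding simple_object_def by metis
  then have "f \<cdot> \<iota> i \<cdot> minv C h = \<i>\<d> S"
    using Cmp_assoc_right[of "\<iota> i" "minv C h" f] \<iota>[OF i(1)] h f(1) Cmp_minv_self[of h]
    unfolding h_def[symmetric] by simp
  then show ?thesis
    using \<iota>[OF i(1)] h \<open>is_iso C h\<close> by (intro exI[of _ "\<iota> i \<cdot> minv C h"]) simp
qed

text \<open>Finite dimension provides a nonzero polynomial that annihilates \<open>f\<close>, and
  algebraic closedness provides a root \<open>r\<close> of it. Either \<open>f\<close> is the scalar
  \<open>r\<close>, or \<open>f - r\<close> has a section and cancels, which leaves an annihilating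
  polynomial of smaller degree.\<close>

lemma simple_scalar_end:
  assumes "simple_object C X"
  shows "scalar_end X"
  unfolding scalar_end_def
proof (intro allI impI)
  fix f
  assume f: "Dom C f = X \<and> Cod C f = X"
  obtain B where B: "set B \<subseteq> hom_set C X X"
    "\<forall>g \<in> hom_set C X X. \<exists>cs. length cs = length B \<and> g = sum_mor C X X (map2 (Smult C) cs B)"
    using finite_dimensional_hom by blast
  have span: "in_span X X B' (sum_mor C X X (map2 (Smult C) cs B'))"
    if "length cs = length B'" for cs B'
    using that by (induction cs B' rule: list_induct2) auto
  \<comment> \<open>The powers of \<open>f\<close> lie in a finite-dimensional space, and the
    degrees of the monomials increase strictly.\<close>
  have "in_span X X B (poly_eval f (monom 1 i))" for i
    using B(2) span f by (metis Cod_poly_eval Dom_poly_eval hom_iff)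
  then have "\<exists>q. q \<noteq> 0 \<and> poly_eval f q = Zero C X X"
    using f B(1) by (intro ex_annihilating_poly[where p = "\<lambda>i. monom 1 i" and B = B])
      (auto simp: hom_iff degree_monom_eq strict_mono_def)
  then obtain q where "q \<noteq> 0" "poly_eval f q = Zero C X X"
    by blast
  then show "\<exists>s. f = Smult C s (\<i>\<d> X)"
  proof (induction "degree q" arbitrary: q rule: less_induct)
    case less
    show ?case
    proof (cases "degree q = 0")
      case True
      then obtain c where c: "q = [:c:]"
        by (metis degree_eq_zeroE)
      then have "c \<noteq> 0" "Smult C c (\<i>\<d> X) = Zero C X X"
        using less.prems f by (auto simp: poly_eval_pCons)
      then have "zero_object C X"
        using Smult_eq_Zero zero_object_iff by blast
      then show ?thesis
        using assms by (simp add: simple_object_def)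
    next
      case False
      then obtain r where "poly q r = 0"
        using alg_closed_imp_poly_has_root[of q] by auto
      then obtain q' where q': "q = [:- r, 1:] * q'"
        by (metis poly_eq_0_iff_dvd dvdE)
      then have q'0: "q' \<noteq> 0"
        using less.prems(1) by auto
      then have deg: "degree q' < degree q"
        unfolding q' by (subst degree_mult_eq) auto
      let ?g = "Add C f (Smult C (- r) (\<i>\<d> X))"
      have eq: "poly_eval f q' \<cdot> ?g = Zero C X X"
        using less.prems(2) poly_eval_linear_factor[of f r q'] f by (simp add: q')
      show ?thesis
      proof (cases "?g = Zero C X X")
        case True
        then have "f = Smult C r (\<i>\<d> X)"
          using f eq_if_diff_Zero[of f "Smult C r (\<i>\<d> X)"] by simp
        then show ?thesis
          by blast
      next
        case False
        then obtain g where g: "Dom C g = X" "Cod C g = X" "?g \<cdot> g = \<i>\<d> X"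
          using simple_split_epi[OF assms, of ?g] f by auto
        have "poly_eval f q' = poly_eval f q' \<cdot> (?g \<cdot> g)"
          using f g(3) by simp
        also have "\<dots> = (poly_eval f q' \<cdot> ?g) \<cdot> g"
          using f g by simp
        finally have "poly_eval f q' = Zero C X X"
          using eq g by simp
        then show ?thesis
          using less.hyps deg q'0 by blast
      qed
    qed
  qed
qed

end

section \<open>Strict ribbon fusion categories\<close>

context strict_ribbon_fusion_category
begin

declare TenO_assoc [simp] TenO_Unit [simp] Unit_TenO [simp]
  TenM_assoc [simp] TenM_Unit [simp] Unit_TenM [simp]
  TenM_Smult_left [simp] TenM_Smult_right [simp]

lemma Dom_TenM [simp]: "Dom C (f \<star> g) = Dom C f \<odot> Dom C g"
  and Cod_TenM [simp]: "Cod C (f \<star> g) = Cod C f \<odot> Cod C g"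
  using TenM_in_hom[of f "Dom C f" "Cod C f" g "Dom C g" "Cod C g"] by (auto simp: hom_iff)

lemma interchange:
  "Dom C f' = Cod C f \<Longrightarrow> Dom C g' = Cod C g \<Longrightarrow> (f' \<star> g') \<cdot> (f \<star> g) = (f' \<cdot> f) \<star> (g' \<cdot> g)"
  using TenM_Cmp by (auto simp: hom_iff)

lemma interchange_Cmp:
  assumes "Dom C f' = Cod C f" "Dom C g' = Cod C g" "Cod C h = Dom C f \<odot> Dom C g"
  shows "(f' \<star> g') \<cdot> (f \<star> g) \<cdot> h = ((f' \<cdot> f) \<star> (g' \<cdot> g)) \<cdot> h"
  using assms Cmp_assoc_right[of "f \<star> g" h "f' \<star> g'"] by (simp add: interchange)

lemmas Id_TenO = TenM_Id[symmetric]

lemma TenM_Zero [simp]: "f \<star> Zero C X Y = Zero C (Dom C f \<odot> X) (Cod C f \<odot> Y)"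
  using TenM_Smult_right[of f 0 "Zero C X Y"] Smult_0[of "f \<star> Zero C X Y"] by simp

lemma Zero_TenM [simp]: "Zero C X Y \<star> f = Zero C (X \<odot> Dom C f) (Y \<odot> Cod C f)"
  using TenM_Smult_left[of 0 "Zero C X Y" f] Smult_0[of "Zero C X Y \<star> f"] by simp

lemma Add_TenM:
  "Dom C f = Dom C g \<Longrightarrow> Cod C f = Cod C g \<Longrightarrow> Add C f g \<star> h = Add C (f \<star> h) (g \<star> h)"
  using TenM_Add_left[of f "Dom C g" "Cod C g" g h] by (simp add: hom_iff)

lemma inverse_mors_TenM:
  "is_iso C f \<Longrightarrow> is_iso C g \<Longrightarrow> inverse_mors C (f \<star> g) (minv C f \<star> minv C g)"
  by (simp add: inverse_mors_iff interchange TenM_Id)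

lemma is_iso_TenM [simp]: "is_iso C f \<Longrightarrow> is_iso C g \<Longrightarrow> is_iso C (f \<star> g)"
  and minv_TenM: "is_iso C f \<Longrightarrow> is_iso C g \<Longrightarrow> minv C (f \<star> g) = minv C f \<star> minv C g"
  by (metis inverse_mors_TenM minv_eqI is_iso_def)+

lemma sum_mor_TenM:
  assumes "\<forall>f \<in> set fs. Dom C f = X \<and> Cod C f = Y"
  shows "sum_mor C X Y fs \<star> \<i>\<d> W = sum_mor C (X \<odot> W) (Y \<odot> W) (map (\<lambda>f. f \<star> \<i>\<d> W) fs)"
  using assms by (induction fs) (auto simp: Add_TenM Dom_Cod_sum_mor)

lemma resolves_TenM:
  assumes "resolves X n \<iota> \<pi>"
  shows "resolves (X \<odot> W) n (\<lambda>i. \<iota> i \<star> \<i>\<d> W) (\<lambda>i. \<pi> i \<star> \<i>\<d> W)"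
proof -
  have eq: "map (\<lambda>i. (\<iota> i \<star> \<i>\<d> W) \<cdot> (\<pi> i \<star> \<i>\<d> W)) [0..<n] = map (\<lambda>f. f \<star> \<i>\<d> W) (map (\<lambda>i. \<iota> i \<cdot> \<pi> i) [0..<n])"
    using assms by (auto simp: resolves_def interchange)
  have "sum_mor C X X (map (\<lambda>i. \<iota> i \<cdot> \<pi> i) [0..<n]) \<star> \<i>\<d> W =
      sum_mor C (X \<odot> W) (X \<odot> W) (map (\<lambda>f. f \<star> \<i>\<d> W) (map (\<lambda>i. \<iota> i \<cdot> \<pi> i) [0..<n]))"
    using assms by (intro sum_mor_TenM) (auto simp: resolves_def)
  then show ?thesis
    using assms unfolding resolves_def eq by (simp add: TenM_Id del: map_map)
qed

subsection \<open>Braidings\<close>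

declare Braid_iso [simp] Twist_iso [simp]

lemma Dom_Braid [simp]: "Dom C (\<beta> X Y) = X \<odot> Y" and Cod_Braid [simp]: "Cod C (\<beta> X Y) = Y \<odot> X"
  using Braid_in_hom[of X Y] by (auto simp: hom_iff)

lemma Dom_Twist [simp]: "Dom C (\<theta> X) = X" and Cod_Twist [simp]: "Cod C (\<theta> X) = X"
  using Twist_in_hom[of X] by (auto simp: hom_iff)

lemma Dom_Ev [simp]: "Dom C (Ev C X) = Dual C X \<odot> X" and Cod_Ev [simp]: "Cod C (Ev C X) = \<I>"
  using Ev_in_hom[of X] by (auto simp: hom_iff)

lemma Dom_Coev [simp]: "Dom C (Coev C X) = \<I>" and Cod_Coev [simp]: "Cod C (Coev C X) = X \<odot> Dual C X"
  using Coev_in_hom[of X] by (auto simp: hom_iff)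

lemma Braid_nat: "\<beta> (Cod C f) (Cod C g) \<cdot> (f \<star> g) = (g \<star> f) \<cdot> \<beta> (Dom C f) (Dom C g)"
  by (rule Braid_natural) (simp_all add: hom_iff)

text \<open>The hexagon with two unit objects makes this crossing idempotent, and an invertible
  idempotent is an identity.\<close>

lemma Braid_Unit_left [simp]: "\<beta> \<I> X = \<i>\<d> X"
proof -
  have "\<beta> \<I> X = \<beta> \<I> X \<cdot> \<beta> \<I> X"
    using hexagon_left[of \<I> \<I> X] by simp
  then show ?thesis
    using iso_left_cancel[of "\<beta> \<I> X" "\<i>\<d> X" "\<beta> \<I> X"] by simp
qed

lemma Braid_Unit_right [simp]: "\<beta> X \<I> = \<i>\<d> X"
proof -
  have "\<beta> X \<I> = \<beta> X \<I> \<cdot> \<beta> X \<I>"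
    using hexagon_right[of X \<I> \<I>] by simp
  then show ?thesis
    using iso_left_cancel[of "\<beta> X \<I>" "\<i>\<d> X" "\<beta> X \<I>"] by simp
qed

text \<open>The crossing by which \<open>L\<close> moves to the right underneath \<open>X\<close>.\<close>

definition under :: "'o \<Rightarrow> 'o \<Rightarrow> 'm" where
  "under L X = minv C (\<beta> X L)"

lemma Dom_under [simp]: "Dom C (under L X) = L \<odot> X"
  and Cod_under [simp]: "Cod C (under L X) = X \<odot> L"
  and is_iso_under [simp]: "is_iso C (under L X)"
  and under_Braid: "under L X \<cdot> \<beta> X L = \<i>\<d> (X \<odot> L)"
  and Braid_under: "\<beta> X L \<cdot> under L X = \<i>\<d> (L \<odot> X)"
  and under_Unit_left [simp]: "under \<I> X = \<i>\<d> X"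
  and under_Unit_right [simp]: "under L \<I> = \<i>\<d> L"
  by (simp_all add: under_def)

lemma under_nat: "under (Cod C g) (Cod C f) \<cdot> (g \<star> f) = (f \<star> g) \<cdot> under (Dom C g) (Dom C f)"
proof (rule iso_right_cancel[of "\<beta> (Dom C f) (Dom C g)"])
  have "(under (Cod C g) (Cod C f) \<cdot> (g \<star> f)) \<cdot> \<beta> (Dom C f) (Dom C g) =
      under (Cod C g) (Cod C f) \<cdot> \<beta> (Cod C f) (Cod C g) \<cdot> (f \<star> g)"
    by (simp add: Braid_nat)
  then show "(under (Cod C g) (Cod C f) \<cdot> (g \<star> f)) \<cdot> \<beta> (Dom C f) (Dom C g) =
      ((f \<star> g) \<cdot> under (Dom C g) (Dom C f)) \<cdot> \<beta> (Dom C f) (Dom C g)"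
    by (simp add: under_def)
qed simp_all

lemma under_TenO_right: "under L (X \<odot> Y) = (\<i>\<d> X \<star> under L Y) \<cdot> (under L X \<star> \<i>\<d> Y)"
  by (simp add: under_def hexagon_left minv_Cmp minv_TenM)

lemma under_TenO_left: "under (L \<odot> M) X = (under L X \<star> \<i>\<d> M) \<cdot> (\<i>\<d> L \<star> under M X)"
  by (simp add: under_def hexagon_right minv_Cmp minv_TenM)

subsection \<open>Duals and invertible objects\<close>

text \<open>One half of the adjunction between \<open>X\<close> and its dual: by the zigzag
  identity, \<open>h\<close> can be recovered from \<open>Ev C X \<cdot> (h \<star> id)\<close> by
  bending the strand \<open>X\<close> back with \<open>Coev C X\<close>.\<close>

lemma Ev_ext:
  assumes "Cod C f = Dual C X" "Cod C g = Dual C X" "Dom C f = Dom C g"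
    and "Ev C X \<cdot> (f \<star> \<i>\<d> X) = Ev C X \<cdot> (g \<star> \<i>\<d> X)"
  shows "f = g"
proof -
  have *: "h = ((Ev C X \<cdot> (h \<star> \<i>\<d> X)) \<star> \<i>\<d> (Dual C X)) \<cdot> (\<i>\<d> (Dom C h) \<star> Coev C X)"
    if "Cod C h = Dual C X" for h
  proof -
    have "((Ev C X \<cdot> (h \<star> \<i>\<d> X)) \<star> \<i>\<d> (Dual C X)) \<cdot> (\<i>\<d> (Dom C h) \<star> Coev C X) =
        ((Ev C X \<star> \<i>\<d> (Dual C X)) \<cdot> ((h \<star> \<i>\<d> X) \<star> \<i>\<d> (Dual C X))) \<cdot> (\<i>\<d> (Dom C h) \<star> Coev C X)"
      using that by (subst interchange) simp_all
    also have "\<dots> = (Ev C X \<star> \<i>\<d> (Dual C X)) \<cdot> (h \<star> \<i>\<d> (X \<odot> Dual C X)) \<cdot> (\<i>\<d> (Dom C h) \<star> Coev C X)"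
      using that by (simp add: Id_TenO)
    also have "(h \<star> \<i>\<d> (X \<odot> Dual C X)) \<cdot> (\<i>\<d> (Dom C h) \<star> Coev C X) = (\<i>\<d> (Dual C X) \<star> Coev C X) \<cdot> (h \<star> \<i>\<d> \<I>)"
      using that by (simp only: interchange Dom_Id Cod_Id Dom_Coev Cod_Coev Cmp_Id_left Cmp_Id_right)
    also have "(Ev C X \<star> \<i>\<d> (Dual C X)) \<cdot> (\<i>\<d> (Dual C X) \<star> Coev C X) \<cdot> (h \<star> \<i>\<d> \<I>) = h"
      using that Cmp_assoc_right[of "\<i>\<d> (Dual C X) \<star> Coev C X" h "Ev C X \<star> \<i>\<d> (Dual C X)"]
      by (simp add: zigzag_Dual)
    finally show ?thesis
      by simp
  qed
  show ?thesis
    using *[OF assms(1)] *[OF assms(2)] assms(3,4) by metis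
qed

lemma zero_object_if_Ev_Zero:
  assumes "Ev C X = Zero C (Dual C X \<odot> X) \<I>"
  shows "zero_object C X"
  using zigzag[of X] by (simp add: assms zero_object_iff)

lemma zero_object_Dual:
  assumes "zero_object C (Dual C X)"
  shows "zero_object C X"
proof -
  have "\<i>\<d> (Dual C X \<odot> X) = Zero C (Dual C X \<odot> X) (Dual C X \<odot> X)"
    using assms by (simp add: Id_TenO zero_object_iff)
  then have "zero_object C (Dual C X \<odot> X)"
    by (simp add: zero_object_iff)
  then have "Ev C X = Zero C (Dual C X \<odot> X) \<I>"
    using zero_object_Dom[of _ "Ev C X"] by simp
  then show ?thesis
    by (rule zero_object_if_Ev_Zero)
qed

text \<open>The evaluation of a nonzero \<open>X\<close> is a nonzero morphism to the simple unit,
  hence has a section. Tensoring with \<open>Y\<close> exhibits \<open>Y\<close> as a retract of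
  \<open>Dual C X \<odot> X \<odot> Y\<close>.\<close>

lemma zero_object_TenO:
  assumes "zero_object C (X \<odot> Y)" "\<not> zero_object C X"
  shows "zero_object C Y"
proof -
  have "Ev C X \<noteq> Zero C (Dual C X \<odot> X) \<I>"
    using zero_object_if_Ev_Zero assms(2) by blast
  then obtain g where g: "Dom C g = \<I>" "Cod C g = Dual C X \<odot> X" "Ev C X \<cdot> g = \<i>\<d> \<I>"
    using simple_split_epi[OF simple_Unit, of "Ev C X"] by auto
  have "g \<star> \<i>\<d> Y = (\<i>\<d> (Dual C X) \<star> \<i>\<d> (X \<odot> Y)) \<cdot> (g \<star> \<i>\<d> Y)"
    using g by (simp add: TenM_Id)
  then have "g \<star> \<i>\<d> Y = Zero C Y (Dual C X \<odot> X \<odot> Y)"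
    using assms(1) g by (simp add: zero_object_iff)
  moreover have "(Ev C X \<star> \<i>\<d> Y) \<cdot> (g \<star> \<i>\<d> Y) = \<i>\<d> Y"
    using g by (simp add: interchange)
  ultimately show ?thesis
    by (simp add: zero_object_iff)
qed

section \<open>Invertible objects\<close>

lemma invertibleE:
  assumes "X \<in> invertible_objects C"
  obtains Y u v where "Y \<in> invertible_objects C"
    and "is_iso C u" "Dom C u = X \<odot> Y" "Cod C u = \<I>"
    and "is_iso C v" "Dom C v = Y \<odot> X" "Cod C v = \<I>"
proof -
  obtain Y where Y: "isomorphic C (X \<odot> Y) \<I>" "isomorphic C (Y \<odot> X) \<I>"
    using assms unfolding invertible_objects_def by blast
  then have "Y \<in> invertible_objects C"
    unfolding invertible_objects_def by blast
  then show thesis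
    using that Y by (metis isomorphicE)
qed

lemma isomorphic_swap: "isomorphic C (X \<odot> Y) Z \<Longrightarrow> isomorphic C (Y \<odot> X) Z"
  by (rule isomorphic_trans[of _ "X \<odot> Y"]) (auto intro: isomorphicI[of "\<beta> Y X"])

lemma invertibleI: "isomorphic C (X \<odot> Y) \<I> \<Longrightarrow> X \<in> invertible_objects C"
  unfolding invertible_objects_def using isomorphic_swap by blast

lemma invertible_Unit: "\<I> \<in> invertible_objects C"
  by (rule invertibleI[of _ \<I>]) (auto intro: isomorphicI[of "\<i>\<d> \<I>"])

lemma invertible_TenO:
  assumes "X \<in> invertible_objects C" "Y \<in> invertible_objects C"
  shows "X \<odot> Y \<in> invertible_objects C"
proof -
  obtain X' u where X: "is_iso C u" "Dom C u = X \<odot> X'" "Cod C u = \<I>"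
    using assms(1) by (rule invertibleE)
  obtain Y' v where Y: "is_iso C v" "Dom C v = Y \<odot> Y'" "Cod C v = \<I>"
    using assms(2) by (rule invertibleE)
  show ?thesis
    using X Y by (intro invertibleI[of _ "Y' \<odot> X'"] isomorphicI[of "u \<cdot> (\<i>\<d> X \<star> v \<star> \<i>\<d> X')"]) simp_all
qed

lemma not_zero_object_Unit: "\<not> zero_object C \<I>"
  using simple_Unit by (simp add: simple_object_def)

lemma not_zero_object_invertible:
  assumes "X \<in> invertible_objects C"
  shows "\<not> zero_object C X"
proof
  assume *: "zero_object C X"
  obtain Y u where u: "is_iso C u" "Dom C u = X \<odot> Y" "Cod C u = \<I>"
    using assms by (rule invertibleE)
  have "zero_object C (X \<odot> Y)"
    using * by (simp add: zero_object_iff Id_TenO)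
  then show False
    using zero_object_isomorphic[OF isomorphicI[OF u]] not_zero_object_Unit by blast
qed

text \<open>Tensoring further with an inverse \<open>Y\<close> of \<open>\<eta>\<close> and
  contracting the pair by \<open>u\<close> gives \<open>f\<close> back.\<close>

lemma invertible_faithful:
  assumes "\<eta> \<in> invertible_objects C" "Dom C f = Dom C g" "Cod C f = Cod C g"
    and "f \<star> \<i>\<d> \<eta> = g \<star> \<i>\<d> \<eta>"
  shows "f = g"
proof -
  obtain Y u where u: "is_iso C u" "Dom C u = \<eta> \<odot> Y" "Cod C u = \<I>"
    using assms(1) by (rule invertibleE)
  have *: "h \<cdot> (\<i>\<d> (Dom C h) \<star> u) = (\<i>\<d> (Cod C h) \<star> u) \<cdot> ((h \<star> \<i>\<d> \<eta>) \<star> \<i>\<d> Y)" for h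
  proof -
    have "(\<i>\<d> (Cod C h) \<star> u) \<cdot> ((h \<star> \<i>\<d> \<eta>) \<star> \<i>\<d> Y) = h \<star> u"
      using u by (simp add: TenM_Id interchange)
    also have "\<dots> = (h \<star> \<i>\<d> \<I>) \<cdot> (\<i>\<d> (Dom C h) \<star> u)"
      using u by (subst interchange) simp_all
    finally show ?thesis
      by simp
  qed
  have "f \<cdot> (\<i>\<d> (Dom C f) \<star> u) = g \<cdot> (\<i>\<d> (Dom C f) \<star> u)"
    using *[of f] *[of g] unfolding assms(2-4) by argo
  moreover have "is_iso C (\<i>\<d> (Dom C f) \<star> u)" "Dom C f = Cod C (\<i>\<d> (Dom C f) \<star> u)"
    "Dom C g = Cod C (\<i>\<d> (Dom C f) \<star> u)"
    using u assms(2) by simp_all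
  ultimately show ?thesis
    using iso_right_cancel by blast
qed

section \<open>Objects with scalar endomorphisms, and duals of invertible objects\<close>

lemma scalar_endE:
  assumes "scalar_end X" "Dom C f = X" "Cod C f = X"
  obtains s where "f = Smult C s (\<i>\<d> X)"
  using assms unfolding scalar_end_def by blast

text \<open>The isomorphism \<open>\<i>\<d> X \<star> u\<close> from
  \<open>X \<odot> \<eta> \<odot> Y\<close> to \<open>X\<close> turns
  \<open>g \<star> \<i>\<d> Y\<close> into an endomorphism of \<open>X\<close>, which is a scalar;
  faithfulness of tensoring with \<open>Y\<close> carries this back to \<open>g\<close>.\<close>

lemma scalar_end_TenO:
  assumes "scalar_end X" "\<eta> \<in> invertible_objects C"
  shows "scalar_end (X \<odot> \<eta>)"
  unfolding scalar_end_def
proof (intro allI impI)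
  fix g
  assume g: "Dom C g = X \<odot> \<eta> \<and> Cod C g = X \<odot> \<eta>"
  obtain Y u where Y: "Y \<in> invertible_objects C"
    and u: "is_iso C u" "Dom C u = \<eta> \<odot> Y" "Cod C u = \<I>"
    using assms(2) by (rule invertibleE)
  let ?w = "\<i>\<d> X \<star> u"
  obtain s where s: "?w \<cdot> (g \<star> \<i>\<d> Y) \<cdot> minv C ?w = Smult C s (\<i>\<d> X)"
    using scalar_endE[OF assms(1), of "?w \<cdot> (g \<star> \<i>\<d> Y) \<cdot> minv C ?w"] g u by auto
  have "minv C ?w \<cdot> (?w \<cdot> (g \<star> \<i>\<d> Y) \<cdot> minv C ?w) \<cdot> ?w = g \<star> \<i>\<d> Y"
    using g u by simp
  then have "g \<star> \<i>\<d> Y = Smult C s (\<i>\<d> (X \<odot> \<eta>)) \<star> \<i>\<d> Y"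
    unfolding s using u by (simp add: TenM_Id)
  then show "\<exists>s. g = Smult C s (\<i>\<d> (X \<odot> \<eta>))"
    using invertible_faithful[OF Y, of g "Smult C s (\<i>\<d> (X \<odot> \<eta>))"] g by auto
qed

lemma scalar_end_Unit: "scalar_end \<I>"
  using simple_Unit by (rule simple_scalar_end)

lemma scalar_end_invertible: "\<eta> \<in> invertible_objects C \<Longrightarrow> scalar_end \<eta>"
  using scalar_end_TenO[OF scalar_end_Unit, of \<eta>] by simp

text \<open>The transpose of \<open>f\<close> is an endomorphism of \<open>X\<close>, hence a scalar
  \<open>s\<close>. Pairing with \<open>Ev C X\<close> does not distinguish \<open>f\<close> from
  its transpose, and it determines \<open>f\<close>.\<close>

lemma scalar_end_Dual:
  assumes "scalar_end X"
  shows "scalar_end (Dual C X)"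
  unfolding scalar_end_def
proof (intro allI impI)
  fix f
  assume f: "Dom C f = Dual C X \<and> Cod C f = Dual C X"
  let ?X' = "Dual C X"
  let ?t = "(\<i>\<d> X \<star> Ev C X) \<cdot> (\<i>\<d> X \<star> f \<star> \<i>\<d> X) \<cdot> (Coev C X \<star> \<i>\<d> X)"
  obtain s where s: "?t = Smult C s (\<i>\<d> X)"
    using scalar_endE[OF assms, of ?t] f by auto
  have "Ev C X \<cdot> (\<i>\<d> ?X' \<star> ?t) =
      Ev C X \<cdot> (\<i>\<d> ?X' \<star> \<i>\<d> X \<star> Ev C X) \<cdot> (\<i>\<d> ?X' \<star> \<i>\<d> X \<star> f \<star> \<i>\<d> X) \<cdot> (\<i>\<d> ?X' \<star> Coev C X \<star> \<i>\<d> X)"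
    using f by (simp add: interchange)
  \<comment> \<open>The two evaluations sit on disjoint strands and may be performed in either
    order. Doing the left one first leaves \<open>f\<close> followed by \<open>Ev C X\<close>, up to
    a zigzag.\<close>
  also have "\<dots> = (Ev C X \<cdot> (\<i>\<d> (?X' \<odot> X) \<star> Ev C X)) \<cdot> (\<i>\<d> ?X' \<star> \<i>\<d> X \<star> f \<star> \<i>\<d> X) \<cdot> (\<i>\<d> ?X' \<star> Coev C X \<star> \<i>\<d> X)"
    using f by (simp add: Id_TenO)
  also have "Ev C X \<cdot> (\<i>\<d> (?X' \<odot> X) \<star> Ev C X) = (Ev C X \<star> \<i>\<d> \<I>) \<cdot> (\<i>\<d> (?X' \<odot> X) \<star> Ev C X)"
    by simp
  also have "\<dots> = Ev C X \<star> Ev C X"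
    by (subst interchange) simp_all
  also have "\<dots> = (\<i>\<d> \<I> \<star> Ev C X) \<cdot> (Ev C X \<star> \<i>\<d> (?X' \<odot> X))"
    by (subst interchange) simp_all
  also have "\<dots> = Ev C X \<cdot> (Ev C X \<star> \<i>\<d> ?X' \<star> \<i>\<d> X)"
    by (simp add: Id_TenO)
  also have "(Ev C X \<cdot> (Ev C X \<star> \<i>\<d> ?X' \<star> \<i>\<d> X)) \<cdot> (\<i>\<d> ?X' \<star> \<i>\<d> X \<star> f \<star> \<i>\<d> X) \<cdot> (\<i>\<d> ?X' \<star> Coev C X \<star> \<i>\<d> X)
      = Ev C X \<cdot> ((Ev C X \<star> \<i>\<d> ?X' \<star> \<i>\<d> X) \<cdot> (\<i>\<d> (?X' \<odot> X) \<star> f \<star> \<i>\<d> X)) \<cdot> (\<i>\<d> ?X' \<star> Coev C X \<star> \<i>\<d> X)"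
    using f by (simp add: Id_TenO)
  also have "(Ev C X \<star> \<i>\<d> ?X' \<star> \<i>\<d> X) \<cdot> (\<i>\<d> (?X' \<odot> X) \<star> f \<star> \<i>\<d> X) = (\<i>\<d> \<I> \<star> f \<star> \<i>\<d> X) \<cdot> (Ev C X \<star> \<i>\<d> ?X' \<star> \<i>\<d> X)"
    using f by (subst (1 2) interchange) (simp_all add: interchange)
  also have "Ev C X \<cdot> ((\<i>\<d> \<I> \<star> f \<star> \<i>\<d> X) \<cdot> (Ev C X \<star> \<i>\<d> ?X' \<star> \<i>\<d> X)) \<cdot> (\<i>\<d> ?X' \<star> Coev C X \<star> \<i>\<d> X)
      = Ev C X \<cdot> (f \<star> \<i>\<d> X) \<cdot> (((Ev C X \<star> \<i>\<d> ?X') \<cdot> (\<i>\<d> ?X' \<star> Coev C X)) \<star> \<i>\<d> X)"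
    using f interchange[of "Ev C X \<star> \<i>\<d> ?X'" "\<i>\<d> ?X' \<star> Coev C X" "\<i>\<d> X" "\<i>\<d> X"] by simp
  also have "\<dots> = Ev C X \<cdot> (f \<star> \<i>\<d> X)"
    using f by (simp add: zigzag_Dual TenM_Id)
  finally have "Ev C X \<cdot> (f \<star> \<i>\<d> X) = Ev C X \<cdot> (Smult C s (\<i>\<d> ?X') \<star> \<i>\<d> X)"
    by (simp add: s TenM_Id)
  then show "\<exists>s. f = Smult C s (\<i>\<d> ?X')"
    using Ev_ext[of f X "Smult C s (\<i>\<d> ?X')"] f by auto
qed

text \<open>\<open>Ev C X\<close> has a section \<open>g\<close>, and the idempotent
  \<open>g \<cdot> Ev C X\<close> is a scalar because \<open>Dual C X \<odot> X\<close> has only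
  scalar endomorphisms. The scalar is 1, so \<open>Ev C X\<close> is an isomorphism.\<close>

lemma invertible_Dual:
  assumes "X \<in> invertible_objects C"
  shows "Dual C X \<in> invertible_objects C"
proof -
  have sc: "scalar_end (Dual C X \<odot> X)"
    using assms scalar_end_TenO scalar_end_Dual scalar_end_invertible by blast
  have nz: "Ev C X \<noteq> Zero C (Dual C X \<odot> X) \<I>"
    using zero_object_if_Ev_Zero not_zero_object_invertible assms by blast
  then obtain g where g: "Dom C g = \<I>" "Cod C g = Dual C X \<odot> X" "Ev C X \<cdot> g = \<i>\<d> \<I>"
    using simple_split_epi[OF simple_Unit, of "Ev C X"] by auto
  obtain s where s: "g \<cdot> Ev C X = Smult C s (\<i>\<d> (Dual C X \<odot> X))"
    using scalar_endE[OF sc, of "g \<cdot> Ev C X"] g by auto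
  have "Smult C 1 (Ev C X) = (Ev C X \<cdot> g) \<cdot> Ev C X"
    unfolding g(3) by simp
  also have "\<dots> = Ev C X \<cdot> g \<cdot> Ev C X"
    using g by (subst Cmp_assoc_right) simp_all
  also have "\<dots> = Smult C s (Ev C X)"
    by (simp add: s)
  finally have "s = 1"
    using Smult_right_cancel nz by (metis Dom_Ev Cod_Ev)
  then have "inverse_mors C (Ev C X) g"
    using g s by (simp add: inverse_mors_iff)
  then have "isomorphic C (Dual C X \<odot> X) \<I>"
    by (intro isomorphicI[of "Ev C X"]) (auto simp: is_iso_def)
  then show ?thesis
    by (rule invertibleI)
qed

end

section \<open>Double braidings with invertible objects\<close>

context strict_ribbon_fusion_category
begin

text \<open>A relation rather than a function: a general object has no such scalar, and a zero
  object has all of them.\<close>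

definition dbraid :: "'o \<Rightarrow> 'o \<Rightarrow> 'k \<Rightarrow> bool" where
  "dbraid \<eta> X s \<longleftrightarrow> \<beta> \<eta> X \<cdot> \<beta> X \<eta> = Smult C s (\<i>\<d> (X \<odot> \<eta>))"

lemma double_braid_nat:
  "\<beta> \<eta> (Cod C f) \<cdot> \<beta> (Cod C f) \<eta> \<cdot> (f \<star> \<i>\<d> \<eta>) = (f \<star> \<i>\<d> \<eta>) \<cdot> \<beta> \<eta> (Dom C f) \<cdot> \<beta> (Dom C f) \<eta>"
proof -
  have "\<beta> \<eta> (Cod C f) \<cdot> \<beta> (Cod C f) \<eta> \<cdot> (f \<star> \<i>\<d> \<eta>) = (\<beta> \<eta> (Cod C f) \<cdot> (\<i>\<d> \<eta> \<star> f)) \<cdot> \<beta> (Dom C f) \<eta>"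
    using Braid_nat[of f "\<i>\<d> \<eta>"] by simp
  also have "\<beta> \<eta> (Cod C f) \<cdot> (\<i>\<d> \<eta> \<star> f) = (f \<star> \<i>\<d> \<eta>) \<cdot> \<beta> \<eta> (Dom C f)"
    using Braid_nat[of "\<i>\<d> \<eta>" f] by simp
  finally show ?thesis
    by simp
qed

lemma dbraid_Cmp:
  assumes "dbraid \<eta> (Dom C f) s"
  shows "\<beta> \<eta> (Cod C f) \<cdot> \<beta> (Cod C f) \<eta> \<cdot> (f \<star> \<i>\<d> \<eta>) = Smult C s (f \<star> \<i>\<d> \<eta>)"
  unfolding double_braid_nat using assms by (simp add: dbraid_def)

lemma dbraid_retract:
  assumes "dbraid \<eta> X s" "Dom C k = Y" "Cod C k = X" "Dom C r = X" "Cod C r = Y" "r \<cdot> k = \<i>\<d> Y"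
  shows "dbraid \<eta> Y s"
proof -
  have rk: "(r \<star> \<i>\<d> \<eta>) \<cdot> (k \<star> \<i>\<d> \<eta>) = \<i>\<d> (Y \<odot> \<eta>)"
    using assms by (simp add: interchange TenM_Id)
  have "\<beta> \<eta> Y \<cdot> \<beta> Y \<eta> = (\<beta> \<eta> Y \<cdot> \<beta> Y \<eta> \<cdot> (r \<star> \<i>\<d> \<eta>)) \<cdot> (k \<star> \<i>\<d> \<eta>)"
    using rk assms by simp
  also have "\<beta> \<eta> Y \<cdot> \<beta> Y \<eta> \<cdot> (r \<star> \<i>\<d> \<eta>) = Smult C s (r \<star> \<i>\<d> \<eta>)"
    using dbraid_Cmp[of \<eta> r s] assms by simp
  also have "\<dots> \<cdot> (k \<star> \<i>\<d> \<eta>) = Smult C s (\<i>\<d> (Y \<odot> \<eta>))"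
    using rk assms by simp
  finally show ?thesis
    by (simp add: dbraid_def)
qed

lemma dbraid_isomorphic:
  assumes "dbraid \<eta> X s" "isomorphic C X Y"
  shows "dbraid \<eta> Y s"
proof -
  obtain f where "is_iso C f" "Dom C f = X" "Cod C f = Y"
    using assms(2) by (rule isomorphicE)
  then show ?thesis
    using assms(1) by (intro dbraid_retract[of \<eta> X s "minv C f" Y f]) simp_all
qed

text \<open>By the hexagons, the double braiding with \<open>X\<close> is nested inside the one with
  \<open>Y\<close>; once the inner one has become a scalar, only the outer one remains.
  Multiplicativity is the tensor axiom of the grading built from these scalars.\<close>

lemma dbraid_TenO:
  assumes "dbraid \<eta> X r" "dbraid \<eta> Y s"
  shows "dbraid \<eta> (X \<odot> Y) (r * s)"
proof -
  have "\<beta> \<eta> (X \<odot> Y) \<cdot> \<beta> (X \<odot> Y) \<eta> =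
      (\<i>\<d> X \<star> \<beta> \<eta> Y) \<cdot> ((\<beta> \<eta> X \<cdot> \<beta> X \<eta>) \<star> \<i>\<d> Y) \<cdot> (\<i>\<d> X \<star> \<beta> Y \<eta>)"
    by (simp add: hexagon_left hexagon_right interchange_Cmp)
  also have "\<dots> = Smult C r (\<i>\<d> X \<star> (\<beta> \<eta> Y \<cdot> \<beta> Y \<eta>))"
    using assms(1) by (simp add: dbraid_def TenM_Id interchange)
  also have "\<dots> = Smult C (r * s) (\<i>\<d> ((X \<odot> Y) \<odot> \<eta>))"
    using assms(2) by (simp add: dbraid_def TenM_Id)
  finally show ?thesis
    by (simp add: dbraid_def)
qed

text \<open>By naturality of the double braiding, \<open>f \<star> \<i>\<d> \<eta>\<close> is
  multiplied equally by \<open>r\<close> and by \<open>s\<close>, so it vanishes. This is the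
  orthogonality axiom of the grading.\<close>

lemma dbraid_hom_Zero:
  assumes "\<eta> \<in> invertible_objects C" "dbraid \<eta> (Dom C f) r" "dbraid \<eta> (Cod C f) s" "r \<noteq> s"
  shows "f = Zero C (Dom C f) (Cod C f)"
proof -
  have "Smult C r (f \<star> \<i>\<d> \<eta>) = (\<beta> \<eta> (Cod C f) \<cdot> \<beta> (Cod C f) \<eta>) \<cdot> (f \<star> \<i>\<d> \<eta>)"
    using dbraid_Cmp[OF assms(2)] by simp
  also have "\<dots> = Smult C s (f \<star> \<i>\<d> \<eta>)"
    using assms(3) by (simp add: dbraid_def)
  finally have "f \<star> \<i>\<d> \<eta> = Zero C (Dom C (f \<star> \<i>\<d> \<eta>)) (Cod C (f \<star> \<i>\<d> \<eta>))"
    using Smult_right_cancel assms(4) by blast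
  also have "\<dots> = Zero C (Dom C f) (Cod C f) \<star> \<i>\<d> \<eta>"
    by simp
  finally show ?thesis
    by (rule invertible_faithful[OF assms(1), rotated 2]) simp_all
qed

lemma not_zero_object_TenO_invertible:
  assumes "\<eta> \<in> invertible_objects C" "\<not> zero_object C X"
  shows "\<not> zero_object C (X \<odot> \<eta>)"
  using zero_object_TenO[of X \<eta>] not_zero_object_invertible assms by blast

lemma dbraid_nonzero:
  assumes "\<eta> \<in> invertible_objects C" "\<not> zero_object C X" "dbraid \<eta> X s"
  shows "s \<noteq> 0"
proof
  assume "s = 0"
  then have "\<beta> \<eta> X \<cdot> \<beta> X \<eta> = Zero C (X \<odot> \<eta>) (X \<odot> \<eta>)"
    using assms(3) by (simp add: dbraid_def Smult_0)
  moreover have "\<i>\<d> (X \<odot> \<eta>) = minv C (\<beta> \<eta> X \<cdot> \<beta> X \<eta>) \<cdot> \<beta> \<eta> X \<cdot> \<beta> X \<eta>"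
    by simp
  ultimately have "zero_object C (X \<odot> \<eta>)"
    by (metis Cmp_Zero Cod_Braid Cod_Cmp Cod_minv Dom_Braid Dom_Cmp Dom_minv Braid_iso
      is_iso_Cmp zero_object_iff)
  then show False
    using not_zero_object_TenO_invertible assms(1,2) by blast
qed

lemma dbraid_unique:
  assumes "\<eta> \<in> invertible_objects C" "\<not> zero_object C X" "dbraid \<eta> X r" "dbraid \<eta> X s"
  shows "r = s"
proof -
  have "\<i>\<d> (X \<odot> \<eta>) \<noteq> Zero C (X \<odot> \<eta>) (X \<odot> \<eta>)"
    using not_zero_object_TenO_invertible[OF assms(1,2)] by (simp add: zero_object_iff)
  then show ?thesis
    using Smult_right_cancel[of r "\<i>\<d> (X \<odot> \<eta>)" s] assms(3,4) by (simp add: dbraid_def)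
qed

lemma dbraid_simple:
  assumes "\<eta> \<in> invertible_objects C" "simple_object C X"
  shows "\<exists>s. dbraid \<eta> X s"
  using scalar_endE[OF scalar_end_TenO[OF simple_scalar_end[OF assms(2)] assms(1)], of "\<beta> \<eta> X \<cdot> \<beta> X \<eta>"]
  by (auto simp: dbraid_def)

text \<open>The form in which the scalar enters warp products: an over-crossing is a multiple of the
  under-crossing.\<close>

lemma dbraid_Braid:
  assumes "dbraid \<eta> X s"
  shows "\<beta> \<eta> X = Smult C s (under \<eta> X)"
proof -
  have "\<beta> \<eta> X = (\<beta> \<eta> X \<cdot> \<beta> X \<eta>) \<cdot> under \<eta> X"
    by (simp add: Braid_under)
  also have "\<beta> \<eta> X \<cdot> \<beta> X \<eta> = Smult C s (\<i>\<d> (X \<odot> \<eta>))"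
    using assms by (simp add: dbraid_def)
  finally show ?thesis
    by simp
qed

text \<open>The image of \<open>e\<close> is the kernel \<open>k\<close> of \<open>1 - e\<close>,
  and \<open>e\<close> itself factors through that kernel.\<close>

lemma idempotent_split:
  assumes "Dom C e = X" "Cod C e = X" "e \<cdot> e = e"
  obtains k r where "Cod C k = X" "Dom C r = X" "Cod C r = Dom C k" "r \<cdot> k = \<i>\<d> (Dom C k)" "k \<cdot> r = e"
proof -
  let ?f = "Add C (\<i>\<d> X) (Smult C (- 1) e)"
  obtain k where "kernel_of C ?f k"
    using ex_kernel by blast
  then have k: "Cod C k = X" "?f \<cdot> k = Zero C (Dom C k) X"
    and ku: "\<And>g. Cod C g = X \<Longrightarrow> ?f \<cdot> g = Zero C (Dom C g) X \<Longrightarrow>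
      \<exists>!u. Dom C u = Dom C g \<and> Cod C u = Dom C k \<and> k \<cdot> u = g"
    using assms(1,2) unfolding kernel_of_def by (simp_all add: hom_iff)
  have "Add C k (Smult C (- 1) (e \<cdot> k)) = Zero C (Dom C k) X"
    using k assms(1,2) by (simp add: Add_Cmp)
  then have ek: "k = e \<cdot> k"
    using eq_if_diff_Zero[of k "e \<cdot> k"] k(1) assms(1,2) by simp
  have "?f \<cdot> e = Zero C (Dom C e) X"
    using assms by (simp add: Add_Cmp Add_uminus_self)
  then obtain r where r: "Dom C r = X" "Cod C r = Dom C k" "k \<cdot> r = e"
    using ku[of e] assms(1,2) by auto
  \<comment> \<open>Both \<open>r \<cdot> k\<close> and the identity factor \<open>k\<close> through
    itself, and such a factorization is unique.\<close>
  have "\<exists>!u. Dom C u = Dom C k \<and> Cod C u = Dom C k \<and> k \<cdot> u = k"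
    using ku[of k] k by blast
  moreover have "k \<cdot> r \<cdot> k = k"
    using ek r k(1) Cmp_assoc_right[of r k k] by simp
  ultimately have "r \<cdot> k = \<i>\<d> (Dom C k)"
    using r k(1) by (metis Cmp_Id_right Cod_Cmp Cod_Id Dom_Cmp Dom_Id)
  then show thesis
    using that r k(1) by blast
qed

text \<open>A grading allows only one summand per degree, so the simple summands with equal scalar
  must be merged. This is done by adding their projections and splitting the resulting
  idempotent.\<close>

lemma dbraid_decomposition:
  assumes \<eta>: "\<eta> \<in> invertible_objects C"
  shows "\<exists>ss Z. distinct ss \<and> (\<forall>s \<in> set ss. \<exists>S. simple_object C S \<and> dbraid \<eta> S s) \<and>
    (\<forall>s \<in> set ss. dbraid \<eta> (Z s) s) \<and> direct_sum C X (map Z ss)"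
proof -
  obtain Ys where Ys: "\<forall>Y \<in> set Ys. simple_object C Y" "direct_sum C X Ys"
    using semisimple by blast
  let ?n = "length Ys"
  obtain \<iota> \<pi> where res: "resolves X ?n \<iota> \<pi>"
    and \<iota>: "\<And>i. i < ?n \<Longrightarrow> Dom C (\<iota> i) = Ys ! i \<and> Cod C (\<iota> i) = X"
    and \<pi>: "\<And>i. i < ?n \<Longrightarrow> Dom C (\<pi> i) = X \<and> Cod C (\<pi> i) = Ys ! i"
    and \<pi>\<iota>: "\<And>i j. i < ?n \<Longrightarrow> j < ?n \<Longrightarrow>
      \<pi> i \<cdot> \<iota> j = (if i = j then \<i>\<d> (Ys ! i) else Zero C (Ys ! j) (Ys ! i))"
    using Ys(2) by (rule direct_sumE) blast
  have "\<forall>i < ?n. \<exists>s. dbraid \<eta> (Ys ! i) s"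
    using Ys(1) dbraid_simple[OF \<eta>] by simp
  then obtain c where c: "\<And>i. i < ?n \<Longrightarrow> dbraid \<eta> (Ys ! i) (c i)"
    by metis
  \<comment> \<open>The projection to the part of \<open>X\<close> with scalar \<open>v\<close>; it
    is zero if \<open>v\<close> does not occur.\<close>
  define e where "e v = sum_mor C X X (map (\<lambda>i. if c i = v then \<iota> i \<cdot> \<pi> i else Zero C X X) [0..<?n])" for v
  have "Dom C (e v) = X \<and> Cod C (e v) = X" for v
    unfolding e_def by (rule Dom_Cod_sum_mor) (auto simp: \<iota> \<pi>)
  then have e: "Dom C (e v) = X" "Cod C (e v) = X" for v
    by simp_all
  have e\<iota>: "e v \<cdot> \<iota> j = (if c j = v then \<iota> j else Zero C (Ys ! j) X)" if j: "j < ?n" for v j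
  proof -
    let ?g = "if c j = v then \<iota> j else Zero C (Ys ! j) X"
    have "e v \<cdot> \<iota> j = sum_mor C (Ys ! j) X
        (map (\<lambda>f. f \<cdot> \<iota> j) (map (\<lambda>i. if c i = v then \<iota> i \<cdot> \<pi> i else Zero C X X) [0..<?n]))"
      unfolding e_def \<iota>[OF j, THEN conjunct1, symmetric] by (rule sum_mor_Cmp) (auto simp: \<iota> \<pi> j)
    also have "map (\<lambda>f. f \<cdot> \<iota> j) (map (\<lambda>i. if c i = v then \<iota> i \<cdot> \<pi> i else Zero C X X) [0..<?n]) =
        map (\<lambda>i. if i = j then ?g else Zero C (Ys ! j) X) [0..<?n]"
      using \<iota> \<pi> \<pi>\<iota> j by simp
    also have "sum_mor C (Ys ! j) X \<dots> = ?g"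
      using \<iota>[OF j] j by (subst sum_mor_single) auto
    finally show ?thesis .
  qed
  have ee: "e v \<cdot> e w = (if v = w then e v else Zero C X X)" for v w
  proof (rule resolves_ext[OF res])
    fix j
    assume "j < ?n"
    then show "(e v \<cdot> e w) \<cdot> \<iota> j = (if v = w then e v else Zero C X X) \<cdot> \<iota> j"
      using e \<iota> e\<iota> by simp
  qed (simp_all add: e)
  have "\<exists>k r. Cod C k = X \<and> Dom C r = X \<and> Cod C r = Dom C k \<and> r \<cdot> k = \<i>\<d> (Dom C k) \<and> k \<cdot> r = e v" for v
    using idempotent_split[of "e v" X] e ee[of v v] by metis
  then obtain k r where k: "\<And>v. Cod C (k v) = X" and r: "\<And>v. Dom C (r v) = X" "\<And>v. Cod C (r v) = Dom C (k v)"
    and rk: "\<And>v. r v \<cdot> k v = \<i>\<d> (Dom C (k v))" and kr: "\<And>v. k v \<cdot> r v = e v"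
    by metis
  define Z where "Z v = Dom C (k v)" for v
  define ss where "ss = remdups (map c [0..<?n])"
  have rk_Zero: "r v \<cdot> k w = Zero C (Z w) (Z v)" if "v \<noteq> w" for v w
  proof -
    \<comment> \<open>Inserting both identities makes the product of the orthogonal idempotents
      \<open>e v\<close> and \<open>e w\<close> appear.\<close>
    have "r v \<cdot> k w = (r v \<cdot> k v) \<cdot> (r v \<cdot> k w) \<cdot> (r w \<cdot> k w)"
      using k r by (simp add: rk)
    also have "\<dots> = r v \<cdot> ((k v \<cdot> r v) \<cdot> (k w \<cdot> r w)) \<cdot> k w"
      using k r by simp
    also have "\<dots> = Zero C (Z w) (Z v)"
      unfolding kr using that k r by (simp add: ee Z_def)
    finally show ?thesis .
  qed
  have "dbraid \<eta> (Z v) v" for v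
  proof -
    have "(\<beta> \<eta> X \<cdot> \<beta> X \<eta>) \<cdot> (e v \<star> \<i>\<d> \<eta>) = Smult C v (e v \<star> \<i>\<d> \<eta>)"
    proof (rule resolves_ext[OF resolves_TenM[OF res, of \<eta>]])
      fix j
      assume j: "j < ?n"
      have "(e v \<star> \<i>\<d> \<eta>) \<cdot> (\<iota> j \<star> \<i>\<d> \<eta>) = (if c j = v then \<iota> j \<star> \<i>\<d> \<eta> else Zero C (Ys ! j \<odot> \<eta>) (X \<odot> \<eta>))"
        using e \<iota>[OF j] e\<iota>[OF j] by (simp add: interchange)
      moreover have "\<beta> \<eta> X \<cdot> \<beta> X \<eta> \<cdot> (\<iota> j \<star> \<i>\<d> \<eta>) = Smult C (c j) (\<iota> j \<star> \<i>\<d> \<eta>)"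
        using dbraid_Cmp[of \<eta> "\<iota> j" "c j"] c[OF j] \<iota>[OF j] by simp
      ultimately show "((\<beta> \<eta> X \<cdot> \<beta> X \<eta>) \<cdot> (e v \<star> \<i>\<d> \<eta>)) \<cdot> (\<iota> j \<star> \<i>\<d> \<eta>) =
          Smult C v (e v \<star> \<i>\<d> \<eta>) \<cdot> (\<iota> j \<star> \<i>\<d> \<eta>)"
        using e \<iota>[OF j] by simp
    qed (simp_all add: e)
    then have *: "\<beta> \<eta> X \<cdot> \<beta> X \<eta> \<cdot> (e v \<star> \<i>\<d> \<eta>) = Smult C v (e v \<star> \<i>\<d> \<eta>)"
      using e by simp
    have "\<beta> \<eta> (Z v) \<cdot> \<beta> (Z v) \<eta> = (\<beta> \<eta> (Z v) \<cdot> \<beta> (Z v) \<eta> \<cdot> (r v \<star> \<i>\<d> \<eta>)) \<cdot> (k v \<star> \<i>\<d> \<eta>)"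
      using r k rk[of v] by (simp add: interchange TenM_Id Z_def)
    also have "\<beta> \<eta> (Z v) \<cdot> \<beta> (Z v) \<eta> \<cdot> (r v \<star> \<i>\<d> \<eta>) = (r v \<star> \<i>\<d> \<eta>) \<cdot> \<beta> \<eta> X \<cdot> \<beta> X \<eta>"
      using double_braid_nat[of \<eta> "r v"] r by (simp add: Z_def)
    also have "((r v \<star> \<i>\<d> \<eta>) \<cdot> \<beta> \<eta> X \<cdot> \<beta> X \<eta>) \<cdot> (k v \<star> \<i>\<d> \<eta>) =
        (r v \<star> \<i>\<d> \<eta>) \<cdot> (\<beta> \<eta> X \<cdot> \<beta> X \<eta> \<cdot> (e v \<star> \<i>\<d> \<eta>)) \<cdot> (k v \<star> \<i>\<d> \<eta>)"
    proof -
      have "e v \<cdot> k v = k v"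
        using kr[of v] rk[of v] k r Cmp_assoc_right[of "r v" "k v" "k v"] by simp
      then have "k v \<star> \<i>\<d> \<eta> = (e v \<star> \<i>\<d> \<eta>) \<cdot> (k v \<star> \<i>\<d> \<eta>)"
        using e k by (simp add: interchange)
      then show ?thesis
        using e k r by simp
    qed
    also have "\<dots> = Smult C v ((r v \<star> \<i>\<d> \<eta>) \<cdot> ((k v \<cdot> r v) \<star> \<i>\<d> \<eta>) \<cdot> (k v \<star> \<i>\<d> \<eta>))"
      unfolding * kr using e k r by simp
    also have "\<dots> = Smult C v (\<i>\<d> (Z v \<odot> \<eta>))"
      using r k rk[of v] by (simp add: interchange TenM_Id Z_def)
    finally show ?thesis
      by (simp add: dbraid_def)
  qed
  moreover have "direct_sum C X (map Z ss)"
  proof -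
    have nth: "ss ! i = ss ! j \<longleftrightarrow> i = j" if "i < length ss" "j < length ss" for i j
      using that by (simp add: ss_def nth_eq_iff_index_eq)
    have "map (\<lambda>i. k (ss ! i) \<cdot> r (ss ! i)) [0..<length ss] = map e ss"
      by (rule nth_equalityI) (simp_all add: kr)
    moreover have "sum_mor C X X (map e ss) = \<i>\<d> X"
    proof (rule resolves_ext[OF res])
      fix j
      assume j: "j < ?n"
      have "sum_mor C X X (map e ss) \<cdot> \<iota> j = sum_mor C (Ys ! j) X (map (\<lambda>f. f \<cdot> \<iota> j) (map e ss))"
        unfolding \<iota>[OF j, THEN conjunct1, symmetric] by (rule sum_mor_Cmp) (auto simp: e \<iota>[OF j])
      also have "map (\<lambda>f. f \<cdot> \<iota> j) (map e ss) = map (\<lambda>v. if v = c j then \<iota> j else Zero C (Ys ! j) X) ss"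
        using e\<iota>[OF j] by auto
      also have "sum_mor C (Ys ! j) X \<dots> = \<iota> j"
        using \<iota>[OF j] j by (subst sum_mor_single) (auto simp: ss_def)
      finally show "sum_mor C X X (map e ss) \<cdot> \<iota> j = \<i>\<d> X \<cdot> \<iota> j"
        using \<iota>[OF j] by simp
    qed (use e Dom_Cod_sum_mor[of "map e ss" X X] in auto)
    ultimately show ?thesis
      unfolding direct_sum_def
      by (intro exI[of _ "\<lambda>i. k (ss ! i)"] exI[of _ "\<lambda>i. r (ss ! i)"])
        (simp add: hom_iff k r rk rk_Zero nth Z_def)
  qed
  moreover have "\<forall>s \<in> set ss. \<exists>S. simple_object C S \<and> dbraid \<eta> S s"
    using c Ys(1) by (auto simp: ss_def) (metis nth_mem)
  ultimately show ?thesis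
    by (intro exI[of _ ss] exI[of _ Z]) (simp add: ss_def)
qed

text \<open>The scalar is invariant under isomorphism and unique for nonzero objects, so it can be
  read off from the finitely many representatives of the simple objects.\<close>

lemma finite_dbraid_scalars:
  assumes \<eta>: "\<eta> \<in> invertible_objects C"
  shows "finite {s. \<exists>X. simple_object C X \<and> dbraid \<eta> X s}"
proof -
  obtain I where I: "finite I" "\<And>X. simple_object C X \<Longrightarrow> \<exists>Y \<in> I. isomorphic C X Y"
    using finitely_many_simples by blast
  have "{s. \<exists>X. simple_object C X \<and> dbraid \<eta> X s} \<subseteq> (\<lambda>Y. THE s. dbraid \<eta> Y s) ` I"
  proof clarify
    fix s X
    assume X: "simple_object C X" "dbraid \<eta> X s"
    obtain Y where Y: "Y \<in> I" "isomorphic C X Y"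
      using I(2) X(1) by blast
    have "\<not> zero_object C Y"
      using zero_object_isomorphic[OF isomorphic_sym[OF Y(2)]] X(1) by (auto simp: simple_object_def)
    moreover have "dbraid \<eta> Y s"
      using X(2) Y(2) by (rule dbraid_isomorphic)
    ultimately have "(THE s. dbraid \<eta> Y s) = s"
      using dbraid_unique[OF \<eta>] by blast
    then show "s \<in> (\<lambda>Y. THE s. dbraid \<eta> Y s) ` I"
      using Y(1) by blast
  qed
  then show ?thesis
    using I(1) finite_surj by blast
qed

text \<open>The objects on which the double braiding with \<open>\<eta>\<close> is a given scalar are the components of a
  grading. Its group is generated by finitely many scalars, hence it is countable and can be carried
  by a set of natural numbers.\<close>

lemma dbraid_grading:
  assumes \<eta>: "\<eta> \<in> invertible_objects C"
  shows "\<exists>(H :: nat monoid) g. category_grading C H (\<lambda>n. {X. dbraid \<eta> X (g n)})"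
proof -
  define S where "S = {s. \<exists>X. simple_object C X \<and> dbraid \<eta> X s}"
  \<comment> \<open>The subgroup generated by \<open>S\<close>, as the set of values of words in the
    generators and their inverses.\<close>
  define K where "K = prod_list ` lists (S \<union> inverse ` S)"
  have "countable K"
    using finite_dbraid_scalars[OF \<eta>] by (simp add: K_def S_def countable_finite)
  have one: "1 \<in> K"
    unfolding K_def by (intro image_eqI[of _ _ "[]"]) auto
  have mult: "x * y \<in> K" if xy: "x \<in> K" "y \<in> K" for x y
  proof -
    obtain xs ys where "x = prod_list xs" "y = prod_list ys" "xs \<in> lists (S \<union> inverse ` S)"
      "ys \<in> lists (S \<union> inverse ` S)"
      using xy unfolding K_def by blast
    then show ?thesis
      unfolding K_def by (intro image_eqI[of _ _ "xs @ ys"]) auto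
  qed
  have nz: "x \<noteq> 0" if "x \<in> K" for x
  proof -
    have "0 \<notin> S"
      using dbraid_nonzero[OF \<eta>] by (auto simp: S_def simple_object_def)
    then have "0 \<notin> S \<union> inverse ` S"
      by auto
    obtain xs where xs: "x = prod_list xs" "xs \<in> lists (S \<union> inverse ` S)"
      using \<open>x \<in> K\<close> unfolding K_def by blast
    then have "0 \<notin> set xs"
      using \<open>0 \<notin> S \<union> inverse ` S\<close> in_lists_conv_set by metis
    then show ?thesis
      using xs(1) by (simp add: prod_list_zero_iff)
  qed
  have inv: "inverse x \<in> K" if "x \<in> K" for x
  proof -
    obtain xs where xs: "x = prod_list xs" "xs \<in> lists (S \<union> inverse ` S)"
      using \<open>x \<in> K\<close> unfolding K_def by blast
    have "inverse (prod_list xs) = prod_list (map inverse xs)"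
      by (induction xs) simp_all
    moreover have "map inverse xs \<in> lists (S \<union> inverse ` S)"
      using xs(2) by (auto simp: in_lists_conv_set)
    ultimately show ?thesis
      unfolding K_def xs(1) by (intro image_eqI[of _ _ "map inverse xs"])
  qed
  define h where "h = to_nat_on K"
  define g where "g = from_nat_into K"
  have gh: "g (h x) = x" if "x \<in> K" for x
    using \<open>countable K\<close> that by (simp add: g_def h_def)
  \<comment> \<open>The group structure of \<open>K\<close> transported along the enumeration
    \<open>h\<close>, which \<open>g\<close> inverts; \<open>g n\<close> is the scalar of the
    component \<open>n\<close>.\<close>
  define H where "H = \<lparr>carrier = h ` K, monoid.mult = (\<lambda>m n. h (g m * g n)), one = h 1\<rparr>"
  have "group H"
  proof (rule groupI)
    fix x
    assume "x \<in> carrier H"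
    then obtain y where y: "y \<in> K" "x = h y"
      by (auto simp: H_def)
    then show "\<exists>z \<in> carrier H. z \<otimes>\<^bsub>H\<^esub> x = \<one>\<^bsub>H\<^esub>"
      using inv[of y] nz[of y] by (intro bexI[of _ "h (inverse y)"]) (simp_all add: H_def gh)
  qed (auto simp: H_def gh mult one mult.assoc)
  have gK: "g n \<in> K" if "n \<in> carrier H" for n
    using that gh by (auto simp: H_def)
  have g_inj: "g m \<noteq> g n" if "m \<in> carrier H" "n \<in> carrier H" "m \<noteq> n" for m n
    using that gh by (auto simp: H_def)
  have "category_grading C H (\<lambda>n. {X. dbraid \<eta> X (g n)})"
  proof (rule category_grading.intro)
    show "group H"
      by fact
  next
    fix n X Y
    assume "X \<in> {X. dbraid \<eta> X (g n)}" "isomorphic C X Y"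
    then show "Y \<in> {X. dbraid \<eta> X (g n)}"
      using dbraid_isomorphic by blast
  next
    fix m n X Y
    assume *: "m \<in> carrier H" "n \<in> carrier H" "m \<noteq> n"
      "X \<in> {X. dbraid \<eta> X (g m)}" "Y \<in> {X. dbraid \<eta> X (g n)}"
    have "f = Zero C X Y" if "Dom C f = X" "Cod C f = Y" for f
      using dbraid_hom_Zero[OF \<eta>, of f] * g_inj that by auto
    then show "hom_set C X Y = {Zero C X Y}"
      by (auto simp: hom_iff)
  next
    fix X
    obtain ss Z where *: "distinct ss" "\<forall>s \<in> set ss. \<exists>S. simple_object C S \<and> dbraid \<eta> S s"
      "\<forall>s \<in> set ss. dbraid \<eta> (Z s) s" "direct_sum C X (map Z ss)"
      using dbraid_decomposition[OF \<eta>] by blast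
    have "s \<in> K" if "s \<in> S" for s
      unfolding K_def using that by (intro image_eqI[of _ _ "[s]"]) auto
    then have ss: "set ss \<subseteq> K"
      using *(2) by (auto simp: S_def)
    then have "map (Z \<circ> g) (map h ss) = map Z ss"
      using gh by auto
    then have "direct_sum C X (map (Z \<circ> g) (map h ss))"
      using *(4) by (simp only:)
    moreover have "distinct (map h ss)"
      using *(1) ss gh by (metis distinct_map inj_on_inverseI inj_on_subset)
    moreover have "set (map h ss) \<subseteq> carrier H"
      using ss by (auto simp: H_def)
    moreover have "\<forall>n \<in> set (map h ss). (Z \<circ> g) n \<in> {X. dbraid \<eta> X (g n)}"
      using *(3) ss gh by auto
    ultimately show "\<exists>gs Z. distinct gs \<and> set gs \<subseteq> carrier H \<and>
        (\<forall>n \<in> set gs. Z n \<in> {X. dbraid \<eta> X (g n)}) \<and> direct_sum C X (map Z gs)"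
      by blast
  next
    fix m n X Y
    assume "m \<in> carrier H" "n \<in> carrier H" "X \<in> {X. dbraid \<eta> X (g m)}" "Y \<in> {X. dbraid \<eta> X (g n)}"
    then show "X \<odot> Y \<in> {X. dbraid \<eta> X (g (m \<otimes>\<^bsub>H\<^esub> n))}"
      using dbraid_TenO[of \<eta> X _ Y] gh mult gK by (simp add: H_def)
  qed
  then show ?thesis
    by blast
qed

text \<open>The homomorphism given by universality sends the degree \<open>a\<close> to the index of
  a single component of the grading by scalars, and all of \<open>Cg a\<close> lies in that
  component. This reaches homogeneous objects that are not simple.\<close>

lemma ex_dbraid_homogeneous:
  assumes "universal_grading C A Cg" "\<eta> \<in> invertible_objects C" "a \<in> carrier A" "X \<in> Cg a"
  shows "\<exists>s. dbraid \<eta> X s"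
proof -
  obtain H :: "nat monoid" and g where "category_grading C H (\<lambda>n. {X. dbraid \<eta> X (g n)})"
    using dbraid_grading[OF assms(2)] by blast
  then obtain \<phi> where "\<forall>a \<in> carrier A. Cg a \<subseteq> {X. dbraid \<eta> X (g (\<phi> a))}"
    using universal_grading.universal[OF assms(1)] by blast
  then show ?thesis
    using assms(3,4) by blast
qed

subsection \<open>Degrees\<close>

text \<open>Since the unit is simple, some summand in its decomposition is isomorphic to it, so it
  is homogeneous. Being its own square, it has an idempotent degree.\<close>

lemma Unit_graded:
  assumes "category_grading C A Cg"
  shows "\<I> \<in> Cg \<one>\<^bsub>A\<^esub>"
proof -
  interpret category_grading C A Cg
    by fact
  interpret A: group A
    by (rule group_G)
  obtain gs Z where Z: "distinct gs" "set gs \<subseteq> carrier A" "\<forall>g \<in> set gs. Z g \<in> Cg g"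
    "direct_sum C \<I> (map Z gs)"
    using decomposition by blast
  let ?n = "length (map Z gs)"
  obtain \<iota> \<pi> where res: "resolves \<I> ?n \<iota> \<pi>"
    and \<iota>: "\<And>i. i < ?n \<Longrightarrow> Dom C (\<iota> i) = map Z gs ! i \<and> Cod C (\<iota> i) = \<I>"
    and \<pi>: "\<And>i. i < ?n \<Longrightarrow> Dom C (\<pi> i) = \<I> \<and> Cod C (\<pi> i) = map Z gs ! i"
    and \<pi>\<iota>: "\<And>i j. i < ?n \<Longrightarrow> j < ?n \<Longrightarrow>
      \<pi> i \<cdot> \<iota> j = (if i = j then \<i>\<d> (map Z gs ! i) else Zero C (map Z gs ! j) (map Z gs ! i))"
    using Z(4) by (rule direct_sumE) blast
  have "\<exists>i < ?n. \<i>\<d> \<I> \<cdot> \<iota> i \<noteq> Zero C \<I> \<I> \<cdot> \<iota> i"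
    using resolves_ext[OF res, of "\<i>\<d> \<I>" "Zero C \<I> \<I>"] not_zero_object_Unit
    by (auto simp: zero_object_iff)
  then obtain i where i: "i < ?n" "\<iota> i \<noteq> Zero C (Z (gs ! i)) \<I>"
    using \<iota> by auto
  obtain f where f: "Dom C f = \<I>" "Cod C f = Z (gs ! i)" "\<iota> i \<cdot> f = \<i>\<d> \<I>"
    using simple_split_epi[OF simple_Unit, of "\<iota> i"] i \<iota>[OF i(1)] by auto
  \<comment> \<open>A right inverse of \<open>\<iota> i\<close> agrees with its left inverse
    \<open>\<pi> i\<close>.\<close>
  have "f = (\<pi> i \<cdot> \<iota> i) \<cdot> f"
    using \<pi>\<iota>[OF i(1) i(1)] f i(1) by simp
  also have "\<dots> = \<pi> i"
    using \<iota>[OF i(1)] \<pi>[OF i(1)] f i(1) by simp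
  finally have "inverse_mors C (\<iota> i) f"
    using \<pi>\<iota>[OF i(1) i(1)] \<iota>[OF i(1)] f i(1) by (simp add: inverse_mors_iff)
  then have "isomorphic C (Z (gs ! i)) \<I>"
    using \<iota>[OF i(1)] i(1) by (intro isomorphicI[of "\<iota> i"]) (auto simp: is_iso_def)
  moreover have g: "gs ! i \<in> carrier A" "Z (gs ! i) \<in> Cg (gs ! i)"
    using Z i(1) by auto
  ultimately have I: "\<I> \<in> Cg (gs ! i)"
    using replete by blast
  then have "\<I> \<in> Cg (gs ! i \<otimes>\<^bsub>A\<^esub> gs ! i)"
    using TenO_graded[OF g(1) g(1) I I] by simp
  then have "gs ! i = gs ! i \<otimes>\<^bsub>A\<^esub> gs ! i"
    using orthogonal[of "gs ! i" "gs ! i \<otimes>\<^bsub>A\<^esub> gs ! i" \<I> \<I>] g(1) I not_zero_object_Unit Id_in_hom[of \<I>]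
    by (auto simp: zero_object_iff)
  then have "gs ! i = \<one>\<^bsub>A\<^esub>"
    using g(1) A.l_cancel_one' by metis
  then show ?thesis
    using I by simp
qed

text \<open>Pairing a summand of degree \<open>g\<close> in the dual with \<open>X\<close> gives a
  morphism from degree \<open>g \<otimes> a\<close> to the degree of the unit. It vanishes unless
  \<open>g\<close> is the inverse of \<open>a\<close>, and then so does the injection of the
  summand; hence one summand is everything.\<close>

lemma Dual_graded:
  assumes "category_grading C A Cg" "a \<in> carrier A" "X \<in> Cg a" "\<not> zero_object C X"
  shows "Dual C X \<in> Cg (inv\<^bsub>A\<^esub> a)"
proof -
  interpret category_grading C A Cg
    by fact
  interpret A: group A
    by (rule group_G)
  obtain gs Z where Z: "distinct gs" "set gs \<subseteq> carrier A" "\<forall>g \<in> set gs. Z g \<in> Cg g"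
    "direct_sum C (Dual C X) (map Z gs)"
    using decomposition by blast
  let ?n = "length (map Z gs)"
  obtain \<iota> \<pi> where res: "resolves (Dual C X) ?n \<iota> \<pi>"
    and \<iota>: "\<And>i. i < ?n \<Longrightarrow> Dom C (\<iota> i) = map Z gs ! i \<and> Cod C (\<iota> i) = Dual C X"
    and \<pi>: "\<And>i. i < ?n \<Longrightarrow> Dom C (\<pi> i) = Dual C X \<and> Cod C (\<pi> i) = map Z gs ! i"
    and \<pi>\<iota>: "\<And>i j. i < ?n \<Longrightarrow> j < ?n \<Longrightarrow>
      \<pi> i \<cdot> \<iota> j = (if i = j then \<i>\<d> (map Z gs ! i) else Zero C (map Z gs ! j) (map Z gs ! i))"
    using Z(4) by (rule direct_sumE) blast
  have \<iota>_Zero: "\<iota> i = Zero C (Z (gs ! i)) (Dual C X)" if i: "i < ?n" "gs ! i \<noteq> inv\<^bsub>A\<^esub> a" for i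
  proof (rule Ev_ext)
    have g: "gs ! i \<in> carrier A" "Z (gs ! i) \<in> Cg (gs ! i)"
      using Z i(1) by auto
    have "gs ! i \<otimes>\<^bsub>A\<^esub> a \<noteq> \<one>\<^bsub>A\<^esub>"
      using g(1) assms(2) i(2) A.inv_equality by metis
    then have "hom_set C (Z (gs ! i) \<odot> X) \<I> = {Zero C (Z (gs ! i) \<odot> X) \<I>}"
      using g assms(2,3) TenO_graded Unit_graded[OF assms(1)]
      by (intro orthogonal[of "gs ! i \<otimes>\<^bsub>A\<^esub> a" "\<one>\<^bsub>A\<^esub>"]) simp_all
    moreover have "Ev C X \<cdot> (\<iota> i \<star> \<i>\<d> X) \<in> hom_set C (Z (gs ! i) \<odot> X) \<I>"
      using \<iota>[OF i(1)] i(1) by (simp add: hom_iff)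
    ultimately show "Ev C X \<cdot> (\<iota> i \<star> \<i>\<d> X) = Ev C X \<cdot> (Zero C (Z (gs ! i)) (Dual C X) \<star> \<i>\<d> X)"
      by simp
  qed (use \<iota> i in simp_all)
  have "\<exists>i < ?n. \<i>\<d> (Dual C X) \<cdot> \<iota> i \<noteq> Zero C (Dual C X) (Dual C X) \<cdot> \<iota> i"
    using resolves_ext[OF res, of "\<i>\<d> (Dual C X)" "Zero C (Dual C X) (Dual C X)"]
      zero_object_Dual assms(4) by (auto simp: zero_object_iff)
  then obtain i where i: "i < ?n" "\<iota> i \<noteq> Zero C (Z (gs ! i)) (Dual C X)"
    using \<iota> by auto
  then have gi: "gs ! i = inv\<^bsub>A\<^esub> a"
    using \<iota>_Zero by blast
  have "\<iota> i \<cdot> \<pi> i = \<i>\<d> (Dual C X)"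
  proof (rule resolves_ext[OF res])
    fix j
    assume j: "j < ?n"
    show "(\<iota> i \<cdot> \<pi> i) \<cdot> \<iota> j = \<i>\<d> (Dual C X) \<cdot> \<iota> j"
    proof (cases "j = i")
      case True
      then show ?thesis
        using \<pi>\<iota>[OF i(1) i(1)] \<iota>[OF i(1)] \<pi>[OF i(1)] i(1) by simp
    next
      case False
      then have "gs ! j \<noteq> inv\<^bsub>A\<^esub> a"
        using gi Z(1) i(1) j by (metis length_map nth_eq_iff_index_eq)
      then show ?thesis
        using \<iota>_Zero[OF j] \<iota>[OF i(1)] \<pi>[OF i(1)] by simp
    qed
  qed (use \<iota>[OF i(1)] \<pi>[OF i(1)] in simp_all)
  then have "inverse_mors C (\<iota> i) (\<pi> i)"
    using \<pi>\<iota>[OF i(1) i(1)] \<iota>[OF i(1)] \<pi>[OF i(1)] by (simp add: inverse_mors_iff)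
  then have "isomorphic C (Z (gs ! i)) (Dual C X)"
    using \<iota>[OF i(1)] i(1) by (intro isomorphicI[of "\<iota> i"]) (auto simp: is_iso_def)
  moreover have "gs ! i \<in> carrier A" "Z (gs ! i) \<in> Cg (gs ! i)"
    using Z i(1) by auto
  ultimately show ?thesis
    using replete gi by metis
qed

end

section \<open>Warp products\<close>

context strict_ribbon_fusion_category
begin

text \<open>A triple \<open>(X, L, s)\<close> stands for the source of an isomorphism \<open>s\<close> to \<open>X \<odot> L\<close>. In the product of
  two triples the second component of the first one passes underneath the first component of the
  second one, so that \<open>s\<close> is the map \<open>\<Sigma>\<close> of the warp product.\<close>

fun box :: "'o \<times> 'o \<times> 'm \<Rightarrow> 'o \<times> 'o \<times> 'm \<Rightarrow> 'o \<times> 'o \<times> 'm" (infixr "\<bowtie>" 75) where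
  "(X, L, s) \<bowtie> (Y, M, r) = (X \<odot> Y, L \<odot> M, (\<i>\<d> X \<star> under L Y \<star> \<i>\<d> M) \<cdot> (s \<star> r))"

definition pr :: "'o \<Rightarrow> 'o \<Rightarrow> 'o \<times> 'o \<times> 'm" where
  "pr X L = (X, L, \<i>\<d> (X \<odot> L))"

fun valid :: "'o \<times> 'o \<times> 'm \<Rightarrow> bool" where
  "valid (X, L, s) \<longleftrightarrow> is_iso C s \<and> Cod C s = X \<odot> L"

definition source :: "'o \<times> 'o \<times> 'm \<Rightarrow> 'o" where
  "source S = Dom C (snd (snd S))"

text \<open>The defining equation of a warp product with the inverse cleared from it. The
  isomorphisms \<open>s\<close> and \<open>r\<close> need not come from lists of pairs, which admits
  the intermediate bracketings.\<close>

fun warps :: "'o \<times> 'o \<times> 'm \<Rightarrow> 'o \<times> 'o \<times> 'm \<Rightarrow> 'm \<Rightarrow> 'm \<Rightarrow> 'm \<Rightarrow> bool" where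
  "warps (X, L, s) (Y, M, r) f j h \<longleftrightarrow> Dom C f = X \<and> Cod C f = Y \<and> Dom C j = L \<and> Cod C j = M \<and>
     Dom C h = Dom C s \<and> Cod C h = Dom C r \<and> r \<cdot> h = (f \<star> j) \<cdot> s"

lemma valid_pr [simp]: "valid (pr X L)"
  by (simp add: pr_def)

lemma valid_box [simp]: "valid S \<Longrightarrow> valid S' \<Longrightarrow> valid (S \<bowtie> S')"
  by (cases S; cases S') simp

lemma fst_box [simp]: "fst (S \<bowtie> S') = fst S \<odot> fst S'"
  by (cases S; cases S') simp

lemma fst_snd_box [simp]: "fst (snd (S \<bowtie> S')) = fst (snd S) \<odot> fst (snd S')"
  by (cases S; cases S') simp

lemma fst_pr [simp]: "fst (pr X L) = X" and fst_snd_pr [simp]: "fst (snd (pr X L)) = L"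
  by (simp_all add: pr_def)

lemma source_pr [simp]: "source (pr X L) = X \<odot> L"
  by (simp add: source_def pr_def)

lemma source_box [simp]: "valid S \<Longrightarrow> valid S' \<Longrightarrow> source (S \<bowtie> S') = source S \<odot> source S'"
  by (cases S; cases S') (simp add: source_def)

lemma box_Unit_left [simp]: "valid S \<Longrightarrow> pr \<I> \<I> \<bowtie> S = S"
  by (cases S) (simp add: pr_def TenM_Id)

lemma box_Unit_right [simp]: "valid S \<Longrightarrow> S \<bowtie> pr \<I> \<I> = S"
  by (cases S) (simp add: pr_def TenM_Id)

text \<open>With a unit in the inner position there is nothing to cross. This and the next rule let
  an invertible factor be detached from its pair and attached elsewhere.\<close>

lemma box_pr_right [simp]: "pr X L \<bowtie> pr \<I> M = pr X (L \<odot> M)"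
  by (simp add: pr_def TenM_Id)

lemma box_pr_left [simp]: "pr X \<I> \<bowtie> pr Y M = pr (X \<odot> Y) M"
  by (simp add: pr_def TenM_Id)

lemma Cmp_TenM_Id: "Dom C g = Cod C f \<Longrightarrow> (g \<cdot> f) \<star> \<i>\<d> X = (g \<star> \<i>\<d> X) \<cdot> (f \<star> \<i>\<d> X)"
  and Id_TenM_Cmp: "Dom C g = Cod C f \<Longrightarrow> \<i>\<d> X \<star> (g \<cdot> f) = (\<i>\<d> X \<star> g) \<cdot> (\<i>\<d> X \<star> f)"
  by (simp_all add: interchange)

text \<open>Both bracketings contain the same three crossings: \<open>L\<close> under
  \<open>X'\<close>, \<open>L\<close> under \<open>X''\<close> and \<open>L'\<close> under
  \<open>X''\<close>. They differ in the order of the first and the third, which sit on disjoint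
  strands.\<close>

lemma box_assoc:
  assumes "valid S" "valid S'" "valid S''"
  shows "(S \<bowtie> S') \<bowtie> S'' = S \<bowtie> S' \<bowtie> S''"
proof -
  obtain X L s where S: "S = (X, L, s)"
    by (cases S)
  obtain X' L' s' where S': "S' = (X', L', s')"
    by (cases S')
  obtain X'' L'' s'' where S'': "S'' = (X'', L'', s'')"
    by (cases S'')
  have typing: "Cod C s = X \<odot> L" "Cod C s' = X' \<odot> L'" "Cod C s'' = X'' \<odot> L''"
    using assms by (simp_all add: S S' S'')
  let ?a = "\<i>\<d> X \<star> \<i>\<d> X' \<star> under L X'' \<star> \<i>\<d> L' \<star> \<i>\<d> L''"
  let ?b = "\<i>\<d> X \<star> \<i>\<d> X' \<star> \<i>\<d> L \<star> under L' X'' \<star> \<i>\<d> L''"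
  let ?c = "\<i>\<d> X \<star> under L X' \<star> \<i>\<d> L' \<star> \<i>\<d> X'' \<star> \<i>\<d> L''"
  let ?c' = "\<i>\<d> X \<star> under L X' \<star> \<i>\<d> X'' \<star> \<i>\<d> L' \<star> \<i>\<d> L''"
  let ?b' = "\<i>\<d> X \<star> \<i>\<d> L \<star> \<i>\<d> X' \<star> under L' X'' \<star> \<i>\<d> L''"
  let ?s = "s \<star> s' \<star> s''"
  have "((\<i>\<d> X \<star> under L X' \<star> \<i>\<d> L') \<cdot> (s \<star> s')) \<star> s'' =
      ((\<i>\<d> X \<star> under L X' \<star> \<i>\<d> L') \<star> \<i>\<d> X'' \<star> \<i>\<d> L'') \<cdot> ((s \<star> s') \<star> s'')"
    using typing by (subst interchange) (simp_all add: TenM_Id)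
  moreover have "under (L \<odot> L') X'' \<star> \<i>\<d> L'' =
      (under L X'' \<star> \<i>\<d> L' \<star> \<i>\<d> L'') \<cdot> (\<i>\<d> L \<star> under L' X'' \<star> \<i>\<d> L'')"
    using interchange[of "under L X'' \<star> \<i>\<d> L'" "\<i>\<d> L \<star> under L' X''" "\<i>\<d> L''" "\<i>\<d> L''"]
    by (simp add: under_TenO_left)
  ultimately have left: "snd (snd ((S \<bowtie> S') \<bowtie> S'')) = ?a \<cdot> ?b \<cdot> ?c \<cdot> ?s"
    using typing by (simp add: S S' S'' Id_TenO interchange_Cmp)
  have "s \<star> ((\<i>\<d> X' \<star> under L' X'' \<star> \<i>\<d> L'') \<cdot> (s' \<star> s'')) =
      ((\<i>\<d> X \<star> \<i>\<d> L) \<star> \<i>\<d> X' \<star> under L' X'' \<star> \<i>\<d> L'') \<cdot> (s \<star> s' \<star> s'')"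
    using typing by (subst interchange) (simp_all add: TenM_Id)
  moreover have "under L (X' \<odot> X'') \<star> \<i>\<d> L' \<star> \<i>\<d> L'' =
      (\<i>\<d> X' \<star> under L X'' \<star> \<i>\<d> L' \<star> \<i>\<d> L'') \<cdot> (under L X' \<star> \<i>\<d> X'' \<star> \<i>\<d> L' \<star> \<i>\<d> L'')"
    using interchange[of "\<i>\<d> X' \<star> under L X''" "under L X' \<star> \<i>\<d> X''" "\<i>\<d> (L' \<odot> L'')" "\<i>\<d> (L' \<odot> L'')"]
    by (simp add: under_TenO_right TenM_Id)
  ultimately have right: "snd (snd (S \<bowtie> S' \<bowtie> S'')) = ?a \<cdot> ?c' \<cdot> ?b' \<cdot> ?s"
    using typing by (simp add: S S' S'' Id_TenO interchange_Cmp)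
  have "?b \<cdot> ?c = \<i>\<d> X \<star> ((\<i>\<d> (X' \<odot> L) \<star> under L' X'') \<cdot> (under L X' \<star> \<i>\<d> (L' \<odot> X''))) \<star> \<i>\<d> L''"
    by (simp add: Cmp_TenM_Id Id_TenM_Cmp Id_TenO)
  also have "(\<i>\<d> (X' \<odot> L) \<star> under L' X'') \<cdot> (under L X' \<star> \<i>\<d> (L' \<odot> X'')) =
      (under L X' \<star> \<i>\<d> (X'' \<odot> L')) \<cdot> (\<i>\<d> (L \<odot> X') \<star> under L' X'')"
    by (simp add: interchange)
  also have "\<i>\<d> X \<star> \<dots> \<star> \<i>\<d> L'' = ?c' \<cdot> ?b'"
    by (simp add: Cmp_TenM_Id Id_TenM_Cmp Id_TenO)
  finally have bc: "?b \<cdot> ?c = ?c' \<cdot> ?b'" .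
  have "?b \<cdot> ?c \<cdot> ?s = (?b \<cdot> ?c) \<cdot> ?s"
    using typing by simp
  also have "\<dots> = ?c' \<cdot> ?b' \<cdot> ?s"
    unfolding bc using typing by simp
  finally have "snd (snd ((S \<bowtie> S') \<bowtie> S'')) = snd (snd (S \<bowtie> S' \<bowtie> S''))"
    unfolding left right by (rule arg_cong)
  then show ?thesis
    by (intro prod_eqI) simp_all
qed

section \<open>Closure properties of warps\<close>

lemma warps_Id: "valid S \<Longrightarrow> warps S S (\<i>\<d> (fst S)) (\<i>\<d> (fst (snd S))) (\<i>\<d> (source S))"
  by (cases S) (simp add: source_def TenM_Id)

lemma warps_pr: "warps (pr (Dom C f) (Dom C j)) (pr (Cod C f) (Cod C j)) f j (f \<star> j)"
  by (simp add: pr_def)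

lemma warps_typing:
  assumes "warps S S' f j h"
  shows "Dom C f = fst S" "Cod C f = fst S'" "Dom C j = fst (snd S)" "Cod C j = fst (snd S')"
    "Dom C h = source S" "Cod C h = source S'"
  using assms by (cases S; cases S'; simp add: source_def)+

lemma warps_Cmp:
  assumes "valid S" "valid S'" "valid S''" "warps S S' f j h" "warps S' S'' f' j' h'"
  shows "warps S S'' (f' \<cdot> f) (j' \<cdot> j) (h' \<cdot> h)"
proof -
  obtain X L s where S: "S = (X, L, s)"
    by (cases S)
  obtain X' L' s' where S': "S' = (X', L', s')"
    by (cases S')
  obtain X'' L'' s'' where S'': "S'' = (X'', L'', s'')"
    by (cases S'')
  have 1: "Dom C f = X" "Cod C f = X'" "Dom C j = L" "Cod C j = L'" "Dom C h = Dom C s"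
    "Cod C h = Dom C s'" "s' \<cdot> h = (f \<star> j) \<cdot> s" "Cod C s = X \<odot> L" "Cod C s' = X' \<odot> L'"
    using assms by (simp_all add: S S')
  have 2: "Dom C f' = X'" "Cod C f' = X''" "Dom C j' = L'" "Cod C j' = L''" "Dom C h' = Dom C s'"
    "Cod C h' = Dom C s''" "s'' \<cdot> h' = (f' \<star> j') \<cdot> s'"
    using assms by (simp_all add: S' S'')
  have "s'' \<cdot> h' \<cdot> h = (s'' \<cdot> h') \<cdot> h"
    using 1 2 by (subst Cmp_assoc_right) simp_all
  also have "\<dots> = (f' \<star> j') \<cdot> s' \<cdot> h"
    unfolding 2(7) using 1 2 by simp
  also have "\<dots> = ((f' \<cdot> f) \<star> (j' \<cdot> j)) \<cdot> s"
    unfolding 1(7) using 1(1-6,8,9) 2(1-6) by (simp add: interchange_Cmp)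
  finally show ?thesis
    using 1(1-6) 2(1-6) by (simp add: S S'')
qed

text \<open>Naturality slides \<open>j\<close> and \<open>g\<close> through the crossing that the
  product of triples introduces.\<close>

lemma warps_TenM:
  assumes "valid S" "valid S'" "valid R" "valid R'" "warps S S' f j h" "warps R R' g k l"
  shows "warps (S \<bowtie> R) (S' \<bowtie> R') (f \<star> g) (j \<star> k) (h \<star> l)"
proof -
  obtain X L s where S: "S = (X, L, s)"
    by (cases S)
  obtain X' L' s' where S': "S' = (X', L', s')"
    by (cases S')
  obtain Y M r where R: "R = (Y, M, r)"
    by (cases R)
  obtain Y' M' r' where R': "R' = (Y', M', r')"
    by (cases R')
  have 1: "Dom C f = X" "Cod C f = X'" "Dom C j = L" "Cod C j = L'" "Dom C h = Dom C s"
    "Cod C h = Dom C s'" "Cod C s = X \<odot> L" "Cod C s' = X' \<odot> L'"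
    "Dom C g = Y" "Cod C g = Y'" "Dom C k = M" "Cod C k = M'" "Dom C l = Dom C r"
    "Cod C l = Dom C r'" "Cod C r = Y \<odot> M" "Cod C r' = Y' \<odot> M'"
    and 2: "s' \<cdot> h = (f \<star> j) \<cdot> s" "r' \<cdot> l = (g \<star> k) \<cdot> r"
    using assms by (simp_all add: S S' R R')
  have under: "under L' Y' \<cdot> (j \<star> g) = (g \<star> j) \<cdot> under L Y"
    using under_nat[of j g] 1 by simp
  have "((\<i>\<d> X' \<star> under L' Y' \<star> \<i>\<d> M') \<cdot> (s' \<star> r')) \<cdot> (h \<star> l) =
      (\<i>\<d> X' \<star> under L' Y' \<star> \<i>\<d> M') \<cdot> (((f \<star> j) \<cdot> s) \<star> ((g \<star> k) \<cdot> r))"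
    using 1 by (simp add: interchange 2)
  also have "\<dots> = (\<i>\<d> X' \<star> under L' Y' \<star> \<i>\<d> M') \<cdot> ((f \<star> j) \<star> (g \<star> k)) \<cdot> (s \<star> r)"
    using 1 by (subst interchange[of "f \<star> j" s "g \<star> k" r, symmetric]) simp_all
  also have "\<dots> = ((\<i>\<d> X' \<star> under L' Y' \<star> \<i>\<d> M') \<cdot> (f \<star> (j \<star> g) \<star> k)) \<cdot> (s \<star> r)"
    using 1 by simp
  also have "(\<i>\<d> X' \<star> under L' Y' \<star> \<i>\<d> M') \<cdot> (f \<star> (j \<star> g) \<star> k) = f \<star> ((g \<star> j) \<cdot> under L Y) \<star> k"
    using 1 by (subst interchange, simp, simp, subst interchange) (simp_all add: under)
  also have "\<dots> = (f \<star> (g \<star> j) \<star> k) \<cdot> (\<i>\<d> X \<star> under L Y \<star> \<i>\<d> M)"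
    using 1 by (subst interchange, simp, simp, subst interchange) simp_all
  finally show ?thesis
    using 1 by (simp add: S S' R R')
qed

text \<open>Scalars are charged to \<open>j\<close>, so that the morphism of the original category
  stays the same.\<close>

lemma warps_Smult:
  "valid S \<Longrightarrow> warps S S' f j h \<Longrightarrow> warps S S' f (Smult C c j) (Smult C c h)"
  by (cases S; cases S') simp

lemma warps_minv:
  assumes "valid S" "valid S'" "warps S S' f j h" "is_iso C f" "is_iso C j" "is_iso C h"
  shows "warps S' S (minv C f) (minv C j) (minv C h)"
proof -
  obtain X L s where S: "S = (X, L, s)"
    by (cases S)
  obtain X' L' s' where S': "S' = (X', L', s')"
    by (cases S')
  have 1: "Dom C f = X" "Cod C f = X'" "Dom C j = L" "Cod C j = L'" "Dom C h = Dom C s"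
    "Cod C h = Dom C s'" "Cod C s = X \<odot> L" "Cod C s' = X' \<odot> L'"
    and 2: "s' \<cdot> h = (f \<star> j) \<cdot> s"
    using assms by (simp_all add: S S')
  have "minv C f \<star> minv C j = minv C (f \<star> j)"
    using assms(4,5) by (simp add: minv_TenM)
  then have "(minv C f \<star> minv C j) \<cdot> s' = minv C (f \<star> j) \<cdot> (s' \<cdot> h) \<cdot> minv C h"
    using 1 assms(4-6) by simp
  also have "\<dots> = minv C (f \<star> j) \<cdot> (f \<star> j) \<cdot> s \<cdot> minv C h"
    unfolding 2 using 1 assms(4-6) by simp
  also have "\<dots> = s \<cdot> minv C h"
    using 1 assms(4-6) by (subst minv_Cmp_cancel) simp_all
  finally show ?thesis
    using 1 assms(4-6) by (simp add: S S')
qed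

text \<open>The crossing of \<open>L\<close> under \<open>Y\<close> is already part of the source
  triple; only the crossing with \<open>M\<close>, between invertible objects in the application, is
  left for \<open>j\<close>. This is the crossing in the zested associator.\<close>

lemma warps_under:
  "warps (pr \<I> L \<bowtie> pr Y M) (pr Y (M \<odot> L)) (\<i>\<d> Y) (under L M) (under L (Y \<odot> M))"
  by (simp add: pr_def under_TenO_right TenM_Id)

text \<open>In the braiding of \<open>X \<odot> L\<close> with \<open>Y \<odot> M\<close> the strand \<open>L\<close> passes over \<open>Y\<close>, but under \<open>Y\<close> in the
  warp product; the two crossings differ by a scalar.\<close>

lemma warps_Braid:
  assumes "dbraid L Y c"
  shows "warps (pr X L \<bowtie> pr Y M) (pr Y M \<bowtie> pr X L) (\<beta> X Y) (Smult C c (\<beta> L M)) (\<beta> (X \<odot> L) (Y \<odot> M))"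
proof -
  let ?b = "\<beta> X Y \<star> \<i>\<d> M \<star> \<i>\<d> L"
  let ?d = "\<i>\<d> X \<star> \<i>\<d> Y \<star> \<beta> L M"
  let ?u = "\<i>\<d> X \<star> under L Y \<star> \<i>\<d> M"
  \<comment> \<open>The hexagons resolve the crossing of the two bundles into \<open>L\<close> over
    \<open>Y\<close>, \<open>L\<close> over \<open>M\<close>, \<open>X\<close> over \<open>Y\<close>
    and \<open>X\<close> over \<open>M\<close>.\<close>
  have "\<beta> (X \<odot> L) (Y \<odot> M) =
      (\<i>\<d> Y \<star> \<beta> X M \<star> \<i>\<d> L) \<cdot> ?b \<cdot> ?d \<cdot> (\<i>\<d> X \<star> \<beta> L Y \<star> \<i>\<d> M)"
    by (simp add: hexagon_left[of X L] hexagon_right[of X Y] hexagon_right[of L Y]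
      Cmp_TenM_Id Id_TenM_Cmp)
  also have "(\<i>\<d> X \<star> \<beta> L Y \<star> \<i>\<d> M) = Smult C c ?u"
    using dbraid_Braid[OF assms] by simp
  finally have "(\<i>\<d> Y \<star> under M X \<star> \<i>\<d> L) \<cdot> \<beta> (X \<odot> L) (Y \<odot> M) =
      Smult C c (((\<i>\<d> Y \<star> under M X \<star> \<i>\<d> L) \<cdot> (\<i>\<d> Y \<star> \<beta> X M \<star> \<i>\<d> L)) \<cdot> ?b \<cdot> ?d \<cdot> ?u)"
    by simp
  \<comment> \<open>The crossing of \<open>X\<close> over \<open>M\<close> is undone by the target
    triple, in which \<open>M\<close> returns underneath \<open>X\<close>.\<close>
  also have "(\<i>\<d> Y \<star> under M X \<star> \<i>\<d> L) \<cdot> (\<i>\<d> Y \<star> \<beta> X M \<star> \<i>\<d> L) = \<i>\<d> (Y \<odot> X \<odot> M \<odot> L)"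
    by (simp add: interchange under_Braid TenM_Id)
  also have "\<i>\<d> (Y \<odot> X \<odot> M \<odot> L) \<cdot> ?b \<cdot> ?d \<cdot> ?u = (?b \<cdot> ?d) \<cdot> ?u"
    by simp
  also have "?b \<cdot> ?d = (\<beta> X Y \<star> \<i>\<d> (M \<odot> L)) \<cdot> (\<i>\<d> (X \<odot> Y) \<star> \<beta> L M)"
    by (simp add: Id_TenO)
  also have "\<dots> = \<beta> X Y \<star> \<beta> L M"
    by (subst interchange) simp_all
  finally show ?thesis
    by (simp add: pr_def TenM_Id)
qed

subsection \<open>The map \<open>\<Sigma>\<close> of a list\<close>

definition shape :: "('o \<times> 'o) list \<Rightarrow> 'o \<times> 'o \<times> 'm" where
  "shape XLs = foldr (\<lambda>(X, L) S. pr X L \<bowtie> S) XLs (pr \<I> \<I>)"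

lemma shape_simps [simp]:
  "shape [] = pr \<I> \<I>"
  "shape ((X, L) # XLs) = pr X L \<bowtie> shape XLs"
  by (simp_all add: shape_def)

lemma valid_shape [simp]: "valid (shape XLs)"
  by (induction XLs) auto

lemma tensor_list_simps [simp]:
  "tensor_list C [] = \<I>"
  "tensor_list C (X # Xs) = X \<odot> tensor_list C Xs"
  by (simp_all add: tensor_list_def)

lemma pass_under_eq: "pass_under C L Xs = under L (tensor_list C Xs)"
  by (induction Xs) (simp_all add: under_TenO_right under_def[symmetric])

text \<open>The link to the warp product of the theorem: multiplying the pairs one by one builds
  exactly the isomorphism \<open>unshuffle\<close>.\<close>

lemma shape_eq:
  "shape XLs = (tensor_list C (map fst XLs), tensor_list C (map snd XLs), unshuffle C XLs)"
proof (induction XLs)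
  case (Cons XL XLs)
  obtain X L where "XL = (X, L)"
    by (cases XL)
  then show ?case
    using Cons.IH by (simp add: pr_def pass_under_eq Id_TenO)
qed (simp add: pr_def)

lemma warps_imp_warp:
  assumes "warps (shape XLs) (shape YMs) f j h"
  shows "h = warp C XLs YMs f j"
proof -
  have "valid (shape XLs)" "valid (shape YMs)"
    by simp_all
  then have "is_iso C (unshuffle C YMs)" "Cod C h = Dom C (unshuffle C YMs)"
    "unshuffle C YMs \<cdot> h = (f \<star> j) \<cdot> unshuffle C XLs"
    using assms by (simp_all add: shape_eq)
  then show ?thesis
    unfolding warp_def by (metis minv_Cmp_cancel)
qed

end

section \<open>Zested categories\<close>

locale zesting = strict_ribbon_fusion_category C + A: comm_group A + universal_grading C A Cg +
  ribbon_zesting C A Cg lam nu t eps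
  for C :: "('o, 'm, 'k::{alg_closed_field,field_char_0}) ribbon_data" (structure)
    and A :: "'a monoid" and Cg :: "'a \<Rightarrow> 'o set" and lam :: "'a \<Rightarrow> 'a \<Rightarrow> 'o"
    and nu :: "'a \<Rightarrow> 'a \<Rightarrow> 'a \<Rightarrow> 'm" and t :: "'a \<Rightarrow> 'a \<Rightarrow> 'm" and eps :: "'a \<Rightarrow> 'k"
begin

section \<open>Structure maps and degrees in the zested category\<close>

abbreviation Z :: "('o, 'm, 'k) ribbon_data" where
  "Z \<equiv> zested C A Cg lam nu t eps"

lemma Z_simps [simp]:
  "Dom Z = Dom C" "Cod Z = Cod C" "Ident Z = Ident C" "Cmp Z = Cmp C" "Unit Z = Unit C"
  by (simp_all add: zested_def)

lemma TenO_Z: "X \<odot>\<^bsub>Z\<^esub> Y = X \<odot> Y \<odot> lam (deg A Cg X) (deg A Cg Y)"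
  and TenM_Z: "f \<star>\<^bsub>Z\<^esub> g = f \<star> g \<star> \<i>\<d> (lam (deg A Cg (Dom C f)) (deg A Cg (Dom C g)))"
  and Assoc_Z: "Assoc Z X Y V =
    (\<i>\<d> (X \<odot> Y \<odot> V) \<star> nu (deg A Cg X) (deg A Cg Y) (deg A Cg V)) \<cdot>
    (\<i>\<d> (X \<odot> Y) \<star> under (lam (deg A Cg X) (deg A Cg Y)) V \<star>
      \<i>\<d> (lam (deg A Cg X \<otimes>\<^bsub>A\<^esub> deg A Cg Y) (deg A Cg V)))"
  and Braid_Z: "\<beta>\<^bsub>Z\<^esub> X Y = \<beta> X Y \<star> t (deg A Cg X) (deg A Cg Y)"
  by (simp_all add: zested_def Let_def under_def)

lemma minv_Z [simp]: "minv Z = minv C"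
  by (simp add: minv_def inverse_mors_def hom_set_def fun_eq_iff)

text \<open>Degree as a relation, so that it can be derived by rules for products and duals.
  Excluding zero objects makes it single-valued.\<close>

definition hdeg :: "'o \<Rightarrow> 'a \<Rightarrow> bool" where
  "hdeg X a \<longleftrightarrow> a \<in> carrier A \<and> X \<in> Cg a \<and> \<not> zero_object C X"

lemma hdeg_carrier: "hdeg X a \<Longrightarrow> a \<in> carrier A"
  by (simp add: hdeg_def)

lemma hdeg_deg:
  assumes "hdeg X a"
  shows "deg A Cg X = a"
  unfolding deg_def
proof (rule the_equality)
  fix b
  assume b: "b \<in> carrier A \<and> X \<in> Cg b"
  show "b = a"
  proof (rule ccontr)
    assume "b \<noteq> a"
    then have "hom_set C X X = {Zero C X X}"
      using b assms orthogonal[of b a X X] by (simp add: hdeg_def)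
    then show False
      using assms Id_in_hom[of X] by (simp add: hdeg_def zero_object_iff)
  qed
qed (use assms in \<open>simp add: hdeg_def\<close>)

lemma hdeg_homogeneous: "homogeneous C A Cg X \<Longrightarrow> hdeg X (deg A Cg X)"
  using hdeg_deg unfolding homogeneous_def hdeg_def by metis

lemma hdeg_TenO: "hdeg X a \<Longrightarrow> hdeg Y b \<Longrightarrow> hdeg (X \<odot> Y) (a \<otimes>\<^bsub>A\<^esub> b)"
  using TenO_graded zero_object_TenO by (auto simp: hdeg_def)

lemma hdeg_Dual: "hdeg X a \<Longrightarrow> hdeg (Dual C X) (inv\<^bsub>A\<^esub> a)"
  using Dual_graded[OF category_grading_axioms] zero_object_Dual by (auto simp: hdeg_def)

lemma hdeg_Inv_e: "L \<in> Inv_e C A Cg \<Longrightarrow> hdeg L \<one>\<^bsub>A\<^esub>"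
  using not_zero_object_invertible by (auto simp: hdeg_def Inv_e_def)

lemma Inv_e_iff: "L \<in> Inv_e C A Cg \<longleftrightarrow> L \<in> invertible_objects C \<and> hdeg L \<one>\<^bsub>A\<^esub>"
  using not_zero_object_invertible by (auto simp: hdeg_def Inv_e_def)

lemma Inv_e_Unit: "\<I> \<in> Inv_e C A Cg"
  using invertible_Unit Unit_graded[OF category_grading_axioms] by (simp add: Inv_e_def)

lemma Inv_e_TenO: "L \<in> Inv_e C A Cg \<Longrightarrow> M \<in> Inv_e C A Cg \<Longrightarrow> L \<odot> M \<in> Inv_e C A Cg"
  using invertible_TenO hdeg_TenO[of L "\<one>\<^bsub>A\<^esub>" M "\<one>\<^bsub>A\<^esub>"] by (simp add: Inv_e_iff)

lemma Inv_e_Dual: "L \<in> Inv_e C A Cg \<Longrightarrow> Dual C L \<in> Inv_e C A Cg"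
  using invertible_Dual hdeg_Dual[of L "\<one>\<^bsub>A\<^esub>"] by (simp add: Inv_e_iff)

lemma ex_dbraid_Inv_e:
  assumes "L \<in> Inv_e C A Cg" "hdeg X a"
  obtains c where "dbraid L X c" "c \<noteq> 0"
proof -
  obtain c where "dbraid L X c"
    using ex_dbraid_homogeneous[OF universal_grading_axioms, of L a X] assms
    by (auto simp: Inv_e_def hdeg_def)
  then show thesis
    using that dbraid_nonzero assms by (auto simp: Inv_e_def hdeg_def)
qed

lemma Dom_nu [simp]: "a \<in> carrier A \<Longrightarrow> b \<in> carrier A \<Longrightarrow> c \<in> carrier A \<Longrightarrow>
    Dom C (nu a b c) = lam a b \<odot> lam (a \<otimes>\<^bsub>A\<^esub> b) c"
  and Cod_nu [simp]: "a \<in> carrier A \<Longrightarrow> b \<in> carrier A \<Longrightarrow> c \<in> carrier A \<Longrightarrow>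
    Cod C (nu a b c) = lam b c \<odot> lam a (b \<otimes>\<^bsub>A\<^esub> c)"
  using nu_in_hom[of a b c] by (simp_all add: hom_iff)

lemma Dom_t [simp]: "a \<in> carrier A \<Longrightarrow> b \<in> carrier A \<Longrightarrow> Dom C (t a b) = lam a b"
  and Cod_t [simp]: "a \<in> carrier A \<Longrightarrow> b \<in> carrier A \<Longrightarrow> Cod C (t a b) = lam b a"
  using t_in_hom[of a b] by (simp_all add: hom_iff)

lemma lam_one_left [simp]: "a \<in> carrier A \<Longrightarrow> lam \<one>\<^bsub>A\<^esub> a = \<I>"
  and lam_one_right [simp]: "a \<in> carrier A \<Longrightarrow> lam a \<one>\<^bsub>A\<^esub> = \<I>"
  using lam_one by auto

declare nu_iso [simp] t_iso [simp]

subsection \<open>Points and words\<close>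

definition pdeg :: "'o point \<Rightarrow> 'a" where
  "pdeg p = (if snd p then deg A Cg (fst p) else inv\<^bsub>A\<^esub> (deg A Cg (fst p)))"

text \<open>The factor by which the object of a boundary point in the zested category exceeds its object in
  the original category.\<close>

definition dpart :: "'o point \<Rightarrow> 'o" where
  "dpart p = (if snd p then \<I> else Dual C (lam (deg A Cg (fst p)) (inv\<^bsub>A\<^esub> (deg A Cg (fst p)))))"

abbreviation hpoint :: "'o point \<Rightarrow> bool" where
  "hpoint p \<equiv> homogeneous C A Cg (fst p)"

abbreviation pobj :: "'o point \<Rightarrow> 'o" where
  "pobj \<equiv> point_obj C"

lemma point_obj_Z: "point_obj Z p = pobj p \<odot> dpart p"
  by (simp add: point_obj_def dpart_def zested_def Let_def)

lemma hdeg_pobj: "hpoint p \<Longrightarrow> hdeg (pobj p) (pdeg p)"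
  using hdeg_homogeneous hdeg_Dual by (auto simp: point_obj_def pdeg_def)

lemma pdeg_carrier [simp]: "hpoint p \<Longrightarrow> pdeg p \<in> carrier A"
  using hdeg_pobj hdeg_carrier by blast

lemma dpart_Inv_e: "hpoint p \<Longrightarrow> dpart p \<in> Inv_e C A Cg"
  using hdeg_carrier[OF hdeg_homogeneous] by (auto simp: dpart_def intro!: Inv_e_Unit lam_Inv Inv_e_Dual)

lemma hdeg_point_obj_Z: "hpoint p \<Longrightarrow> hdeg (pobj p \<odot> dpart p) (pdeg p)"
  using hdeg_TenO[OF hdeg_pobj hdeg_Inv_e[OF dpart_Inv_e], of p p] by simp

lemma deg_point_obj_Z [simp]: "hpoint p \<Longrightarrow> deg A Cg (pobj p \<odot> dpart p) = pdeg p"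
  using hdeg_point_obj_Z hdeg_deg by blast

section \<open>Degrees and shapes of words\<close>

fun wdeg :: "'o point list \<Rightarrow> 'a" where
  "wdeg [] = \<one>\<^bsub>A\<^esub>"
| "wdeg (p # w) = pdeg p \<otimes>\<^bsub>A\<^esub> wdeg w"

abbreviation hword :: "'o point list \<Rightarrow> bool" where
  "hword w \<equiv> \<forall>p \<in> set w. hpoint p"

lemma wdeg_carrier [simp]: "hword w \<Longrightarrow> wdeg w \<in> carrier A"
  by (induction w) auto

lemma wdeg_append: "hword u \<Longrightarrow> hword w \<Longrightarrow> wdeg (u @ w) = wdeg u \<otimes>\<^bsub>A\<^esub> wdeg w"
  by (induction u) (auto simp: A.m_assoc)

text \<open>As in \<open>mu_from\<close>, \<open>c\<close> is the total degree of the points to the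
  left.\<close>

definition wshape :: "'a \<Rightarrow> 'o point list \<Rightarrow> 'o \<times> 'o \<times> 'm" where
  "wshape c w = shape (zip (map pobj w) (mu_from C A Cg lam c w))"

lemma wshape_Nil [simp]: "wshape c [] = pr \<I> \<I>"
  by (simp add: wshape_def)

lemma wshape_Cons [simp]:
  "wshape c (p # w) = pr (pobj p) (dpart p \<odot> lam c (pdeg p)) \<bowtie> wshape (c \<otimes>\<^bsub>A\<^esub> pdeg p) w"
proof -
  obtain X d where "p = (X, d)"
    by (cases p)
  then show ?thesis
    by (simp add: wshape_def pdeg_def dpart_def Let_def)
qed

lemma valid_wshape [simp]: "valid (wshape c w)"
  by (simp add: wshape_def)

lemma wshape_append:
  assumes "hword u" "hword w" "c \<in> carrier A"
  shows "wshape c (u @ w) = wshape c u \<bowtie> wshape (c \<otimes>\<^bsub>A\<^esub> wdeg u) w"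
  using assms by (induction u arbitrary: c) (auto simp: box_assoc A.m_assoc)

lemma word_obj_append: "word_obj C (u @ w) = word_obj C u \<odot> word_obj C w"
proof -
  have "foldl (TenO C) X Xs = X \<odot> foldl (TenO C) \<I> Xs" for X Xs
  proof (induction Xs arbitrary: X)
    case (Cons Y Ys)
    show ?case
      using Cons.IH[of "X \<odot> Y"] Cons.IH[of Y] by simp
  qed simp
  then show ?thesis
    by (metis word_obj_def foldl_append map_append)
qed

lemma word_obj_simps [simp]: "word_obj C [] = \<I>" "word_obj C (p # w) = pobj p \<odot> word_obj C w"
  using word_obj_append[of "[p]" w] by (simp_all add: word_obj_def)

lemma fst_wshape: "fst (wshape c w) = word_obj C w"
  by (induction w arbitrary: c) simp_all

lemma fst_snd_wshape: "fst (snd (wshape c w)) = tensor_list C (mu_from C A Cg lam c w)"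
proof (induction w arbitrary: c)
  case (Cons p w)
  obtain X d where "p = (X, d)"
    by (cases p)
  then show ?case
    using Cons.IH by (simp add: pdeg_def dpart_def Let_def)
qed simp

lemma Inv_e_wshape: "hword w \<Longrightarrow> c \<in> carrier A \<Longrightarrow> fst (snd (wshape c w)) \<in> Inv_e C A Cg"
  by (induction w arbitrary: c) (auto intro!: Inv_e_TenO Inv_e_Unit dpart_Inv_e lam_Inv)

text \<open>The product is left-associated, so the induction adds points at the end. The degree is
  carried along because the factor \<open>lam\<close> added with the last point depends on the
  degree of everything before it.\<close>

lemma word_obj_Z:
  assumes "hword w"
  shows "word_obj Z w = source (wshape \<one>\<^bsub>A\<^esub> w) \<and> hdeg (source (wshape \<one>\<^bsub>A\<^esub> w)) (wdeg w)"
  using assms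
proof (induction w rule: rev_induct)
  case Nil
  then show ?case
    using hdeg_Inv_e[OF Inv_e_Unit] by (simp add: word_obj_def)
next
  case (snoc p w)
  let ?W = "source (wshape \<one>\<^bsub>A\<^esub> w)"
  have IH: "word_obj Z w = ?W" "hdeg ?W (wdeg w)" and p: "hpoint p" and w: "hword w"
    using snoc by auto
  have "wshape \<one>\<^bsub>A\<^esub> (w @ [p]) = wshape \<one>\<^bsub>A\<^esub> w \<bowtie> pr (pobj p) (dpart p \<odot> lam (wdeg w) (pdeg p))"
    using p w by (subst wshape_append) simp_all
  then have src: "source (wshape \<one>\<^bsub>A\<^esub> (w @ [p])) = ?W \<odot> pobj p \<odot> dpart p \<odot> lam (wdeg w) (pdeg p)"
    by simp
  have "word_obj Z (w @ [p]) = TenO Z (word_obj Z w) (point_obj Z p)"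
    by (simp add: word_obj_def)
  also have "\<dots> = ?W \<odot> pobj p \<odot> dpart p \<odot> lam (wdeg w) (pdeg p)"
    using p hdeg_deg[OF IH(2)] by (simp add: IH(1) point_obj_Z TenO_Z)
  moreover have "hdeg (?W \<odot> (pobj p \<odot> dpart p) \<odot> lam (wdeg w) (pdeg p)) (wdeg w \<otimes>\<^bsub>A\<^esub> (pdeg p \<otimes>\<^bsub>A\<^esub> \<one>\<^bsub>A\<^esub>))"
    using p w by (intro hdeg_TenO IH(2) hdeg_point_obj_Z hdeg_Inv_e lam_Inv) simp_all
  ultimately show ?case
    using p w src by (simp add: wdeg_append)
qed

subsection \<open>Elementary pieces\<close>

text \<open>Elementary pieces are bounded by words of length 0 and 2; the second equation also
  serves as a default for other lengths. The factor \<open>lam\<close> is kept apart from the second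
  point because the zested braiding acts on it separately, by \<open>t\<close>.\<close>

fun eshape :: "'o point list \<Rightarrow> 'o \<times> 'o \<times> 'm" where
  "eshape [p, q] = pr (pobj p) (dpart p) \<bowtie> pr (pobj q) (dpart q) \<bowtie> pr \<I> (lam (pdeg p) (pdeg q))"
| "eshape w = pr \<I> \<I>"

lemma valid_eshape [simp]: "valid (eshape w)"
  by (cases w rule: eshape.cases) simp_all

text \<open>The factor \<open>dpart p\<close> passes over the strand \<open>q\<close>, which costs
  the scalar \<open>c\<close>. As \<open>c\<close> is nonzero, \<open>j\<close> is invertible, as
  the inverse crossing requires.\<close>

lemma warps_Braid_Z:
  assumes "hpoint p" "hpoint q"
  shows "\<exists>j. is_iso C j \<and> warps (eshape [p, q]) (eshape [q, p]) (\<beta> (pobj p) (pobj q)) j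
    (\<beta>\<^bsub>Z\<^esub> (point_obj Z p) (point_obj Z q))"
proof -
  obtain c where c: "dbraid (dpart p) (pobj q) c" "c \<noteq> 0"
    using ex_dbraid_Inv_e[OF dpart_Inv_e hdeg_pobj] assms by blast
  let ?j = "Smult C c (\<beta> (dpart p) (dpart q))"
  have "warps (pr \<I> (lam (pdeg p) (pdeg q))) (pr \<I> (lam (pdeg q) (pdeg p))) (\<i>\<d> \<I>) (t (pdeg p) (pdeg q))
      (t (pdeg p) (pdeg q))"
    using warps_pr[of "\<i>\<d> \<I>" "t (pdeg p) (pdeg q)"] assms by simp
  from warps_TenM[OF _ _ _ _ warps_Braid[OF c(1)] this]
  have "warps (eshape [p, q]) (eshape [q, p]) (\<beta> (pobj p) (pobj q)) (?j \<star> t (pdeg p) (pdeg q))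
      (\<beta> (pobj p \<odot> dpart p) (pobj q \<odot> dpart q) \<star> t (pdeg p) (pdeg q))"
    by (simp add: box_assoc)
  moreover have "is_iso C (?j \<star> t (pdeg p) (pdeg q))"
    using c(2) assms by (intro is_iso_TenM is_iso_Smult) simp_all
  moreover have "\<beta>\<^bsub>Z\<^esub> (point_obj Z p) (point_obj Z q) =
      \<beta> (pobj p \<odot> dpart p) (pobj q \<odot> dpart q) \<star> t (pdeg p) (pdeg q)"
    using assms by (simp add: point_obj_Z Braid_Z)
  ultimately show ?thesis
    by metis
qed

text \<open>The crossing in the zested evaluation, of the dual of \<open>lam\<close> under
  \<open>X\<close>, is the one that the source triple prescribes; \<open>j\<close> is the rest of
  the formula.\<close>

lemma warps_Ev_Z:
  assumes "homogeneous C A Cg X"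
  shows "\<exists>j. warps (eshape [(X, False), (X, True)]) (pr \<I> \<I>) (Ev C X) j (Ev Z X)"
proof -
  let ?a = "deg A Cg X"
  let ?L = "lam ?a (inv\<^bsub>A\<^esub> ?a)"
  have a: "?a \<in> carrier A"
    using assms hdeg_homogeneous hdeg_carrier by blast
  let ?j = "Ev C ?L \<cdot> (\<i>\<d> (Dual C ?L) \<star> minv C (nu ?a (inv\<^bsub>A\<^esub> ?a) ?a))"
  have "warps (eshape [(X, False), (X, True)]) (pr \<I> \<I>) (Ev C X) ?j (Ev Z X)"
    using a by (simp add: pr_def pdeg_def dpart_def point_obj_def zested_def Let_def under_def TenM_Id)
  then show ?thesis
    by blast
qed

text \<open>Here the target triple has no crossing: the downward strand carries no extra factor, and
  the factors of the upward strand already stand at the right end.\<close>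

lemma warps_Coev_Z:
  assumes "homogeneous C A Cg X"
  shows "\<exists>j. warps (pr \<I> \<I>) (eshape [(X, True), (X, False)]) (Coev C X) j (Coev Z X)"
proof -
  let ?a = "deg A Cg X"
  let ?L = "lam ?a (inv\<^bsub>A\<^esub> ?a)"
  have a: "?a \<in> carrier A"
    using assms hdeg_homogeneous hdeg_carrier by blast
  let ?j = "Smult C (inverse (qdim C ?L)) (Coev' C ?L)"
  have "Dom C (Coev' C ?L) = \<I>" "Cod C (Coev' C ?L) = Dual C ?L \<odot> ?L"
    by (simp_all add: Coev'_def)
  then have "warps (pr \<I> \<I>) (eshape [(X, True), (X, False)]) (Coev C X) ?j (Coev Z X)"
    using warps_pr[of "Coev C X" ?j]
    by (simp add: pdeg_def dpart_def point_obj_def zested_def Let_def)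
  then show ?thesis
    by blast
qed

lemma warps_Twist_Z:
  "\<exists>j. warps (pr X \<I>) (pr X \<I>) (\<theta> X) j (\<theta>\<^bsub>Z\<^esub> X)"
proof -
  have "\<theta>\<^bsub>Z\<^esub> X = Smult C (scalar_of C (t (deg A Cg X) (deg A Cg X)) * eps (deg A Cg X)) (\<theta> X)"
    by (simp add: zested_def Let_def)
  then show ?thesis
    using warps_Smult[OF _ warps_pr[of "\<theta> X" "\<i>\<d> \<I>"]] by auto
qed



lemma Dual_Z: "Dual Z X = point_obj Z (X, False)"
  by (simp add: point_obj_def)

lemma point_obj_True [simp]: "point_obj R (X, True) = X"
  by (simp add: point_obj_def)

lemma dpart_True [simp]: "dpart (X, True) = \<I>"
  by (simp add: dpart_def)

lemma pdeg_True [simp]: "pdeg (X, True) = deg A Cg X"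
  by (simp add: pdeg_def)

text \<open>The right evaluation and coevaluation are composites of the left ones with a braiding
  and a twist, by the same formula in both categories, so closure under composition reduces them to
  the cases already treated.\<close>

lemma elementary_warps:
  assumes "hword (top_of g)" "hword (bot_of g)"
  shows "\<exists>j. warps (eshape (top_of g)) (eshape (bot_of g)) (elementary_mor C g) j (elementary_mor Z g)"
proof (cases g)
  case (OverX p q)
  then show ?thesis
    using warps_Braid_Z[of p q] assms by auto
next
  case (UnderX p q)
  then obtain j where j: "is_iso C j" "warps (eshape [q, p]) (eshape [p, q]) (\<beta> (pobj q) (pobj p)) j
      (\<beta>\<^bsub>Z\<^esub> (point_obj Z q) (point_obj Z p))"
    using warps_Braid_Z[of q p] assms by auto
  have "is_iso C (\<beta>\<^bsub>Z\<^esub> (point_obj Z q) (point_obj Z p))"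
    using assms UnderX by (simp add: point_obj_Z Braid_Z)
  then show ?thesis
    using warps_minv[OF _ _ j(2)] j(1) UnderX by auto
next
  case (Cap p)
  obtain X d where p: "p = (X, d)"
    by (cases p)
  have X: "homogeneous C A Cg X"
    using assms Cap p by simp
  show ?thesis
  proof (cases d)
    case False
    then show ?thesis
      using warps_Ev_Z[OF X] Cap p by (auto simp: flip_def)
  next
    case True
    let ?u = "(X, True)" and ?d = "(X, False)"
    obtain j1 where j1: "warps (eshape [?d, ?u]) (pr \<I> \<I>) (Ev C X) j1 (Ev Z X)"
      using warps_Ev_Z[OF X] by blast
    obtain j2 where j2: "warps (eshape [?u, ?d]) (eshape [?d, ?u]) (\<beta> X (pobj ?d)) j2 (\<beta>\<^bsub>Z\<^esub> X (Dual Z X))"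
      using warps_Braid_Z[of ?u ?d] X by (auto simp: Dual_Z)
    obtain j3 where j3: "warps (pr X \<I>) (pr X \<I>) (\<theta> X) j3 (\<theta>\<^bsub>Z\<^esub> X)"
      using warps_Twist_Z by blast
    \<comment> \<open>All that stands to the right of the twist, including the factor
      \<open>lam\<close> that the zested tensor product of morphisms appends as an identity.\<close>
    let ?R = "pr (pobj ?d) (dpart ?d) \<bowtie> pr \<I> (lam (pdeg ?u) (pdeg ?d))"
    have "\<theta>\<^bsub>Z\<^esub> X \<star>\<^bsub>Z\<^esub> \<i>\<d> (Dual Z X) = \<theta>\<^bsub>Z\<^esub> X \<star> \<i>\<d> (source ?R)"
      using warps_typing[OF j3] X by (simp add: TenM_Z Dual_Z point_obj_Z TenM_Id)
    then have "\<exists>j. warps (eshape [?u, ?d]) (eshape [?u, ?d]) (\<theta> X \<star> \<i>\<d> (pobj ?d)) j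
        (\<theta>\<^bsub>Z\<^esub> X \<star>\<^bsub>Z\<^esub> \<i>\<d> (Dual Z X))"
      using warps_TenM[OF _ _ _ _ j3 warps_Id[of ?R]] by auto
    then obtain j4 where j4: "warps (eshape [?u, ?d]) (eshape [?u, ?d]) (\<theta> X \<star> \<i>\<d> (pobj ?d)) j4
        (\<theta>\<^bsub>Z\<^esub> X \<star>\<^bsub>Z\<^esub> \<i>\<d> (Dual Z X))"
      by blast
    have "elementary_mor Z g = Ev Z X \<cdot> \<beta>\<^bsub>Z\<^esub> X (Dual Z X) \<cdot> (\<theta>\<^bsub>Z\<^esub> X \<star>\<^bsub>Z\<^esub> \<i>\<d> (Dual Z X))"
      using Cap p True by (simp add: Ev'_def)
    moreover have "elementary_mor C g = Ev C X \<cdot> \<beta> X (pobj ?d) \<cdot> (\<theta> X \<star> \<i>\<d> (pobj ?d))"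
      using Cap p True by (simp add: Ev'_def point_obj_def)
    moreover have "top_of g = [?u, ?d]" "eshape (bot_of g) = pr \<I> \<I>"
      using Cap p True by (simp_all add: flip_def)
    ultimately show ?thesis
      using warps_Cmp[OF _ _ _ warps_Cmp[OF _ _ _ j4 j2] j1] valid_eshape valid_pr by metis
  qed
next
  case (Cup p)
  obtain X d where p: "p = (X, d)"
    by (cases p)
  have X: "homogeneous C A Cg X"
    using assms Cup p by simp
  show ?thesis
  proof (cases d)
    case True
    then show ?thesis
      using warps_Coev_Z[OF X] Cup p by (auto simp: flip_def)
  next
    case False
    let ?u = "(X, True)" and ?d = "(X, False)"
    obtain j1 where j1: "warps (pr \<I> \<I>) (eshape [?u, ?d]) (Coev C X) j1 (Coev Z X)"
      using warps_Coev_Z[OF X] by blast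
    obtain j2 where j2: "warps (eshape [?u, ?d]) (eshape [?d, ?u]) (\<beta> X (pobj ?d)) j2 (\<beta>\<^bsub>Z\<^esub> X (Dual Z X))"
      using warps_Braid_Z[of ?u ?d] X by (auto simp: Dual_Z)
    obtain j3 where j3: "warps (pr X \<I>) (pr X \<I>) (\<theta> X) j3 (\<theta>\<^bsub>Z\<^esub> X)"
      using warps_Twist_Z by blast
    \<comment> \<open>The zested tensor product surrounds the twist by the dual on the left and by
      the factor \<open>lam\<close> on the right.\<close>
    let ?S = "pr (pobj ?d) (dpart ?d)" and ?R = "pr \<I> (lam (pdeg ?d) (pdeg ?u))"
    have "\<i>\<d> (Dual Z X) \<star>\<^bsub>Z\<^esub> \<theta>\<^bsub>Z\<^esub> X = \<i>\<d> (source ?S) \<star> \<theta>\<^bsub>Z\<^esub> X \<star> \<i>\<d> (source ?R)"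
      using warps_typing[OF j3] X by (simp add: TenM_Z Dual_Z point_obj_Z TenM_Id)
    then have "\<exists>j. warps (eshape [?d, ?u]) (eshape [?d, ?u]) (\<i>\<d> (pobj ?d) \<star> \<theta> X) j
        (\<i>\<d> (Dual Z X) \<star>\<^bsub>Z\<^esub> \<theta>\<^bsub>Z\<^esub> X)"
      using warps_TenM[OF _ _ _ _ warps_Id[of ?S] warps_TenM[OF _ _ _ _ j3 warps_Id[of ?R]]]
      by (auto simp del: box_pr_right box_pr_left)
    then obtain j4 where j4: "warps (eshape [?d, ?u]) (eshape [?d, ?u]) (\<i>\<d> (pobj ?d) \<star> \<theta> X) j4
        (\<i>\<d> (Dual Z X) \<star>\<^bsub>Z\<^esub> \<theta>\<^bsub>Z\<^esub> X)"
      by blast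
    have "elementary_mor Z g = (\<i>\<d> (Dual Z X) \<star>\<^bsub>Z\<^esub> \<theta>\<^bsub>Z\<^esub> X) \<cdot> \<beta>\<^bsub>Z\<^esub> X (Dual Z X) \<cdot> Coev Z X"
      using Cup p False by (simp add: Coev'_def)
    moreover have "elementary_mor C g = (\<i>\<d> (pobj ?d) \<star> \<theta> X) \<cdot> \<beta> X (pobj ?d) \<cdot> Coev C X"
      using Cup p False by (simp add: Coev'_def point_obj_def)
    moreover have "bot_of g = [?d, ?u]" "eshape (top_of g) = pr \<I> \<I>"
      using Cup p False by (simp_all add: flip_def)
    ultimately show ?thesis
      using warps_Cmp[OF _ _ _ warps_Cmp[OF _ _ _ j1 j2] j4] valid_eshape valid_pr
      by (metis Cmp_assoc_right warps_typing)
  qed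
qed

subsection \<open>Diagrams\<close>

text \<open>For two points, the zested associator moves \<open>lam (wdeg P) (pdeg p)\<close>
  underneath the second point and then applies \<open>nu\<close>. The first is a warp of an identity
  by \<open>warps_under\<close>, the second acts on invertible factors only. For the empty word all
  factors involved are units.\<close>

lemma split_word_warps:
  assumes P: "hword P" and u: "hword u" "u = [] \<or> (\<exists>p q. u = [p, q])"
  shows "\<exists>j. is_iso C j \<and> is_iso C (split_word Z P u) \<and>
    warps (wshape \<one>\<^bsub>A\<^esub> (P @ u)) (wshape \<one>\<^bsub>A\<^esub> P \<bowtie> eshape u \<bowtie> pr \<I> (lam (wdeg P) (wdeg u)))
      (\<i>\<d> (word_obj C (P @ u))) j (split_word Z P u)"
  using u(2)
proof
  assume "u = []"
  moreover have "warps (wshape \<one>\<^bsub>A\<^esub> P) (wshape \<one>\<^bsub>A\<^esub> P) (\<i>\<d> (word_obj C P))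
      (\<i>\<d> (fst (snd (wshape \<one>\<^bsub>A\<^esub> P)))) (\<i>\<d> (word_obj Z P))"
    using warps_Id[of "wshape \<one>\<^bsub>A\<^esub> P"] word_obj_Z[OF P] by (simp add: fst_wshape)
  ultimately show ?thesis
    using P by (intro exI[of _ "\<i>\<d> (fst (snd (wshape \<one>\<^bsub>A\<^esub> P)))"]) simp
next
  assume "\<exists>p q. u = [p, q]"
  then obtain p q where pq: "u = [p, q]" "hpoint p" "hpoint q"
    using u(1) by auto
  let ?S = "wshape \<one>\<^bsub>A\<^esub> P" and ?c = "wdeg P" and ?a = "pdeg p" and ?b = "pdeg q"
  let ?p = "pr (pobj p) (dpart p)" and ?q = "pr (pobj q) (dpart q)"
  let ?W = "source ?S"
  let ?lca = "lam ?c ?a" and ?lcab = "lam (?c \<otimes>\<^bsub>A\<^esub> ?a) ?b"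
  have c: "?c \<in> carrier A" "?a \<in> carrier A" "?b \<in> carrier A"
    using P pq by simp_all
  have "wshape \<one>\<^bsub>A\<^esub> (P @ u) = ?S \<bowtie> pr (pobj p) (dpart p \<odot> ?lca) \<bowtie> pr (pobj q) (dpart q \<odot> ?lcab)"
    using P pq c by (simp add: wshape_append)
  also have "\<dots> = ?S \<bowtie> (?p \<bowtie> pr \<I> ?lca) \<bowtie> (?q \<bowtie> pr \<I> ?lcab)"
    by simp
  also have "\<dots> = (?S \<bowtie> ?p) \<bowtie> (pr \<I> ?lca \<bowtie> ?q) \<bowtie> pr \<I> ?lcab"
    by (simp only: box_assoc valid_wshape valid_pr valid_box)
  finally have top: "wshape \<one>\<^bsub>A\<^esub> (P @ u) = (?S \<bowtie> ?p) \<bowtie> (pr \<I> ?lca \<bowtie> ?q) \<bowtie> pr \<I> ?lcab" .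
  \<comment> \<open>\<open>?M\<close> is the shape after the crossing, \<open>?M'\<close> the same
    shape with both \<open>lam\<close> factors collected at the right end, and \<open>?N\<close> the
    shape after \<open>nu\<close>.\<close>
  let ?M = "(?S \<bowtie> ?p) \<bowtie> pr (pobj q) (dpart q \<odot> ?lca) \<bowtie> pr \<I> ?lcab"
  let ?M' = "(?S \<bowtie> ?p \<bowtie> ?q) \<bowtie> pr \<I> (?lca \<odot> ?lcab)"
  let ?N = "(?S \<bowtie> ?p \<bowtie> ?q) \<bowtie> pr \<I> (lam ?a ?b \<odot> lam ?c (?a \<otimes>\<^bsub>A\<^esub> ?b))"
  have M: "?M = ?M'"
  proof -
    have "?M = (?S \<bowtie> ?p) \<bowtie> (?q \<bowtie> pr \<I> ?lca) \<bowtie> pr \<I> ?lcab"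
      by simp
    also have "\<dots> = (?S \<bowtie> ?p \<bowtie> ?q) \<bowtie> (pr \<I> ?lca \<bowtie> pr \<I> ?lcab)"
      by (simp only: box_assoc valid_wshape valid_pr valid_box)
    finally show ?thesis
      by simp
  qed
  have N: "?N = ?S \<bowtie> eshape u \<bowtie> pr \<I> (lam ?c (wdeg u))"
  proof -
    have "?N = (?S \<bowtie> ?p \<bowtie> ?q) \<bowtie> (pr \<I> (lam ?a ?b) \<bowtie> pr \<I> (lam ?c (?a \<otimes>\<^bsub>A\<^esub> ?b)))"
      by simp
    also have "\<dots> = ?S \<bowtie> (?p \<bowtie> ?q \<bowtie> pr \<I> (lam ?a ?b)) \<bowtie> pr \<I> (lam ?c (?a \<otimes>\<^bsub>A\<^esub> ?b))"
      by (simp only: box_assoc valid_wshape valid_pr valid_box)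
    finally show ?thesis
      using pq c by simp
  qed
  let ?h1 = "\<i>\<d> (source (?S \<bowtie> ?p)) \<star> under ?lca (pobj q \<odot> dpart q) \<star> \<i>\<d> (source (pr \<I> ?lcab))"
  let ?j1 = "\<i>\<d> (fst (snd (?S \<bowtie> ?p))) \<star> under ?lca (dpart q) \<star> \<i>\<d> (fst (snd (pr \<I> ?lcab)))"
  let ?f1 = "\<i>\<d> (fst (?S \<bowtie> ?p)) \<star> \<i>\<d> (pobj q) \<star> \<i>\<d> (fst (pr \<I> ?lcab))"
  have 1: "warps (wshape \<one>\<^bsub>A\<^esub> (P @ u)) ?M ?f1 ?j1 ?h1"
    unfolding top by (intro warps_TenM warps_Id warps_under valid_box valid_wshape valid_pr)
  let ?h2 = "\<i>\<d> (source (?S \<bowtie> ?p \<bowtie> ?q)) \<star> (\<i>\<d> \<I> \<star> nu ?c ?a ?b)"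
  let ?j2 = "\<i>\<d> (fst (snd (?S \<bowtie> ?p \<bowtie> ?q))) \<star> nu ?c ?a ?b"
  let ?f2 = "\<i>\<d> (fst (?S \<bowtie> ?p \<bowtie> ?q)) \<star> \<i>\<d> \<I>"
  have "warps (pr \<I> (?lca \<odot> ?lcab)) (pr \<I> (lam ?a ?b \<odot> lam ?c (?a \<otimes>\<^bsub>A\<^esub> ?b))) (\<i>\<d> \<I>) (nu ?c ?a ?b)
      (\<i>\<d> \<I> \<star> nu ?c ?a ?b)"
    using warps_pr[of "\<i>\<d> \<I>" "nu ?c ?a ?b"] c by simp
  then have 2: "warps ?M ?N ?f2 ?j2 ?h2"
    unfolding M by (intro warps_TenM warps_Id valid_box valid_wshape valid_pr)
  have h: "split_word Z P u = ?h2 \<cdot> ?h1"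
  proof -
    have "deg A Cg (word_obj Z P) = ?c" "word_obj Z P = ?W"
      using word_obj_Z[OF P] hdeg_deg by auto
    then have "split_word Z P u = (\<i>\<d> (?W \<odot> pobj p \<odot> dpart p \<odot> pobj q \<odot> dpart q) \<star> nu ?c ?a ?b) \<cdot>
        (\<i>\<d> (?W \<odot> pobj p \<odot> dpart p) \<star> under ?lca (pobj q \<odot> dpart q) \<star> \<i>\<d> ?lcab)"
      using pq by (simp add: point_obj_Z Assoc_Z)
    then show ?thesis
      by simp
  qed
  have "warps (wshape \<one>\<^bsub>A\<^esub> (P @ u)) ?N (?f2 \<cdot> ?f1) (?j2 \<cdot> ?j1) (split_word Z P u)"
    unfolding h by (rule warps_Cmp[OF _ _ _ 1 2]) simp_all
  moreover have "?f2 \<cdot> ?f1 = \<i>\<d> (word_obj C (P @ u))"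
    using pq by (simp add: fst_wshape word_obj_append TenM_Id)
  moreover have "is_iso C (?j2 \<cdot> ?j1)" "is_iso C (split_word Z P u)"
    unfolding h using c by simp_all
  ultimately show ?thesis
    unfolding N by metis
qed

text \<open>Caps and cups have trivial degree, and crossings permute two factors of an abelian
  group. Hence a slice does not change the factors \<open>lam\<close> attached to the strands on its
  right.\<close>

lemma wdeg_bot_of:
  assumes "hword (top_of g)" "hword (bot_of g)"
  shows "wdeg (bot_of g) = wdeg (top_of g)"
proof -
  have flip: "pdeg p \<otimes>\<^bsub>A\<^esub> pdeg (flip p) = \<one>\<^bsub>A\<^esub>" if "hpoint p" for p
    using hdeg_carrier[OF hdeg_homogeneous[OF that]] by (simp add: pdeg_def flip_def)
  show ?thesis
    using assms flip by (cases g) (simp_all add: A.m_comm)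
qed

lemma top_bot_length:
  "top_of g = [] \<or> (\<exists>p q. top_of g = [p, q])" "bot_of g = [] \<or> (\<exists>p q. bot_of g = [p, q])"
  by (cases g; simp)+

lemma slice_mor_C:
  "slice_mor C (P, g, Q) = \<i>\<d> (word_obj C P) \<star> elementary_mor C g \<star> \<i>\<d> (word_obj C Q)"
proof -
  have typing: "Dom C (elementary_mor C g) = word_obj C (top_of g)"
    "Cod C (elementary_mor C g) = word_obj C (bot_of g)"
    by (cases g; auto simp: Ev'_def Coev'_def point_obj_def flip_def)+
  have split: "split_word C P u = \<i>\<d> (word_obj C (P @ u))" for u
    by (cases u rule: eshape.cases) (simp_all add: Assoc_strict word_obj_append)
  have "foldl (\<lambda>f q. f \<star> \<i>\<d> (pobj q)) h Q = h \<star> \<i>\<d> (word_obj C Q)" for h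
    by (induction Q arbitrary: h) (simp_all add: Id_TenO)
  then show ?thesis
    by (simp add: split typing word_obj_append)
qed

text \<open>Without strands on the right, the slice is the elementary piece conjugated by
  \<open>split_word\<close>. By left association, each further strand is then tensored on at the
  end.\<close>

lemma slice_warps:
  assumes "hword (slice_top (P, g, Q))" "hword (slice_bot (P, g, Q))"
  shows "\<exists>j. warps (wshape \<one>\<^bsub>A\<^esub> (slice_top (P, g, Q))) (wshape \<one>\<^bsub>A\<^esub> (slice_bot (P, g, Q)))
    (slice_mor C (P, g, Q)) j (slice_mor Z (P, g, Q))"
  using assms
proof (induction Q rule: rev_induct)
  case Nil
  let ?u = "top_of g" and ?v = "bot_of g"
  have h: "hword P" "hword ?u" "hword ?v"
    using Nil by auto
  let ?S = "wshape \<one>\<^bsub>A\<^esub> P"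
  obtain j1 where j1: "is_iso C (split_word Z P ?u)"
    "warps (wshape \<one>\<^bsub>A\<^esub> (P @ ?u)) (?S \<bowtie> eshape ?u \<bowtie> pr \<I> (lam (wdeg P) (wdeg ?u)))
      (\<i>\<d> (word_obj C (P @ ?u))) j1 (split_word Z P ?u)"
    using split_word_warps[of P ?u] h top_bot_length by blast
  obtain j2 where j2: "is_iso C j2" "is_iso C (split_word Z P ?v)"
    "warps (wshape \<one>\<^bsub>A\<^esub> (P @ ?v)) (?S \<bowtie> eshape ?v \<bowtie> pr \<I> (lam (wdeg P) (wdeg ?u)))
      (\<i>\<d> (word_obj C (P @ ?v))) j2 (split_word Z P ?v)"
    using split_word_warps[of P ?v] h top_bot_length wdeg_bot_of[OF h(2,3)] by metis
  obtain j where j: "warps (eshape ?u) (eshape ?v) (elementary_mor C g) j (elementary_mor Z g)"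
    using elementary_warps h by blast
  have deg: "deg A Cg (word_obj Z P) = wdeg P" "word_obj Z P = source ?S"
    using word_obj_Z[OF h(1)] hdeg_deg by auto
  \<comment> \<open>This degree determines the factor \<open>lam\<close> that the zested tensor
    product with the identity of \<open>P\<close> appends.\<close>
  have dege: "deg A Cg (Dom C (elementary_mor Z g)) = wdeg ?u"
  proof -
    have "hdeg (source (eshape ?u)) (wdeg ?u)"
      using top_bot_length(1)[of g]
    proof
      assume "top_of g = []"
      then show ?thesis
        using hdeg_Inv_e[OF Inv_e_Unit] by simp
    next
      assume "\<exists>p q. top_of g = [p, q]"
      then obtain p q where pq: "top_of g = [p, q]"
        by blast
      have "hdeg ((pobj p \<odot> dpart p) \<odot> (pobj q \<odot> dpart q) \<odot> lam (pdeg p) (pdeg q))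
          (pdeg p \<otimes>\<^bsub>A\<^esub> (pdeg q \<otimes>\<^bsub>A\<^esub> \<one>\<^bsub>A\<^esub>))"
        using h(2) unfolding pq by (intro hdeg_TenO hdeg_point_obj_Z hdeg_Inv_e lam_Inv) simp_all
      then show ?thesis
        by (simp add: pq)
    qed
    then show ?thesis
      using warps_typing(5)[OF j] hdeg_deg by simp
  qed
  let ?R = "pr \<I> (lam (wdeg P) (wdeg ?u))"
  let ?h = "\<i>\<d> (source ?S) \<star> elementary_mor Z g \<star> \<i>\<d> (source ?R)"
  have mid: "warps (?S \<bowtie> eshape ?u \<bowtie> ?R) (?S \<bowtie> eshape ?v \<bowtie> ?R)
      (\<i>\<d> (fst ?S) \<star> elementary_mor C g \<star> \<i>\<d> (fst ?R))
      (\<i>\<d> (fst (snd ?S)) \<star> j \<star> \<i>\<d> (fst (snd ?R))) ?h"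
    by (intro warps_TenM warps_Id j valid_box valid_wshape valid_pr valid_eshape)
  have v: "valid (?S \<bowtie> eshape ?u \<bowtie> ?R)" "valid (?S \<bowtie> eshape ?v \<bowtie> ?R)"
    by simp_all
  note bot = warps_minv[OF valid_wshape v(2) j2(3) is_iso_Id j2(1,2)]
  note all = warps_Cmp[OF valid_wshape v(2) valid_wshape warps_Cmp[OF valid_wshape v(1) v(2) j1(2) mid] bot]
  have typing: "Dom C (elementary_mor C g) = word_obj C ?u" "Cod C (elementary_mor C g) = word_obj C ?v"
  proof -
    have "fst (eshape w) = word_obj C w" if "w = [] \<or> (\<exists>p q. w = [p, q])" for w
      using that by auto
    then show "Dom C (elementary_mor C g) = word_obj C ?u" "Cod C (elementary_mor C g) = word_obj C ?v"
      using warps_typing(1,2)[OF j] top_bot_length by metis+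
  qed
  have "slice_mor Z (P, g, []) = minv C (split_word Z P ?v) \<cdot> ?h \<cdot> split_word Z P ?u"
    using deg dege by (simp add: TenM_Z)
  moreover have "slice_mor C (P, g, []) = minv C (\<i>\<d> (word_obj C (P @ ?v))) \<cdot>
      (\<i>\<d> (fst ?S) \<star> elementary_mor C g \<star> \<i>\<d> (fst ?R)) \<cdot> \<i>\<d> (word_obj C (P @ ?u))"
    unfolding slice_mor_C by (simp add: fst_wshape typing word_obj_append)
  ultimately show ?case
    using all unfolding slice_top.simps slice_bot.simps append_Nil2 by metis
next
  case (snoc q Q)
  let ?u = "P @ top_of g @ Q" and ?v = "P @ bot_of g @ Q"
  have h: "hword ?u" "hword ?v" "hpoint q" "hword (top_of g)" "hword (bot_of g)" "hword P" "hword Q"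
    using snoc.prems by auto
  obtain j where j: "warps (wshape \<one>\<^bsub>A\<^esub> ?u) (wshape \<one>\<^bsub>A\<^esub> ?v) (slice_mor C (P, g, Q)) j (slice_mor Z (P, g, Q))"
    using snoc.IH h by (simp only: slice_top.simps slice_bot.simps) blast
  \<comment> \<open>Equal total degrees at top and bottom give the new strand the same factor
    \<open>lam\<close> on both sides, so it contributes an identity warp.\<close>
  have uv: "wdeg ?v = wdeg ?u"
    using h wdeg_bot_of[OF h(4,5)] by (simp add: wdeg_append)
  let ?R = "pr (pobj q) (dpart q \<odot> lam (wdeg ?u) (pdeg q))"
  have append: "wshape \<one>\<^bsub>A\<^esub> (w @ [q]) = wshape \<one>\<^bsub>A\<^esub> w \<bowtie> pr (pobj q) (dpart q \<odot> lam (wdeg w) (pdeg q))"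
    if "hword w" for w
    using that h(3) by (subst wshape_append) simp_all
  have "warps (wshape \<one>\<^bsub>A\<^esub> ?u \<bowtie> ?R) (wshape \<one>\<^bsub>A\<^esub> ?v \<bowtie> ?R)
      (slice_mor C (P, g, Q) \<star> \<i>\<d> (fst ?R)) (j \<star> \<i>\<d> (fst (snd ?R))) (slice_mor Z (P, g, Q) \<star> \<i>\<d> (source ?R))"
    by (intro warps_TenM warps_Id j valid_wshape valid_pr)
  moreover have "slice_mor C (P, g, Q @ [q]) = slice_mor C (P, g, Q) \<star> \<i>\<d> (fst ?R)"
    by simp
  moreover have "slice_mor Z (P, g, Q @ [q]) = slice_mor Z (P, g, Q) \<star> \<i>\<d> (source ?R)"
  proof -
    have "deg A Cg (Dom C (slice_mor Z (P, g, Q))) = wdeg ?u"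
      using warps_typing(5)[OF j] word_obj_Z[OF h(1)] hdeg_deg by simp
    moreover have "slice_mor Z (P, g, Q @ [q]) = slice_mor Z (P, g, Q) \<star>\<^bsub>Z\<^esub> \<i>\<d> (point_obj Z q)"
      by simp
    ultimately show ?thesis
      using h(3) unfolding TenM_Z by (simp add: point_obj_Z TenM_Id del: slice_mor.simps)
  qed
  ultimately show ?case
    using append[OF h(1)] append[OF h(2)] uv by (auto simp del: slice_mor.simps)
qed

section \<open>From slices to diagrams and tangles\<close>

lemma slices_warps:
  assumes "stacked w ss" "hword w" "\<forall>s \<in> set ss. hword (slice_top s) \<and> hword (slice_bot s)"
  shows "\<exists>j. warps (wshape \<one>\<^bsub>A\<^esub> w) (wshape \<one>\<^bsub>A\<^esub> (diagram_bot (w, ss))) (slices_mor C w ss) j (slices_mor Z w ss)"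
  using assms
proof (induction ss arbitrary: w)
  case Nil
  then show ?case
    using warps_Id[of "wshape \<one>\<^bsub>A\<^esub> w"] word_obj_Z[of w] by (auto simp: fst_wshape diagram_bot_def)
next
  case (Cons s ss)
  obtain P g Q where s: "s = (P, g, Q)"
    by (cases s)
  obtain j where j: "warps (wshape \<one>\<^bsub>A\<^esub> w) (wshape \<one>\<^bsub>A\<^esub> (slice_bot s)) (slice_mor C s) j (slice_mor Z s)"
    using slice_warps[of P g Q] Cons.prems unfolding s[symmetric] by auto
  obtain k where k: "warps (wshape \<one>\<^bsub>A\<^esub> (slice_bot s)) (wshape \<one>\<^bsub>A\<^esub> (diagram_bot (slice_bot s, ss)))
      (slices_mor C (slice_bot s) ss) k (slices_mor Z (slice_bot s) ss)"
    using Cons.IH[of "slice_bot s"] Cons.prems by auto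
  have "diagram_bot (slice_bot s, ss) = diagram_bot (w, s # ss)"
    by (simp add: diagram_bot_def)
  then show ?case
    using warps_Cmp[OF valid_wshape valid_wshape valid_wshape j k] by auto
qed

lemma diagram_warp:
  assumes "d \<in> diagrams" "\<forall>X \<in> labels d. homogeneous C A Cg X"
  shows "\<exists>j \<in> Inv_e_hom C A Cg (tensor_list C (mu C A Cg lam (diagram_top d)))
      (tensor_list C (mu C A Cg lam (diagram_bot d))).
    slices_mor Z (fst d) (snd d) = warp C (mu_pairs C A Cg lam (diagram_top d))
      (mu_pairs C A Cg lam (diagram_bot d)) (slices_mor C (fst d) (snd d)) j"
proof -
  obtain w ss where d: "d = (w, ss)"
    by (cases d)
  have st: "stacked w ss"
    using assms(1) d by (simp add: diagrams_def)
  have h: "hword w" "\<forall>s \<in> set ss. hword (slice_top s) \<and> hword (slice_bot s)"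
    using assms(2) unfolding d labels_def by fastforce+
  have hb: "hword (diagram_bot d)"
  proof (cases "ss = []")
    case False
    then show ?thesis
      using bspec[OF h(2) last_in_set[OF False]] by (simp add: d diagram_bot_def)
  qed (use h(1) in \<open>simp add: d diagram_bot_def\<close>)
  obtain j where j: "warps (wshape \<one>\<^bsub>A\<^esub> w) (wshape \<one>\<^bsub>A\<^esub> (diagram_bot d)) (slices_mor C w ss) j (slices_mor Z w ss)"
    using slices_warps[OF st h] d by blast
  then have "slices_mor Z w ss = warp C (mu_pairs C A Cg lam w) (mu_pairs C A Cg lam (diagram_bot d))
      (slices_mor C w ss) j"
    unfolding mu_pairs_def mu_def wshape_def by (rule warps_imp_warp)
  moreover have "j \<in> Inv_e_hom C A Cg (tensor_list C (mu C A Cg lam w))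
      (tensor_list C (mu C A Cg lam (diagram_bot d)))"
    using warps_typing(3,4)[OF j] Inv_e_wshape[OF h(1), of "\<one>\<^bsub>A\<^esub>"] Inv_e_wshape[OF hb, of "\<one>\<^bsub>A\<^esub>"]
    by (simp add: Inv_e_hom_def hom_iff mu_def fst_snd_wshape)
  ultimately show ?thesis
    by (auto simp: d diagram_top_def)
qed

end

lemma representative_mem:
  assumes "T \<in> tangles"
  shows "representative T \<in> T" "representative T \<in> diagrams"
proof -
  obtain d where d: "d \<in> diagrams" "T = isotopy `` {d}"
    using assms unfolding tangles_def by (rule quotientE)
  then have "d \<in> T"
    by (simp add: isotopy_def)
  then show "representative T \<in> T"
    unfolding representative_def by (rule someI)
  then show "representative T \<in> diagrams"
    unfolding d(2) isotopy_def by blast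
qed

theorem theorem7:
  fixes C :: "('o, 'm, 'k::{alg_closed_field,field_char_0}) ribbon_data"
    and A :: "'a monoid"
    and Cg :: "'a \<Rightarrow> 'o set"
    and lam :: "'a \<Rightarrow> 'a \<Rightarrow> 'o"
    and nu :: "'a \<Rightarrow> 'a \<Rightarrow> 'a \<Rightarrow> 'm"
    and t :: "'a \<Rightarrow> 'a \<Rightarrow> 'm"
    and eps :: "'a \<Rightarrow> 'k"
    and T :: "'o tangle"
  assumes "strict_ribbon_fusion_category C"
    and "comm_group A" and "finite (carrier A)"
    and "universal_grading C A Cg"
    and "ribbon_zesting C A Cg lam nu t eps"
    and "T \<in> tangles"
    and "homogeneous_tangle C A Cg T"
  shows "\<exists>j \<in> Inv_e_hom C A Cg
             (tensor_list C (mu C A Cg lam (tangle_top T)))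
             (tensor_list C (mu C A Cg lam (tangle_bot T))).
           RT (zested C A Cg lam nu t eps) T =
             warp C (mu_pairs C A Cg lam (tangle_top T)) (mu_pairs C A Cg lam (tangle_bot T))
               (RT C T) j"
proof -
  interpret zesting C A Cg lam nu t eps
    using assms by (intro zesting.intro)
  \<comment> \<open>Both invariants and both boundary words refer to the same representative of
    \<open>T\<close>, so the statement for diagrams applies to it.\<close>
  show ?thesis
    using diagram_warp[OF representative_mem(2)[OF assms(6)]] representative_mem(1)[OF assms(6)] assms(7)
    unfolding homogeneous_tangle_def tangle_top_def tangle_bot_def RT_def by (auto simp: case_prod_unfold)
qed

end
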